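(* Let $\gamma>1$, and let $\Phi_\varepsilon$, indexed by $\varepsilon>0$, be a sequence in $H^1_{\rm loc}(\mathbb{R};\mathbb{R}^2)$. Then: (i) If $J_\varepsilon(\Phi_\varepsilon)$ is bounded uniformly in $\varepsilon$ (i.e. $J_\varepsilon(\Phi_\varepsilon)\le C<\infty$ with $C$ independent of $\varepsilon$), then as $\varepsilon\to0$ there is a subsequence (not relabelled) and some $\Phi\in H^1_{\rm loc}(\mathbb{R};\mathbb{R}^2)$ with $\Phi_\varepsilon\rightharpoonup\Phi$ weakly in $H^1_{\rm loc}(\mathbb{R};\mathbb{R}^2)$. (ii) ($\Gamma$-liminf inequality) If $\Phi_\varepsilon\to\Phi$ in $L^2_{\rm loc}(\mathbb{R};\mathbb{R}^2)$ as $\varepsilon\to0$, then $\liminf_{\varepsilon\to0}J_\varepsilon(\Phi_\varepsilon)\ge J_0(\Phi)$. (iii) ($\Gamma$-limsup inequality) If $\Phi\in H^1_{\rm loc}(\mathbb{R};\mathbb{R}^2)$, then there is a sequence $\Phi_\varepsilon\in H^1_{\rm loc}(\mathbb{R};\mathbb{R}^2)$ such that, as $\varepsilon\to0$, $\Phi_\varepsilon\to\Phi$ in $L^2_{\rm loc}(\mathbb{R};\mathbb{R}^2)$ and $\limsup_{\varepsilon\to0}J_\varepsilon(\Phi_\varepsilon)\le J_0(\Phi)$.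
   Context: For small $\varepsilon>0$, $\eta_\varepsilon\in H^1(\mathbb{R})\cap L^{2,1}(\mathbb{R})$, with $L^{2,1}(\mathbb{R})=\{f\in L^2(\mathbb{R}):|x|f\in L^2(\mathbb{R})\}$, denotes the positive solution of $\varepsilon^2\eta_\varepsilon''(x)+(1-x^2-\eta_\varepsilon(x)^2)\eta_\varepsilon(x)=0$, $x\in\mathbb{R}$. For $\Phi=(\phi_1,\phi_2)\in H^1_{\rm loc}(\mathbb{R};\mathbb{R}^2)$, $$J_\varepsilon(\Phi)=\frac12\int_{\mathbb{R}}\Big[\eta_\varepsilon(\varepsilon z)^2\big((\phi_1')^2+(\phi_2')^2\big)+\tfrac12\eta_\varepsilon(\varepsilon z)^4(\phi_1^2+\phi_2^2-1)^2+(\gamma-1)\eta_\varepsilon(\varepsilon z)^4\phi_1^2\phi_2^2\Big]dz,$$ $$J_0(\Phi)=\frac12\int_{\mathbb{R}}\Big[(\phi_1')^2+(\phi_2')^2+\tfrac12(\phi_1^2+\phi_2^2-1)^2+(\gamma-1)\phi_1^2\phi_2^2\Big]dz,$$ with values in $[0,+\infty]$ when $\gamma>1$. As usual in $\Gamma$-convergence, $J_0(\Phi)=+\infty$ if $\Phi\in L^2_{\rm loc}\setminus H^1_{\rm loc}$. *)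

theory Defs
  imports "HOL-Analysis.Analysis"
begin

text \<open>
  Elements of the function spaces are represented by everywhere-defined, Lebesgue measurable
  functions; the function-space notions below are invariant under modification on a null set.
\<close>

subsection \<open>Lebesgue and Sobolev spaces on the line\<close>

definition test_function :: "(real \<Rightarrow> real) \<Rightarrow> bool" where
  "test_function \<phi> \<longleftrightarrow>
     (\<forall>k x. (deriv ^^ k) \<phi> field_differentiable (at x)) \<and> compact (closure {x. \<phi> x \<noteq> 0})"

definition L1loc :: "(real \<Rightarrow> 'a::euclidean_space) set" where
  "L1loc = {f. f \<in> borel_measurable lebesgue \<and> (\<forall>K. compact K \<longrightarrow> set_integrable lebesgue K f)}"

definition L2loc :: "(real \<Rightarrow> 'a::euclidean_space) set" where
  "L2loc = {f. f \<in> borel_measurable lebesgue \<and>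
     (\<forall>K. compact K \<longrightarrow> set_integrable lebesgue K (\<lambda>x. (norm (f x))\<^sup>2))}"

definition L2 :: "(real \<Rightarrow> 'a::euclidean_space) set" where
  "L2 = {f. f \<in> borel_measurable lebesgue \<and> integrable lebesgue (\<lambda>x. (norm (f x))\<^sup>2)}"

definition L21 :: "(real \<Rightarrow> real) set" where
  "L21 = {f. f \<in> L2 \<and> (\<lambda>x. \<bar>x\<bar> * f x) \<in> L2}"

definition has_weak_deriv ::
  "(real \<Rightarrow> 'a::euclidean_space) \<Rightarrow> (real \<Rightarrow> 'a) \<Rightarrow> bool" where
  "has_weak_deriv f g \<longleftrightarrow> f \<in> L1loc \<and> g \<in> L1loc \<and>
     (\<forall>\<phi>. test_function \<phi> \<longrightarrow>
        (\<integral>x. deriv \<phi> x *\<^sub>R f x \<partial>lebesgue) = - (\<integral>x. \<phi> x *\<^sub>R g x \<partial>lebesgue))"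

text \<open>Weak derivatives are unique only up to null sets; this picks one representative.\<close>

definition weak_deriv :: "(real \<Rightarrow> 'a::euclidean_space) \<Rightarrow> real \<Rightarrow> 'a" where
  "weak_deriv f = (SOME g. has_weak_deriv f g)"

definition H1 :: "(real \<Rightarrow> 'a::euclidean_space) set" where
  "H1 = {f. f \<in> L2 \<and> (\<exists>g. has_weak_deriv f g \<and> g \<in> L2)}"

definition H1loc :: "(real \<Rightarrow> 'a::euclidean_space) set" where
  "H1loc = {f. f \<in> L2loc \<and> (\<exists>g. has_weak_deriv f g \<and> g \<in> L2loc)}"

definition tendsto_L2loc ::
  "('i \<Rightarrow> real \<Rightarrow> 'a::euclidean_space) \<Rightarrow> (real \<Rightarrow> 'a) \<Rightarrow> 'i filter \<Rightarrow> bool" where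
  "tendsto_L2loc u v F \<longleftrightarrow> v \<in> L2loc \<and> (\<forall>\<^sub>F i in F. u i \<in> L2loc) \<and>
     (\<forall>K. compact K \<longrightarrow>
        ((\<lambda>i. LINT x:K|lebesgue. (norm (u i x - v x))\<^sup>2) \<longlongrightarrow> 0) F)"

definition H1_seminorm :: "real set \<Rightarrow> (real \<Rightarrow> 'a::euclidean_space) \<Rightarrow> real" where
  "H1_seminorm K u =
     sqrt (LINT x:K|lebesgue. (norm (u x))\<^sup>2 + (norm (weak_deriv u x))\<^sup>2)"

text \<open>
  The topological dual of the Frechet space \<open>H1loc\<close>. The seminorms \<open>H1_seminorm K\<close>, for \<open>K\<close>
  compact, are directed, so continuity of a linear functional means being bounded by a
  multiple of one of them.
\<close>

definition H1loc_dual :: "((real \<Rightarrow> 'a::euclidean_space) \<Rightarrow> real) set" where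
  "H1loc_dual = {l.
     (\<forall>u\<in>H1loc. \<forall>v\<in>H1loc. l (\<lambda>x. u x + v x) = l u + l v) \<and>
     (\<forall>c. \<forall>u\<in>H1loc. l (\<lambda>x. c *\<^sub>R u x) = c * l u) \<and>
     (\<exists>K C. compact K \<and> (\<forall>u\<in>H1loc. \<bar>l u\<bar> \<le> C * H1_seminorm K u))}"

definition weakly_tendsto_H1loc ::
  "(nat \<Rightarrow> real \<Rightarrow> 'a::euclidean_space) \<Rightarrow> (real \<Rightarrow> 'a) \<Rightarrow> bool" where
  "weakly_tendsto_H1loc u v \<longleftrightarrow> (\<forall>n. u n \<in> H1loc) \<and> v \<in> H1loc \<and>
     (\<forall>l\<in>H1loc_dual. (\<lambda>n. l (u n)) \<longlonglongrightarrow> l v)"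

subsection \<open>The ground state and the energies\<close>

text \<open>
  Weak \<open>H1\<close> solutions of this equation have a smooth representative, so the equation is
  imposed pointwise.
\<close>

definition positive_ground_state :: "real \<Rightarrow> (real \<Rightarrow> real) \<Rightarrow> bool" where
  "positive_ground_state \<epsilon> \<eta> \<longleftrightarrow> \<eta> \<in> H1 \<inter> L21 \<and> (\<forall>x. \<eta> x > 0) \<and>
     (\<exists>\<eta>' \<eta>''. \<forall>x. (\<eta> has_real_derivative \<eta>' x) (at x) \<and>
        (\<eta>' has_real_derivative \<eta>'' x) (at x) \<and>
        \<epsilon>\<^sup>2 * \<eta>'' x + (1 - x\<^sup>2 - (\<eta> x)\<^sup>2) * \<eta> x = 0)"

text \<open>
  For \<open>\<gamma> \<ge> 1\<close> the integrands are nonnegative, so the truncation at \<open>0\<close> performed by \<^const>\<open>ennreal\<close>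
  is immaterial.
\<close>

definition J_eps :: "real \<Rightarrow> (real \<Rightarrow> real) \<Rightarrow> real \<Rightarrow> (real \<Rightarrow> real^2) \<Rightarrow> ennreal" where
  "J_eps \<gamma> \<eta> \<epsilon> \<Phi> = (1/2) * (\<integral>\<^sup>+ z. ennreal (
       (\<eta> (\<epsilon> * z))\<^sup>2 * ((weak_deriv \<Phi> z $ 1)\<^sup>2 + (weak_deriv \<Phi> z $ 2)\<^sup>2)
     + 1/2 * (\<eta> (\<epsilon> * z))^4 * ((\<Phi> z $ 1)\<^sup>2 + (\<Phi> z $ 2)\<^sup>2 - 1)\<^sup>2
     + (\<gamma> - 1) * (\<eta> (\<epsilon> * z))^4 * (\<Phi> z $ 1)\<^sup>2 * (\<Phi> z $ 2)\<^sup>2) \<partial>lebesgue)"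

definition J_0 :: "real \<Rightarrow> (real \<Rightarrow> real^2) \<Rightarrow> ennreal" where
  "J_0 \<gamma> \<Phi> = (if \<Phi> \<in> H1loc then (1/2) * (\<integral>\<^sup>+ z. ennreal (
       (weak_deriv \<Phi> z $ 1)\<^sup>2 + (weak_deriv \<Phi> z $ 2)\<^sup>2
     + 1/2 * ((\<Phi> z $ 1)\<^sup>2 + (\<Phi> z $ 2)\<^sup>2 - 1)\<^sup>2
     + (\<gamma> - 1) * (\<Phi> z $ 1)\<^sup>2 * (\<Phi> z $ 2)\<^sup>2) \<partial>lebesgue)
     else \<infinity>)"

end

theory Submission
  imports Defs "HOL-Computational_Algebra.Polynomial" "HOL-Complex_Analysis.Great_Picard"
begin

text \<open>
  Where the ground state exceeds 1 it is convex, so square integrability forces it to be at most 1.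
  Touching it from below with a multiple of a cosine supported on an interval of half-width
  \<open>sqrt \<epsilon>\<close> shows that the rescaled ground state tends to 1 locally uniformly. The upper bound
  makes the constant recovery sequence work.

  A bound on the energies bounds the derivatives, multiplied by the rescaled ground state, in
  \<open>L2\<close>. Weak compactness there is obtained without duality: along a subsequence whose Gram matrix
  converges, the averages of a sparse subsequence are Cauchy, and by the Banach--Saks argument every
  bounded functional vanishes in the limit along a bounded sequence with asymptotically null Gram
  matrix. The second fact is purely about the Gram matrix, so it applies to \<open>H1_seminorm K\<close> as well
  and yields convergence against the whole dual of \<open>H1loc\<close>. The lower bound combines weak lower
  semicontinuity of the kinetic term with Fatou's lemma for the potential.
\<close>

subsection \<open>The ground state\<close>


text \<open>The energies see everything through the weight \<open>\<eta> (\<epsilon> * z)\<close>.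
  For each \<open>\<epsilon>\<close> this weight is square integrable, so it cannot be close to 1 on
  the whole line; only locally uniform convergence is available. Two kinds of limit are therefore
  carried side by side. The weighted derivatives converge weakly in all of \<open>L2\<close>, which
  keeps the full kinetic energy in the lower bound. The unweighted functions and derivatives
  converge only when paired with functions of bounded support, which is what identifying a weak
  derivative requires. A second obstacle is that finite potential energy does not put
  \<open>\<Phi>\<close> into \<open>L2\<close>, since its norm may stay near 1 everywhere. A
  decaying factor \<open>1 / (1 + x\<^sup>2)\<close> is inserted before a limit is extracted and
  divided out afterwards. No compact embedding enters the lower bound: convergence in
  \<open>L2loc\<close> is given there, and it yields almost everywhere convergence along
  subsequences, which suffices for the continuous potential.\<close>

text \<open>A point with value above 1 and nonnegative slope pushes the solution upward forever,
  against square integrability. A point with value above 1 and negative slope becomes such a point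
  after reflecting the line, which leaves the equation invariant.\<close>

lemma ground_state_le_1:
  assumes \<epsilon>: "\<epsilon> > 0" and gs: "positive_ground_state \<epsilon> \<eta>"
  shows "\<eta> x \<le> 1"
proof -
  have no_right: "\<not> (h x > 1 \<and> h' x \<ge> 0)"
    if h: "h \<in> L2" and d: "\<And>x. (h has_real_derivative h' x) (at x)"
      "\<And>x. (h' has_real_derivative h'' x) (at x)"
      and eq: "\<And>x. \<epsilon>\<^sup>2 * h'' x + (1 - x\<^sup>2 - (h x)\<^sup>2) * h x = 0" for h h' h'' :: "real \<Rightarrow> real" and x
  proof
    assume a: "h x > 1 \<and> h' x \<ge> 0"
    have h''pos: "h'' y > 0" if "h y > 1" for y
    proof -
      have "\<epsilon>\<^sup>2 * h'' y = (y\<^sup>2 + (h y)\<^sup>2 - 1) * h y"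
        using eq[of y] by (simp add: algebra_simps)
      moreover have "(h y)\<^sup>2 > 1" using that by (simp add: one_less_power)
      then have "(y\<^sup>2 + (h y)\<^sup>2 - 1) * h y > 0" using that
        by (intro mult_pos_pos) (auto intro: add_nonneg_pos simp: add.commute add_strict_increasing2)
      ultimately show ?thesis using \<epsilon> by (metis zero_less_mult_pos zero_less_power)
    qed
    have cont: "continuous_on UNIV h" "continuous_on UNIV h'"
      using d by (auto intro!: DERIV_continuous_on simp: has_field_derivative_at_within)
    \<comment> \<open>Continuation argument: if \<open>h\<close> fell below \<open>h x\<close>, let
      \<open>z\<close> be the first point where it is at most \<open>c\<close>. Before
      \<open>z\<close> it exceeds \<open>c \<ge> 1\<close>, so it is convex there with nonnegative
      slope, and \<open>h z \<ge> h x > c\<close> follows.\<close>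
    have ge: "h y \<ge> h x" if "y \<ge> x" for y
    proof (rule ccontr)
      assume "\<not> h y \<ge> h x"
      then have yl: "h y < h x" by simp
      define c where "c = max 1 (h y)"
      have c: "c < h x" "1 \<le> c" "h y \<le> c" using a yl by (auto simp: c_def)
      define S where "S = {z \<in> {x..y}. h z \<le> c}"
      have "closed S" unfolding S_def
        using continuous_closed_preimage[of "{x..y}" h "{..c}"] cont(1)
        by (auto simp: vimage_def Int_def intro: continuous_on_subset)
      moreover have "y \<in> S" using c that by (auto simp: S_def)
      moreover have bdd: "bdd_below S" by (auto simp: S_def intro!: bdd_belowI[of _ x])
      ultimately have "Inf S \<in> S" by (intro closed_contains_Inf) auto
      define z where "z = Inf S"
      have z: "x \<le> z" "z \<le> y" "h z \<le> c" using \<open>Inf S \<in> S\<close> by (auto simp: S_def z_def)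
      have below: "h w > c" if "x \<le> w" "w < z" for w
      proof (rule ccontr)
        assume "\<not> c < h w"
        then have "w \<in> S" using that z by (auto simp: S_def)
        then have "z \<le> w" unfolding z_def by (rule cInf_lower[OF _ bdd])
        then show False using that by simp
      qed
      have "x < z" using z c by (cases "x = z") auto
      have h'0: "h' w \<ge> 0" if "x \<le> w" "w < z" for w
      proof -
        have "h' x \<le> h' w"
        proof (rule DERIV_nonneg_imp_nondecreasing[OF that(1)])
          fix u assume "x \<le> u" "u \<le> w"
          then have "h u > 1" using below[of u] that c by auto
          then show "\<exists>y. (h' has_real_derivative y) (at u) \<and> y \<ge> 0"
            using d(2)[of u] h''pos[of u] by (auto intro: less_imp_le)
        qed
        then show ?thesis using a by simp
      qed
      obtain w where w: "x < w" "w < z" "h z - h x = (z - x) * h' w"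
        using MVT2[OF \<open>x < z\<close>, of h h'] d(1) by blast
      have "h z - h x \<ge> 0" using w h'0[of w] by simp
      then show False using c z by simp
    qed
    have int: "integrable lebesgue (\<lambda>x. (norm (h x))\<^sup>2)" using h by (simp add: L2_def)
    define I where "I = (\<integral>x. (norm (h x))\<^sup>2 \<partial>lebesgue)"
    \<comment> \<open>The square of \<open>h\<close> is at least 1 on \<open>{x..x+n}\<close>, so
      any length above the total integral \<open>I\<close> is contradictory.\<close>
    define n where "n = max 0 I + 1"
    have n: "n > 0" "n > I" by (auto simp: n_def)
    have "n = measure lebesgue {x..x+n}" using n by simp
    also have "\<dots> = (\<integral>y. indicator {x..x+n} y \<partial>lebesgue)" by simp
    also have "\<dots> \<le> I" unfolding I_def
    proof (rule integral_mono)
      show "integrable lebesgue (indicator {x..x+n} :: real \<Rightarrow> real)"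
        by (simp add: emeasure_lborel_Icc_eq)
      fix y show "indicator {x..x + n} y \<le> (norm (h y))\<^sup>2"
        using ge[of y] a by (auto simp: indicator_def intro: one_le_power)
    qed (rule int)
    finally show False using n by simp
  qed
  from gs obtain \<eta>' \<eta>'' where e: "\<eta> \<in> L2" "\<And>x. (\<eta> has_real_derivative \<eta>' x) (at x)"
        "\<And>x. (\<eta>' has_real_derivative \<eta>'' x) (at x)"
        "\<And>x. \<epsilon>\<^sup>2 * \<eta>'' x + (1 - x\<^sup>2 - (\<eta> x)\<^sup>2) * \<eta> x = 0"
    unfolding positive_ground_state_def L21_def by blast
  show ?thesis
  proof (cases "\<eta>' x \<ge> 0")
    case True
    then show ?thesis using no_right[OF e(1-4), of x] by auto
  next
    case False
    have refl: "(\<lambda>x. \<eta> (- x)) \<in> L2"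
    proof -
      have m: "\<eta> \<in> borel_measurable lebesgue" and i: "integrable lebesgue (\<lambda>x. (norm (\<eta> x))\<^sup>2)"
        using e(1) by (auto simp: L2_def)
      have c: "continuous_on UNIV \<eta>"
        using e by (auto intro!: DERIV_continuous_on simp: has_field_derivative_at_within)
      have "continuous_on UNIV (\<lambda>x. \<eta> (- x))"
        by (intro continuous_on_compose2[OF c] continuous_intros) auto
      then have "(\<lambda>x. \<eta> (- x)) \<in> borel_measurable lborel"
        using borel_measurable_continuous_onI by simp
      then have m': "(\<lambda>x. \<eta> (- x)) \<in> borel_measurable lebesgue"
        by (rule measurable_completion)
      have mb: "\<eta> \<in> borel_measurable lborel"
        using borel_measurable_continuous_onI[OF c] by simp
      have "integrable lborel (\<lambda>x. (norm (\<eta> x))\<^sup>2)"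
        using i mb by (simp add: integrable_completion)
      from lborel_integrable_real_affine[OF this, of "-1" 0]
      have "integrable lborel (\<lambda>x. (norm (\<eta> (- x)))\<^sup>2)" by simp
      then have "integrable lebesgue (\<lambda>x. (norm (\<eta> (- x)))\<^sup>2)"
        by (rule integrable_completion[THEN iffD2, rotated]) (use \<open>(\<lambda>x. \<eta> (- x)) \<in> borel_measurable lborel\<close> in simp)
      then show ?thesis using m' by (simp add: L2_def)
    qed
    have d1: "((\<lambda>x. \<eta> (- x)) has_real_derivative - \<eta>' (- x)) (at x)" for x
      using e(2)[of "-x"] by (simp add: DERIV_mirror)
    have d2: "((\<lambda>x. - \<eta>' (- x)) has_real_derivative \<eta>'' (- x)) (at x)" for x
      using DERIV_minus[OF e(3)[of "-x", unfolded DERIV_mirror]] by simp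
    show ?thesis using no_right[OF refl d1 d2, of "-x"] e(4)[of "- _"] False by auto
  qed
qed

text \<open>Sliding argument: \<open>M\<close> is the least factor for which
  \<open>M * \<eta>\<close> lies above the cosine on the interval. At the contact point the
  second-order condition says \<open>\<eta>'' \<ge> - k\<^sup>2 * \<eta>\<close>, and the equation
  turns this into a lower bound for \<open>\<eta>\<close> there, which the comparison carries to
  every other point. As \<open>sqrt\<close> is monotone on all reals, the sign of the radicand needs
  no case distinction.\<close>

lemma ground_state_lower_bound:
  assumes \<epsilon>: "\<epsilon> > 0" and gs: "positive_ground_state \<epsilon> \<eta>" and \<delta>: "\<delta> > 0"
    and x: "\<bar>x\<bar> \<le> \<delta>"
  shows "\<eta> x \<ge> sqrt (1 - \<delta>\<^sup>2 - (\<epsilon> * (pi / (2 * \<delta>)))\<^sup>2) * cos (pi / (2 * \<delta>) * x)"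
proof -
  define k where "k = pi / (2 * \<delta>)"
  define w where "w = (\<lambda>x. cos (k * x))"
  have k: "k > 0" "k * \<delta> = pi / 2" using \<delta> by (auto simp: k_def field_simps)
  from gs obtain \<eta>' \<eta>'' where e: "\<And>x. \<eta> x > 0" "\<And>x. (\<eta> has_real_derivative \<eta>' x) (at x)"
        "\<And>x. (\<eta>' has_real_derivative \<eta>'' x) (at x)"
        "\<And>x. \<epsilon>\<^sup>2 * \<eta>'' x + (1 - x\<^sup>2 - (\<eta> x)\<^sup>2) * \<eta> x = 0"
    unfolding positive_ground_state_def by blast
  have c: "continuous_on UNIV \<eta>"
    using e by (auto intro!: DERIV_continuous_on simp: has_field_derivative_at_within)
  have "continuous_on {-\<delta>..\<delta>} (\<lambda>x. w x / \<eta> x)" unfolding w_def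
    using e(1) by (intro continuous_intros continuous_on_subset[OF c]) (auto simp: less_imp_neq[symmetric])
  then obtain x1 where x1: "x1 \<in> {-\<delta>..\<delta>}" "\<And>y. y \<in> {-\<delta>..\<delta>} \<Longrightarrow> w y / \<eta> y \<le> w x1 / \<eta> x1"
    using continuous_attains_sup[of "{-\<delta>..\<delta>}" "\<lambda>x. w x / \<eta> x"] \<delta> by auto
  define M where "M = w x1 / \<eta> x1"
  have "w 0 / \<eta> 0 \<le> M" unfolding M_def using x1(2)[of 0] \<delta> by simp
  moreover have "w 0 / \<eta> 0 > 0" using e(1) by (simp add: w_def)
  ultimately have M: "M > 0" by simp
  \<comment> \<open>The frequency \<open>k\<close> is chosen so that the cosine vanishes at the
    endpoints; since \<open>M > 0\<close>, the contact point is interior and hence critical for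
    \<open>p\<close>.\<close>
  have wb: "w \<delta> = 0" "w (-\<delta>) = 0" unfolding w_def mult_minus_right cos_minus k(2) by simp_all
  have "w x1 \<noteq> 0" using M by (auto simp: M_def)
  then have "x1 \<noteq> \<delta>" "x1 \<noteq> -\<delta>" using wb by auto
  then have int: "-\<delta> < x1" "x1 < \<delta>" using x1(1) by auto
  define p where "p = (\<lambda>x. M * \<eta> x - w x)"
  define p' where "p' = (\<lambda>x. M * \<eta>' x + k * sin (k * x))"
  have pd: "(p has_real_derivative p' x) (at x)" for x
    unfolding p_def p'_def w_def by (auto intro!: derivative_eq_intros e)
  have pd': "(p' has_real_derivative (M * \<eta>'' x + k\<^sup>2 * cos (k * x))) (at x)" for x
    unfolding p'_def by (auto intro!: derivative_eq_intros e simp: power2_eq_square)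
  have p0: "p y \<ge> 0" if "y \<in> {-\<delta>..\<delta>}" for y
    using x1(2)[OF that] e(1)[of y] by (simp add: p_def M_def[symmetric] field_simps)
  have px1: "p x1 = 0" using e(1)[of x1] by (simp add: p_def M_def)
  have p'x1: "p' x1 = 0"
  proof (rule DERIV_local_min[OF pd])
    show "0 < min (\<delta> - x1) (x1 + \<delta>)" using int by simp
    show "\<forall>y. \<bar>x1 - y\<bar> < min (\<delta> - x1) (x1 + \<delta>) \<longrightarrow> p x1 \<le> p y"
      using p0 px1 by (auto simp: abs_less_iff)
  qed
  \<comment> \<open>Second derivative test: a negative second derivative at the critical point would
    make \<open>p'\<close> negative just to the right of it, hence \<open>p\<close> negative there
    by the mean value theorem.\<close>
  have "M * \<eta>'' x1 + k\<^sup>2 * cos (k * x1) \<ge> 0"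
  proof (rule ccontr)
    assume "\<not> ?thesis"
    then have neg: "M * \<eta>'' x1 + k\<^sup>2 * cos (k * x1) < 0" by simp
    from DERIV_neg_dec_right[OF pd' neg] obtain d where d: "d > 0"
      "\<And>h. h > 0 \<Longrightarrow> h < d \<Longrightarrow> p' (x1 + h) < p' x1" by blast
    define h where "h = min (d / 2) (\<delta> - x1)"
    have h: "h > 0" "h < d" "x1 + h \<le> \<delta>" using d int by (auto simp: h_def)
    obtain z where z: "x1 < z" "z < x1 + h" "p (x1 + h) - p x1 = (x1 + h - x1) * p' z"
      using MVT2[of x1 "x1 + h" p p'] pd h by auto
    have "p' z < 0" using d(2)[of "z - x1"] z h p'x1 by simp
    then have "p (x1 + h) < 0" using z px1 h by (simp add: mult_pos_neg)
    then show False using p0[of "x1 + h"] h int by auto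
  qed
  then have "M * \<eta>'' x1 + k\<^sup>2 * (M * \<eta> x1) \<ge> 0"
    using px1 by (simp add: p_def w_def)
  then have "M * (\<eta>'' x1 + k\<^sup>2 * \<eta> x1) \<ge> 0" by (simp add: algebra_simps)
  then have "\<eta>'' x1 + k\<^sup>2 * \<eta> x1 \<ge> 0" using M by (simp add: zero_le_mult_iff)
  then have "\<epsilon>\<^sup>2 * (\<eta>'' x1 + k\<^sup>2 * \<eta> x1) \<ge> 0" by simp
  then have "(x1\<^sup>2 + (\<eta> x1)\<^sup>2 - 1 + \<epsilon>\<^sup>2 * k\<^sup>2) * \<eta> x1 \<ge> 0"
    using e(4)[of x1] by (simp add: algebra_simps)
  then have "x1\<^sup>2 + (\<eta> x1)\<^sup>2 - 1 + \<epsilon>\<^sup>2 * k\<^sup>2 \<ge> 0"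
    using e(1)[of x1] by (simp add: zero_le_mult_iff)
  moreover have "x1\<^sup>2 \<le> \<delta>\<^sup>2" using int \<delta> by (simp add: abs_le_square_iff[symmetric])
  ultimately have "1 - \<delta>\<^sup>2 - (\<epsilon> * k)\<^sup>2 \<le> (\<eta> x1)\<^sup>2" by (simp add: power_mult_distrib)
  then have "sqrt (1 - \<delta>\<^sup>2 - (\<epsilon> * k)\<^sup>2) \<le> sqrt ((\<eta> x1)\<^sup>2)" by (rule real_sqrt_le_mono)
  then have s: "sqrt (1 - \<delta>\<^sup>2 - (\<epsilon> * k)\<^sup>2) \<le> \<eta> x1" using e(1)[of x1] by simp
  have "M * \<eta> x1 \<le> 1" using px1 by (simp add: p_def w_def)
  have wx: "w x \<ge> 0" unfolding w_def
  proof (rule cos_ge_zero)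
    have "\<bar>k * x\<bar> \<le> pi / 2" using x k by (metis abs_mult abs_of_pos mult_left_mono less_imp_le)
    then show "- (pi / 2) \<le> k * x" "k * x \<le> pi / 2" by auto
  qed
  have "M * (\<eta> x1 * w x) \<le> 1 * w x"
    using mult_right_mono[OF \<open>M * \<eta> x1 \<le> 1\<close> wx] by (simp add: mult.assoc)
  also have "\<dots> \<le> M * \<eta> x" using p0[of x] x by (auto simp: p_def abs_le_iff)
  finally have "\<eta> x1 * w x \<le> \<eta> x" using M by simp
  moreover have "sqrt (1 - \<delta>\<^sup>2 - (\<epsilon> * k)\<^sup>2) * w x \<le> \<eta> x1 * w x" using s wx by (rule mult_right_mono)
  ultimately show ?thesis by (simp add: k_def w_def)
qed

text \<open>Half-width \<open>\<delta> = sqrt \<epsilon>\<close> balances the errors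
  \<open>\<delta>\<^sup>2\<close> and \<open>(\<epsilon> * (pi / (2 * \<delta>)))\<^sup>2\<close>,
  both then of order \<open>\<epsilon>\<close>. In the rescaled variable the interval has half-width
  \<open>1 / sqrt \<epsilon>\<close>, so it eventually contains any bounded set, and the cosine
  there tends to 1.\<close>

lemma ground_state_tendsto_1:
  assumes e: "\<And>n::nat. e n > 0" "e \<longlonglongrightarrow> 0"
    and gs: "\<And>n. positive_ground_state (e n) (\<eta> n)" and "\<theta> < 1"
  shows "\<forall>\<^sub>F n in sequentially. \<forall>z. \<bar>z\<bar> \<le> R \<longrightarrow> \<theta> \<le> \<eta> n (e n * z)"
proof -
  define R' where "R' = max R 1"
  \<comment> \<open>The lower bound at \<open>z = R'\<close> for half-width \<open>sqrt s\<close>;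
    it is the worst case because the cosine decreases away from 0.\<close>
  define b where "b = (\<lambda>s::real. sqrt (1 - s - s * (pi / 2)\<^sup>2) * cos (pi / 2 * (sqrt s * R')))"
  have "((\<lambda>n. b (e n)) \<longlongrightarrow> sqrt (1 - 0 - 0 * (pi / 2)\<^sup>2) * cos (pi / 2 * (sqrt 0 * R'))) sequentially"
    unfolding b_def by (intro tendsto_intros e)
  then have "(\<lambda>n. b (e n)) \<longlonglongrightarrow> 1" by simp
  then have 1: "\<forall>\<^sub>F n in sequentially. b (e n) > \<theta>" using \<open>\<theta> < 1\<close> by (simp add: order_tendstoD)
  have "((\<lambda>n. sqrt (e n) * R') \<longlongrightarrow> sqrt 0 * R') sequentially"
    by (intro tendsto_intros e)
  then have 2: "\<forall>\<^sub>F n in sequentially. sqrt (e n) * R' < 1" by (simp add: order_tendstoD)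
  have "((\<lambda>n. 1 - e n - e n * (pi / 2)\<^sup>2) \<longlongrightarrow> 1 - 0 - 0 * (pi / 2)\<^sup>2) sequentially"
    by (intro tendsto_intros e)
  then have 3: "\<forall>\<^sub>F n in sequentially. 1 - e n - e n * (pi / 2)\<^sup>2 > 0" by (rule order_tendstoD) simp
  show ?thesis
    using 1 2 3
  proof eventually_elim
    case (elim n)
    show ?case
    proof (intro allI impI)
      fix z assume z: "\<bar>z\<bar> \<le> R"
      define s where "s = sqrt (e n)"
      have s: "s > 0" "s * s = e n" using e(1)[of n] by (auto simp: s_def)
      have sz: "s * \<bar>z\<bar> \<le> s * R'" using z s by (auto simp: R'_def)
      then have sz1: "s * \<bar>z\<bar> \<le> 1" using elim by (simp add: s_def)
      have "\<bar>e n * z\<bar> = s * (s * \<bar>z\<bar>)" using s by (metis abs_mult abs_of_pos mult.assoc)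
      also have "\<dots> \<le> s" using sz1 s by (simp add: mult_left_le)
      finally have le: "\<bar>e n * z\<bar> \<le> s" .
      have eq: "(e n * (pi / (2 * s)))\<^sup>2 = e n * (pi / 2)\<^sup>2" "s\<^sup>2 = e n"
        using s by (auto simp: field_simps power2_eq_square s(2)[symmetric])
      have eq2: "pi / (2 * s) * (e n * z) = pi / 2 * (s * z)"
        using s by (auto simp: field_simps s(2)[symmetric])
      have "b (e n) \<le> sqrt (1 - e n - e n * (pi / 2)\<^sup>2) * cos (pi / 2 * (s * z))"
        unfolding b_def
      proof (rule mult_left_mono)
        have "cos (pi / 2 * (s * R')) \<le> cos (pi / 2 * (s * \<bar>z\<bar>))"
        proof (rule cos_monotone_0_pi_le)
          show "0 \<le> pi / 2 * (s * \<bar>z\<bar>)" using s by simp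
          show "pi / 2 * (s * \<bar>z\<bar>) \<le> pi / 2 * (s * R')" using sz by simp
          have "pi / 2 * (s * R') \<le> pi / 2 * 1"
            using elim by (intro mult_left_mono) (auto simp: s_def)
          then show "pi / 2 * (s * R') \<le> pi" using pi_gt_zero by linarith
        qed
        also have "cos (pi / 2 * (s * \<bar>z\<bar>)) = cos (pi / 2 * (s * z))"
          by (cases "z \<ge> 0") (auto simp: abs_if)
        finally show "cos (pi / 2 * (sqrt (e n) * R')) \<le> cos (pi / 2 * (s * z))"
          by (simp add: s_def)
        show "0 \<le> sqrt (1 - e n - e n * (pi / 2)\<^sup>2)" using elim by simp
      qed
      also have "\<dots> \<le> \<eta> n (e n * z)"
        using ground_state_lower_bound[OF e(1)[of n] gs[of n] s(1) le] by (simp only: eq eq2)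
      finally show "\<theta> \<le> \<eta> n (e n * z)" using elim by simp
    qed
  qed
qed

subsection \<open>Test functions and weak derivatives\<close>


text \<open>Smoothness of finite order, with the derivative taken innermost. Product and chain rules
  then give closure by induction on the order, because the derivative of a product is built from
  functions known to one order less.\<close>

fun diff_upto :: "nat \<Rightarrow> (real \<Rightarrow> real) \<Rightarrow> bool" where
  "diff_upto 0 f \<longleftrightarrow> True"
| "diff_upto (Suc k) f \<longleftrightarrow> (\<forall>x. f field_differentiable (at x)) \<and> diff_upto k (deriv f)"

lemma diff_upto_iff: "diff_upto k f \<longleftrightarrow> (\<forall>j<k. \<forall>x. (deriv ^^ j) f field_differentiable (at x))"
proof (induction k arbitrary: f)
  case (Suc k)
  show ?case
    by (auto simp: Suc.IH less_Suc_eq_0_disj funpow_swap1)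
qed simp

lemma smooth_iff_diff_upto:
  "(\<forall>k x. (deriv ^^ k) f field_differentiable (at x)) \<longleftrightarrow> (\<forall>k. diff_upto k f)"
  unfolding diff_upto_iff by auto

lemma diff_upto_SucD: "diff_upto (Suc k) f \<Longrightarrow> diff_upto k f"
  by (simp add: diff_upto_iff)

lemma diff_upto_const: "diff_upto k (\<lambda>x. c)"
proof (induction k arbitrary: c)
  case (Suc k)
  have "deriv (\<lambda>x. c) = (\<lambda>x::real. 0)" by (auto simp: fun_eq_iff)
  then show ?case using Suc by simp
qed simp

lemma diff_upto_add: "diff_upto k f \<Longrightarrow> diff_upto k g \<Longrightarrow> diff_upto k (\<lambda>x. f x + g x)"
proof (induction k arbitrary: f g)
  case (Suc k)
  then have "deriv (\<lambda>x. f x + g x) = (\<lambda>x. deriv f x + deriv g x)"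
    by (auto simp: fun_eq_iff intro!: deriv_add)
  then show ?case using Suc by (auto intro: field_differentiable_add)
qed simp

lemma diff_upto_mult: "diff_upto k f \<Longrightarrow> diff_upto k g \<Longrightarrow> diff_upto k (\<lambda>x. f x * g x)"
proof (induction k arbitrary: f g)
  case (Suc k)
  then have "deriv (\<lambda>x. f x * g x) = (\<lambda>x. f x * deriv g x + deriv f x * g x)"
    by (auto simp: fun_eq_iff intro!: deriv_mult)
  moreover have "diff_upto k f" "diff_upto k g" using Suc.prems by (blast dest: diff_upto_SucD)+
  ultimately show ?case using Suc
    by (auto intro!: field_differentiable_mult diff_upto_add)
qed simp

lemma diff_upto_power: "diff_upto k f \<Longrightarrow> diff_upto k (\<lambda>x. f x ^ n)"
  by (induction n) (auto intro: diff_upto_const diff_upto_mult)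

lemma diff_upto_affine: "diff_upto k f \<Longrightarrow> diff_upto k (\<lambda>x. f (c * x + d))"
proof (induction k arbitrary: f)
  case (Suc k)
  have D: "((\<lambda>x. f (c * x + d)) has_field_derivative c * deriv f (c * x + d)) (at x)" for x
  proof -
    have "(f has_field_derivative deriv f (c * x + d)) (at (c * x + d))"
      using Suc.prems by (simp add: field_differentiable_derivI)
    moreover have "((\<lambda>x. c * x + d) has_field_derivative c) (at x)"
      by (auto intro!: derivative_eq_intros)
    ultimately show ?thesis using DERIV_chain'[of "\<lambda>x. c * x + d" c x UNIV f] by (metis mult.commute)
  qed
  then have "deriv (\<lambda>x. f (c * x + d)) = (\<lambda>x. c * deriv f (c * x + d))"
    by (auto simp: fun_eq_iff intro: DERIV_imp_deriv)
  moreover have "diff_upto k (\<lambda>x. c * deriv f (c * x + d))"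
    using Suc by (intro diff_upto_mult diff_upto_const) auto
  ultimately show ?case using D by (auto simp: field_differentiable_def)
qed simp

section \<open>Smooth bumps built from a function that is flat at the origin\<close>

text \<open>The classical \<open>exp (- 1 / x)\<close> extended by 0, with a polynomial in
  \<open>1 / x\<close> in front. The extra factor closes the family under differentiation, so one
  derivative formula proves smoothness of every order.\<close>

definition flat_exp :: "real poly \<Rightarrow> real \<Rightarrow> real" where
  "flat_exp p x = (if x > 0 then poly p (inverse x) * exp (- inverse x) else 0)"

lemma poly_mult_exp_minus_tendsto_0: "((\<lambda>y::real. poly p y * exp (- y)) \<longlongrightarrow> 0) at_top"
proof -
  have "((\<lambda>y::real. \<Sum>i\<le>degree p. coeff p i * (y ^ i / exp y)) \<longlongrightarrow> (\<Sum>i\<le>degree p. coeff p i * 0)) at_top"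
    by (intro tendsto_intros tendsto_power_div_exp_0)
  then show ?thesis
    by (simp add: poly_altdef sum_distrib_right exp_minus divide_inverse mult.assoc)
qed

text \<open>For \<open>x > 0\<close> the chain rule contributes a factor
  \<open>1 / x\<^sup>2\<close>, and the product rule leaves \<open>p - pderiv p\<close>. At 0 the
  right difference quotient is again of this type, with \<open>pCons 0 p\<close> for
  \<open>p\<close>, and tends to 0 because the exponential beats any polynomial.\<close>

lemma flat_exp_deriv:
  "(flat_exp p has_field_derivative flat_exp ([:0, 0, 1:] * (p - pderiv p)) x) (at x)"
proof -
  consider "x > 0" | "x < 0" | "x = 0" by linarith
  then show ?thesis
  proof cases
    case 1
    have "((\<lambda>x. poly p (inverse x) * exp (- inverse x)) has_field_derivative
        flat_exp ([:0, 0, 1:] * (p - pderiv p)) x) (at x)"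
      using 1 by (auto intro!: derivative_eq_intros DERIV_chain'[OF _ poly_DERIV]
          simp: flat_exp_def algebra_simps power2_eq_square)
    then show ?thesis
      by (rule has_field_derivative_transform_within_open[where S = "{0<..}"])
        (use 1 in \<open>auto simp: flat_exp_def\<close>)
  next
    case 2
    have "((\<lambda>x. 0) has_field_derivative flat_exp ([:0, 0, 1:] * (p - pderiv p)) x) (at x)"
      using 2 by (auto simp: flat_exp_def)
    then show ?thesis
      by (rule has_field_derivative_transform_within_open[where S = "{..<0}"])
        (use 2 in \<open>auto simp: flat_exp_def\<close>)
  next
    case 3
    have "((\<lambda>y. poly (pCons 0 p) (inverse y) * exp (- inverse y)) \<longlongrightarrow> 0) (at_right 0)"
      by (rule filterlim_compose[OF poly_mult_exp_minus_tendsto_0 filterlim_inverse_at_top_right])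
    then have r: "((\<lambda>y. (flat_exp p y - flat_exp p 0) / (y - 0)) \<longlongrightarrow> 0) (at_right 0)"
      by (rule Lim_transform_eventually)
        (auto simp: flat_exp_def eventually_at_filter field_simps)
    have l: "((\<lambda>y. (flat_exp p y - flat_exp p 0) / (y - 0)) \<longlongrightarrow> 0) (at_left 0)"
      by (rule Lim_transform_eventually[OF tendsto_const])
        (auto simp: flat_exp_def eventually_at_filter)
    have "((\<lambda>y. (flat_exp p y - flat_exp p 0) / (y - 0)) \<longlongrightarrow> 0) (at 0)"
      using l r by (simp add: filterlim_split_at)
    then show ?thesis using 3 by (simp add: has_field_derivative_iff flat_exp_def)
  qed
qed

lemma diff_upto_flat_exp: "diff_upto k (flat_exp p)"
proof (induction k arbitrary: p)
  case (Suc k)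
  have "deriv (flat_exp p) = flat_exp ([:0, 0, 1:] * (p - pderiv p))"
    using flat_exp_deriv by (auto simp: fun_eq_iff intro: DERIV_imp_deriv)
  then show ?case
    using Suc flat_exp_deriv unfolding diff_upto.simps field_differentiable_def by metis
qed simp

text \<open>A product of two flat functions gives a smooth \<open>\<psi>\<close> with values in
  [0,1] that is positive exactly on the interval. Then \<open>1 - (1 - \<psi>) ^ n\<close> is
  smooth, vanishes off the interval and tends to 1 on it, so neither mollification nor rescaling is
  involved.\<close>

lemma ex_test_function_approximating_indicator:
  obtains \<phi> where "\<And>n::nat. test_function (\<phi> n)"
    "\<And>n x. \<bar>\<phi> n x\<bar> \<le> indicator {a<..<b} x"
    "\<And>x. (\<lambda>n. \<phi> n x) \<longlonglongrightarrow> indicator {a<..<b} x"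
proof
  define f where "f = flat_exp 1"
  \<comment> \<open>Differences are spelled as sums and products with constants so that the closure
    rules for \<open>diff_upto\<close> match syntactically.\<close>
  define \<psi> where "\<psi> = (\<lambda>x. f (1 * x + (- a)) * f ((-1) * x + b))"
  define \<phi> where "\<phi> = (\<lambda>n x. 1 + (-1) * (1 + (-1) * \<psi> x) ^ n)"
  have f: "0 \<le> f x" "f x \<le> 1" "f x > 0 \<longleftrightarrow> x > 0" for x
    by (auto simp: f_def flat_exp_def)
  have \<psi>: "0 \<le> \<psi> x" "\<psi> x \<le> 1" "\<psi> x > 0 \<longleftrightarrow> x \<in> {a<..<b}" for x
    using f[of "x - a"] f[of "b - x"]
    by (auto simp: \<psi>_def mult_le_one zero_less_mult_iff dest: order.strict_implies_order)
  have zero: "\<phi> n x = 0" if "x \<notin> {a<..<b}" for n x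
    using \<psi>[of x] that by (auto simp: \<phi>_def)
  have "diff_upto k (\<phi> n)" for k n
    unfolding \<phi>_def \<psi>_def f_def
    by (intro diff_upto_add diff_upto_mult diff_upto_const diff_upto_power diff_upto_affine
        diff_upto_flat_exp)
  moreover have "compact (closure {x. \<phi> n x \<noteq> 0})" for n
  proof -
    have "{x. \<phi> n x \<noteq> 0} \<subseteq> {a..b}" using zero[of _ n] greaterThanLessThan_subseteq_atLeastAtMost_iff[of a b a b] by blast
    then show ?thesis by (simp add: compact_closure bounded_subset[OF bounded_closed_interval])
  qed
  ultimately show "test_function (\<phi> n)" for n
    unfolding test_function_def smooth_iff_diff_upto by blast
  show "\<bar>\<phi> n x\<bar> \<le> indicator {a<..<b} x" for n x
  proof (cases "x \<in> {a<..<b}")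
    case True
    have "0 \<le> (1 - \<psi> x) ^ n" "(1 - \<psi> x) ^ n \<le> 1" using \<psi>[of x] by (auto simp: power_le_one)
    then show ?thesis using True by (simp add: \<phi>_def)
  qed (use zero in auto)
  show "(\<lambda>n. \<phi> n x) \<longlonglongrightarrow> indicator {a<..<b} x" for x
  proof (cases "x \<in> {a<..<b}")
    case True
    then have "\<psi> x > 0" using \<psi>(3) by blast
    then have "(\<lambda>n. (1 - \<psi> x) ^ n) \<longlonglongrightarrow> 0" using \<psi>(2)[of x] by (intro LIMSEQ_realpow_zero) auto
    then have "(\<lambda>n. 1 - (1 - \<psi> x) ^ n) \<longlonglongrightarrow> 1 - 0" by (intro tendsto_diff tendsto_const)
    then show ?thesis using True by (simp add: \<phi>_def)
  qed (use zero in auto)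
qed

section \<open>The fundamental lemma of the calculus of variations\<close>

lemma sigma_finite_lebesgue: "sigma_finite_measure (lebesgue :: real measure)"
proof
  have "\<exists>n. x \<in> {- real n..real n}" for x :: real
    using real_arch_simple[of "\<bar>x\<bar>"] by (auto simp: abs_le_iff minus_le_iff)
  then have "(\<Union>n. {- real n..real n}) = (UNIV :: real set)" by blast
  then show "\<exists>A. countable A \<and> A \<subseteq> sets (lebesgue :: real measure) \<and>
      \<Union> A = space lebesgue \<and> (\<forall>a\<in>A. emeasure lebesgue a \<noteq> \<infinity>)"
    by (intro exI[of _ "range (\<lambda>n. {- real n..real n})"]) (auto simp: emeasure_lborel_Icc_eq)
qed

text \<open>Dominated convergence turns test functions into indicators of open intervals. Intervals
  are stable under intersection and generate the Borel sets, so the integral vanishes over every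
  Borel set and then over every Lebesgue set, which forces the function to vanish almost
  everywhere.\<close>

lemma L1loc_ae_zeroI:
  fixes h :: "real \<Rightarrow> 'a::euclidean_space"
  assumes h: "h \<in> L1loc" and z: "\<And>\<phi>. test_function \<phi> \<Longrightarrow> (\<integral>x. \<phi> x *\<^sub>R h x \<partial>lebesgue) = 0"
  shows "AE x in lebesgue. h x = 0"
proof -
  have hm[measurable]: "h \<in> borel_measurable lebesgue" using h by (simp add: L1loc_def)
  have int: "integrable lebesgue (\<lambda>x. indicator K x *\<^sub>R h x)" if "compact K" for K
    using h that by (auto simp: L1loc_def set_integrable_def)
  have ivl: "(\<integral>x. indicator {a<..<b} x *\<^sub>R h x \<partial>lebesgue) = 0" for a b
  proof -
    obtain \<phi> where \<phi>: "\<And>n::nat. test_function (\<phi> n)"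
      "\<And>n x. \<bar>\<phi> n x\<bar> \<le> indicator {a<..<b} x"
      "\<And>x. (\<lambda>n. \<phi> n x) \<longlonglongrightarrow> indicator {a<..<b} x"
      using ex_test_function_approximating_indicator[of a b] by blast
    have [measurable]: "\<phi> n \<in> borel_measurable lebesgue" for n
    proof -
      have "\<forall>x. \<phi> n field_differentiable (at x)"
        using \<phi>(1)[of n] unfolding test_function_def by (metis funpow_0)
      then have "continuous_on UNIV (\<phi> n)"
        by (meson continuous_at_imp_continuous_on field_differentiable_imp_continuous_at)
      then show ?thesis
        using borel_measurable_continuous_onI measurable_completion by (metis measurable_lborel2)
    qed
    have "(\<lambda>n. \<integral>x. \<phi> n x *\<^sub>R h x \<partial>lebesgue) \<longlonglongrightarrow> (\<integral>x. indicator {a<..<b} x *\<^sub>R h x \<partial>lebesgue)"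
    proof (rule integral_dominated_convergence[where w = "\<lambda>x. norm (indicator {a..b} x *\<^sub>R h x)"])
      show "AE x in lebesgue. (\<lambda>n. \<phi> n x *\<^sub>R h x) \<longlonglongrightarrow> indicator {a<..<b} x *\<^sub>R h x"
        by (intro AE_I2 tendsto_intros \<phi>)
      show "AE x in lebesgue. norm (\<phi> n x *\<^sub>R h x) \<le> norm (indicator {a..b} x *\<^sub>R h x)" for n
      proof (rule AE_I2)
        fix x
        have "\<bar>\<phi> n x\<bar> \<le> indicator {a..b} x"
          using \<phi>(2)[of n x] by (auto simp: indicator_def of_bool_def split: if_splits)
        then show "norm (\<phi> n x *\<^sub>R h x) \<le> norm (indicator {a..b} x *\<^sub>R h x)"
          by (simp add: mult_right_mono)
      qed
      show "integrable lebesgue (\<lambda>x. norm (indicator {a..b} x *\<^sub>R h x))"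
        using int[of "{a..b}"] by (intro integrable_norm) simp
    qed (auto intro!: borel_measurable_scaleR borel_measurable_indicator)
    then show ?thesis using \<phi>(1) z by (simp add: LIMSEQ_const_iff)
  qed
  have "AE x in lebesgue. indicator {- real n<..<real n} x *\<^sub>R h x = 0" for n
  proof -
    \<comment> \<open>Truncation makes the locally integrable \<open>h\<close> integrable on the
      line, as complements and countable unions demand. An interval cut by the truncation is again
      an interval, so \<open>ivl\<close> still applies.\<close>
    define g where "g = (\<lambda>x. indicator {- real n<..<real n} x *\<^sub>R h x)"
    have gi: "integrable lebesgue g"
    proof (rule Bochner_Integration.integrable_bound)
      show "integrable lebesgue (\<lambda>x. indicator {- real n..real n} x *\<^sub>R h x)" by (rule int) simp
      show "AE x in lebesgue. norm (g x) \<le> norm (indicator {- real n..real n} x *\<^sub>R h x)"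
        by (auto simp: g_def indicator_def)
    qed (auto simp: g_def intro!: borel_measurable_scaleR borel_measurable_indicator)
    have g0: "(\<integral>x. g x \<partial>lebesgue) = 0" unfolding g_def by (rule ivl)
    have borel0: "set_lebesgue_integral lebesgue A g = 0" if "A \<in> sets borel" for A
    proof -
      have gen: "A \<in> sigma_sets UNIV (range (\<lambda>(a, b). {a<..<b::real}))"
        using that by (simp add: borel_eq_box box_real)
      have sub: "X \<in> sigma_sets UNIV (range (\<lambda>(a, b). {a<..<b::real})) \<Longrightarrow> X \<in> sets lebesgue" for X
      proof -
        assume "X \<in> sigma_sets UNIV (range (\<lambda>(a, b). {a<..<b::real}))"
        then have "X \<in> sets borel" by (simp add: borel_eq_box box_real)
        then show "X \<in> sets lebesgue" by (simp add: sets_completionI_sets)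
      qed
      have "Int_stable (range (\<lambda>(a, b). {a<..<b::real}))" unfolding Int_stable_def by auto
      moreover have "range (\<lambda>(a, b). {a<..<b::real}) \<subseteq> Pow UNIV" by simp
      moreover note gen
      ultimately show ?thesis
      proof (induction rule: sigma_sets_induct_disjoint)
        case (basic A)
        then obtain a b where A: "A = {a<..<b}" by auto
        have "(\<lambda>x. indicator A x *\<^sub>R g x) = (\<lambda>x. indicator {max a (- real n)<..<min b (real n)} x *\<^sub>R h x)"
          by (auto simp: A g_def indicator_def fun_eq_iff)
        then show ?case using ivl by (simp add: set_lebesgue_integral_def)
      next
        case empty
        show ?case by (simp add: set_lebesgue_integral_def)
      next
        case (compl A)
        have [measurable]: "A \<in> sets lebesgue" using sub compl by blast
        have "(\<lambda>x. indicator (UNIV - A) x *\<^sub>R g x) = (\<lambda>x. g x - indicator A x *\<^sub>R g x)"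
          by (auto simp: indicator_def fun_eq_iff)
        moreover have "integrable lebesgue (\<lambda>x. indicator A x *\<^sub>R g x)"
          by (intro integrable_mult_indicator gi) simp
        ultimately show ?case using compl g0 gi by (simp add: set_lebesgue_integral_def)
      next
        case (union A)
        have "A i \<in> sets lebesgue" for i using sub union by blast
        then have "set_lebesgue_integral lebesgue (\<Union>i. A i) g = (\<Sum>i. set_lebesgue_integral lebesgue (A i) g)"
          using union gi
          by (intro lebesgue_integral_countable_add)
            (auto simp: disjoint_family_on_def set_integrable_def intro!: integrable_mult_indicator)
        then show ?case using union by simp
      qed
    qed
    have "AE x in lebesgue. g x = 0"
    proof (rule sigma_finite_measure.density_zero[OF sigma_finite_lebesgue gi])
      \<comment> \<open>A Lebesgue set differs from a Borel set only inside a null set.\<close>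
      fix A assume A: "A \<in> sets (lebesgue :: real measure)"
      then obtain S N N' where SN: "A = S \<union> N" "N \<subseteq> N'" "N' \<in> null_sets lborel" "S \<in> sets lborel"
        by (auto elim: sets_completionE)
      have "AE x in lebesgue. x \<notin> N'" using SN by (intro AE_not_in null_sets_completionI)
      then have "AE x in lebesgue. indicator A x *\<^sub>R g x = indicator S x *\<^sub>R g x"
        by eventually_elim (use SN in \<open>auto simp: indicator_def\<close>)
      moreover have [measurable]: "g \<in> borel_measurable lebesgue" "A \<in> sets lebesgue" "S \<in> sets lebesgue"
        using gi A SN by auto
      ultimately have "set_lebesgue_integral lebesgue A g = set_lebesgue_integral lebesgue S g"
        unfolding set_lebesgue_integral_def by (intro integral_cong_AE) auto
      then show "set_lebesgue_integral lebesgue A g = 0" using borel0 SN by simp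
    qed
    then show ?thesis by (simp add: g_def)
  qed
  then have "AE x in lebesgue. \<forall>n. indicator {- real n<..<real n} x *\<^sub>R h x = 0"
    unfolding AE_all_countable by blast
  then show ?thesis
  proof eventually_elim
    case (elim x)
    obtain n where "\<bar>x\<bar> < real n" using reals_Archimedean2 by blast
    then show ?case using elim[rule_format, of n] by (auto simp: abs_less_iff indicator_def split: if_splits)
  qed
qed


section \<open>Calculus of weak derivatives and of local \<open>L2\<close> functions\<close>

lemma test_function_differentiable: "test_function \<phi> \<Longrightarrow> \<phi> field_differentiable (at x)"
  unfolding test_function_def by (metis funpow_0)

lemma test_function_measurable [measurable]:
  assumes "test_function \<phi>" shows "\<phi> \<in> borel_measurable lebesgue"
proof -
  have "continuous_on UNIV \<phi>"
    using test_function_differentiable[OF assms]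
    by (meson continuous_at_imp_continuous_on field_differentiable_imp_continuous_at)
  then show ?thesis
    using borel_measurable_continuous_onI measurable_completion by (metis measurable_lborel2)
qed

text \<open>One inequality carries both the bound and the support, in the form in which domination
  is used. \<open>M\<close> may be negative when \<open>K\<close> is empty, so later estimates pass
  to absolute values.\<close>

lemma test_function_bounded:
  assumes "test_function \<phi>"
  obtains K M where "compact K" "\<And>x. \<bar>\<phi> x\<bar> \<le> M * indicator K x"
proof -
  define K where "K = closure {x. \<phi> x \<noteq> 0}"
  have K: "compact K" using assms by (simp add: test_function_def K_def)
  have "continuous_on K \<phi>"
    using test_function_differentiable[OF assms]
    by (meson continuous_at_imp_continuous_on field_differentiable_imp_continuous_at)
  then have "bounded (\<phi> ` K)" using K by (intro compact_imp_bounded compact_continuous_image)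
  then obtain M where M: "\<And>x. x \<in> K \<Longrightarrow> \<bar>\<phi> x\<bar> \<le> M" by (auto simp: bounded_iff)
  have "\<phi> x = 0" if "x \<notin> K" for x using that closure_subset[of "{x. \<phi> x \<noteq> 0}"] by (auto simp: K_def)
  then have "\<bar>\<phi> x\<bar> \<le> M * indicator K x" for x
    using M[of x] by (auto simp: indicator_def)
  then show ?thesis using that K by blast
qed

lemma test_function_deriv:
  assumes "test_function \<phi>" shows "test_function (deriv \<phi>)"
proof -
  have "(deriv ^^ k) (deriv \<phi>) field_differentiable (at x)" for k x
    using assms unfolding test_function_def by (metis funpow_swap1 comp_apply funpow.simps(2))
  moreover have "compact (closure {x. deriv \<phi> x \<noteq> 0})"
  proof -
    have "{x. deriv \<phi> x \<noteq> 0} \<subseteq> closure {x. \<phi> x \<noteq> 0}"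
    proof (rule ccontr)
      assume "\<not> ?thesis"
      then obtain x where x: "deriv \<phi> x \<noteq> 0" "x \<in> - closure {x. \<phi> x \<noteq> 0}" by auto
      have "((\<lambda>x. 0) has_field_derivative 0) (at x)" by simp
      then have "(\<phi> has_field_derivative 0) (at x)"
        by (rule has_field_derivative_transform_within_open[OF _ _ x(2)])
          (use closure_subset[of "{x. \<phi> x \<noteq> 0}"] in auto)
      then show False using x by (simp add: DERIV_imp_deriv)
    qed
    then have "closure {x. deriv \<phi> x \<noteq> 0} \<subseteq> closure {x. \<phi> x \<noteq> 0}"
      by (simp add: closure_minimal)
    then show ?thesis
      using assms by (metis closed_closure compact_Int_closed inf.absorb_iff2 test_function_def)
  qed
  ultimately show ?thesis by (simp add: test_function_def)
qed

lemma test_function_integrable: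
  assumes "test_function \<phi>" "f \<in> L1loc"
  shows "integrable lebesgue (\<lambda>x. \<phi> x *\<^sub>R f x)"
proof -
  obtain K M where KM: "compact K" "\<And>x. \<bar>\<phi> x\<bar> \<le> M * indicator K x"
    using test_function_bounded[OF assms(1)] by blast
  have [measurable]: "f \<in> borel_measurable lebesgue" using assms by (simp add: L1loc_def)
  have "integrable lebesgue (\<lambda>x. M *\<^sub>R (indicator K x *\<^sub>R f x))"
    using assms(2) KM(1) by (auto simp: L1loc_def set_integrable_def simp del: scaleR_scaleR)
  then show ?thesis
  proof (rule Bochner_Integration.integrable_bound)
    show "AE x in lebesgue. norm (\<phi> x *\<^sub>R f x) \<le> norm (M *\<^sub>R indicator K x *\<^sub>R f x)"
    proof (rule AE_I2)
      fix x
      have "norm (\<phi> x *\<^sub>R f x) \<le> (M * indicator K x) * norm (f x)"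
        using KM(2) by (auto intro: mult_right_mono)
      also have "\<dots> \<le> \<bar>M * indicator K x\<bar> * norm (f x)" by (intro mult_right_mono) auto
      finally show "norm (\<phi> x *\<^sub>R f x) \<le> norm (M *\<^sub>R indicator K x *\<^sub>R f x)"
        by (simp add: abs_mult mult.assoc)
    qed
  qed (use assms(1) in measurable)
qed

lemma L1loc_add: "f \<in> L1loc \<Longrightarrow> g \<in> L1loc \<Longrightarrow> (\<lambda>x. f x + g x) \<in> L1loc"
  by (auto simp: L1loc_def intro: set_integral_add)

lemma L1loc_scaleR: "f \<in> L1loc \<Longrightarrow> (\<lambda>x. c *\<^sub>R f x) \<in> L1loc"
  by (auto simp: L1loc_def set_integrable_def scaleR_left_commute[of _ c] simp del: scaleR_scaleR)

lemma has_weak_deriv_add: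
  "has_weak_deriv f f' \<Longrightarrow> has_weak_deriv g g' \<Longrightarrow> has_weak_deriv (\<lambda>x. f x + g x) (\<lambda>x. f' x + g' x)"
  unfolding has_weak_deriv_def
  by (auto simp: scaleR_add_right test_function_integrable test_function_deriv L1loc_add)

lemma has_weak_deriv_scaleR:
  "has_weak_deriv f f' \<Longrightarrow> has_weak_deriv (\<lambda>x. c *\<^sub>R f x) (\<lambda>x. c *\<^sub>R f' x)"
  unfolding has_weak_deriv_def
  by (auto simp: scaleR_left_commute[of _ c] L1loc_scaleR simp del: scaleR_scaleR)

lemma has_weak_deriv_unique:
  assumes "has_weak_deriv f g" "has_weak_deriv f h"
  shows "AE x in lebesgue. g x = h x"
proof -
  have "AE x in lebesgue. g x + (- 1) *\<^sub>R h x = 0"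
  proof (rule L1loc_ae_zeroI)
    show L: "(\<lambda>x. g x + (- 1) *\<^sub>R h x) \<in> L1loc"
      using assms by (intro L1loc_add L1loc_scaleR) (auto simp: has_weak_deriv_def)
    fix \<phi> assume \<phi>: "test_function \<phi>"
    then have "integrable lebesgue (\<lambda>x. \<phi> x *\<^sub>R g x)" "integrable lebesgue (\<lambda>x. \<phi> x *\<^sub>R h x)"
      using assms by (auto intro!: test_function_integrable simp: has_weak_deriv_def)
    then show "(\<integral>x. \<phi> x *\<^sub>R (g x + (- 1) *\<^sub>R h x) \<partial>lebesgue) = 0"
      using assms \<phi> by (auto simp: scaleR_diff_right has_weak_deriv_def)
  qed
  then show ?thesis by simp
qed

lemma L2loc_cong_AE:
  assumes "f \<in> L2loc" "AE x in lebesgue. f x = g x" "g \<in> borel_measurable lebesgue"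
  shows "g \<in> L2loc"
proof -
  have "set_integrable lebesgue K (\<lambda>x. (norm (g x))\<^sup>2)" if "compact K" for K
  proof -
    have [measurable]: "K \<in> sets lebesgue" using that by (simp add: borel_compact)
    have [measurable]: "f \<in> borel_measurable lebesgue" using assms by (simp add: L2loc_def)
    note assms(3)[measurable]
    have "set_integrable lebesgue K (\<lambda>x. (norm (f x))\<^sup>2)" using assms that by (simp add: L2loc_def)
    then show ?thesis unfolding set_integrable_def
      by (rule integrable_cong_AE_imp) (use assms(2) in auto)
  qed
  then show ?thesis using assms by (simp add: L2loc_def)
qed

lemma weak_deriv_AE_eq:
  assumes "has_weak_deriv f g" shows "AE x in lebesgue. weak_deriv f x = g x"
  using has_weak_deriv_unique[OF _ assms] someI[of "has_weak_deriv f", OF assms]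
  by (simp add: weak_deriv_def)

lemma has_weak_deriv_weak_deriv:
  assumes "has_weak_deriv f g" shows "has_weak_deriv f (weak_deriv f)"
  using someI[of "has_weak_deriv f", OF assms] by (simp add: weak_deriv_def)

text \<open>\<open>weak_deriv\<close> is an arbitrary choice among representatives; its local square
  integrability is inherited from the witness in \<open>H1loc\<close> through uniqueness almost
  everywhere.\<close>

lemma H1locD:
  assumes "f \<in> H1loc"
  shows "f \<in> L2loc" "has_weak_deriv f (weak_deriv f)" "weak_deriv f \<in> L2loc"
proof -
  from assms obtain g where g: "f \<in> L2loc" "has_weak_deriv f g" "g \<in> L2loc"
    by (auto simp: H1loc_def)
  show "f \<in> L2loc" "has_weak_deriv f (weak_deriv f)" using g has_weak_deriv_weak_deriv by auto
  then show "weak_deriv f \<in> L2loc"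
    using weak_deriv_AE_eq[OF g(2)]
    by (intro L2loc_cong_AE[OF g(3)]) (auto simp: has_weak_deriv_def L1loc_def)
qed

lemma L2loc_measurable: "f \<in> L2loc \<Longrightarrow> f \<in> borel_measurable lebesgue"
  by (simp add: L2loc_def)

lemma L2loc_add:
  assumes "f \<in> L2loc" "g \<in> L2loc" shows "(\<lambda>x. f x + g x) \<in> L2loc"
proof -
  note [measurable] = assms[THEN L2loc_measurable]
  have "set_integrable lebesgue K (\<lambda>x. (norm (f x + g x))\<^sup>2)" if "compact K" for K
  proof -
    have [measurable]: "K \<in> sets lebesgue" using that by (simp add: borel_compact)
    have "set_integrable lebesgue K (\<lambda>x. 2 * (norm (f x))\<^sup>2 + 2 * (norm (g x))\<^sup>2)"
      using assms that by (intro set_integral_add set_integrable_mult_right) (auto simp: L2loc_def)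
    then show ?thesis unfolding set_integrable_def
    proof (rule Bochner_Integration.integrable_bound)
      show "AE x in lebesgue. norm (indicat_real K x *\<^sub>R (norm (f x + g x))\<^sup>2)
          \<le> norm (indicat_real K x *\<^sub>R (2 * (norm (f x))\<^sup>2 + 2 * (norm (g x))\<^sup>2))"
      proof (rule AE_I2)
        fix x
        have "(norm (f x + g x))\<^sup>2 \<le> (norm (f x) + norm (g x))\<^sup>2"
          by (intro power_mono norm_triangle_ineq) auto
        also have "\<dots> \<le> 2 * (norm (f x))\<^sup>2 + 2 * (norm (g x))\<^sup>2"
          using sum_squares_bound[of "norm (f x)" "norm (g x)"] by (simp add: power2_sum)
        finally show "norm (indicat_real K x *\<^sub>R (norm (f x + g x))\<^sup>2)
          \<le> norm (indicat_real K x *\<^sub>R (2 * (norm (f x))\<^sup>2 + 2 * (norm (g x))\<^sup>2))"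
          by (auto simp: indicator_def)
      qed
    qed measurable
  qed
  then show ?thesis by (simp add: L2loc_def)
qed

lemma L2loc_scaleR: "f \<in> L2loc \<Longrightarrow> (\<lambda>x. c *\<^sub>R f x) \<in> L2loc"
  by (auto simp: L2loc_def power_mult_distrib intro!: set_integrable_mult_right)

lemma L2loc_sum: "(\<And>i. i \<in> I \<Longrightarrow> f i \<in> L2loc) \<Longrightarrow> (\<lambda>x. \<Sum>i\<in>I. f i x) \<in> L2loc"
proof (induction I rule: infinite_finite_induct)
  case (insert i I)
  then show ?case by (simp add: L2loc_add)
qed (simp_all add: L2loc_def set_integrable_def)

lemma has_weak_deriv_sum:
  "(\<And>i. i \<in> I \<Longrightarrow> has_weak_deriv (f i) (g i)) \<Longrightarrow>
    has_weak_deriv (\<lambda>x. \<Sum>i\<in>I. f i x) (\<lambda>x. \<Sum>i\<in>I. g i x)"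
proof (induction I rule: infinite_finite_induct)
  case (insert i I)
  then show ?case by (simp add: has_weak_deriv_add)
qed (simp_all add: has_weak_deriv_def L1loc_def set_integrable_def)

subsection \<open>The space \<open>L2\<close>\<close>


definition L2_inner :: "(real \<Rightarrow> 'a::euclidean_space) \<Rightarrow> (real \<Rightarrow> 'a) \<Rightarrow> real" where
  "L2_inner f g = (\<integral>x. f x \<bullet> g x \<partial>lebesgue)"

lemma L2_measurable: "f \<in> L2 \<Longrightarrow> f \<in> borel_measurable lebesgue"
  by (simp add: L2_def)

lemma L2_inner_integrable:
  assumes "f \<in> L2" "g \<in> L2" shows "integrable lebesgue (\<lambda>x. f x \<bullet> g x)"
proof -
  note [measurable] = assms[THEN L2_measurable]
  have "integrable lebesgue (\<lambda>x. (norm (f x))\<^sup>2 + (norm (g x))\<^sup>2)"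
    using assms by (simp add: L2_def)
  then show ?thesis
  proof (rule Bochner_Integration.integrable_bound)
    show "AE x in lebesgue. norm (f x \<bullet> g x) \<le> norm ((norm (f x))\<^sup>2 + (norm (g x))\<^sup>2)"
    proof (rule AE_I2)
      fix x
      have "\<bar>f x \<bullet> g x\<bar> \<le> norm (f x) * norm (g x)" by (rule Cauchy_Schwarz_ineq2)
      also have "\<dots> \<le> (norm (f x))\<^sup>2 + (norm (g x))\<^sup>2"
        using sum_squares_bound[of "norm (f x)" "norm (g x)"]
          mult_nonneg_nonneg[OF norm_ge_zero[of "f x"] norm_ge_zero[of "g x"]] by linarith
      finally show "norm (f x \<bullet> g x) \<le> norm ((norm (f x))\<^sup>2 + (norm (g x))\<^sup>2)" by simp
    qed
  qed simp
qed

lemma L2_scaleR: "f \<in> L2 \<Longrightarrow> (\<lambda>x. c *\<^sub>R f x) \<in> L2"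
  by (auto simp: L2_def power_mult_distrib)

lemma L2_add:
  assumes "f \<in> L2" "g \<in> L2" shows "(\<lambda>x. f x + g x) \<in> L2"
proof -
  note [measurable] = assms[THEN L2_measurable]
  have "integrable lebesgue (\<lambda>x. (norm (f x))\<^sup>2 + 2 * (f x \<bullet> g x) + (norm (g x))\<^sup>2)"
    using assms L2_inner_integrable[OF assms] by (simp add: L2_def)
  moreover have "(\<lambda>x. (norm (f x))\<^sup>2 + 2 * (f x \<bullet> g x) + (norm (g x))\<^sup>2) = (\<lambda>x. (norm (f x + g x))\<^sup>2)"
    by (auto simp: power2_norm_eq_inner inner_add_left inner_add_right inner_commute)
  ultimately show ?thesis by (simp add: L2_def)
qed

lemma L2_diff: "f \<in> L2 \<Longrightarrow> g \<in> L2 \<Longrightarrow> (\<lambda>x. f x - g x) \<in> L2"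
  using L2_add[of f "\<lambda>x. (-1) *\<^sub>R g x"] L2_scaleR[of g "-1"] by simp

lemma L2_sum: "(\<And>i. i \<in> I \<Longrightarrow> f i \<in> L2) \<Longrightarrow> (\<lambda>x. \<Sum>i\<in>I. f i x) \<in> L2"
proof (induction I rule: infinite_finite_induct)
  case (insert i I)
  then show ?case by (simp add: L2_add)
qed (simp_all add: L2_def)

lemma L2_inner_commute: "L2_inner f g = L2_inner g f"
  by (simp add: L2_inner_def inner_commute)

lemma L2_inner_self: "L2_inner f f = (\<integral>x. (norm (f x))\<^sup>2 \<partial>lebesgue)"
  by (simp add: L2_inner_def power2_norm_eq_inner)

lemma L2_inner_ge_zero: "L2_inner f f \<ge> 0"
  by (simp add: L2_inner_def)

lemma L2_inner_diff_left:
  "f \<in> L2 \<Longrightarrow> g \<in> L2 \<Longrightarrow> h \<in> L2 \<Longrightarrow> L2_inner (\<lambda>x. f x - g x) h = L2_inner f h - L2_inner g h"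
  by (simp add: L2_inner_def inner_diff_left L2_inner_integrable)

lemma L2_inner_diff_right:
  "f \<in> L2 \<Longrightarrow> g \<in> L2 \<Longrightarrow> h \<in> L2 \<Longrightarrow> L2_inner h (\<lambda>x. f x - g x) = L2_inner h f - L2_inner h g"
  by (simp add: L2_inner_def inner_diff_right L2_inner_integrable)

lemma L2_inner_scaleR_left: "L2_inner (\<lambda>x. c *\<^sub>R f x) g = c * L2_inner f g"
  by (simp add: L2_inner_def)

lemma L2_inner_scaleR_right: "L2_inner f (\<lambda>x. c *\<^sub>R g x) = c * L2_inner f g"
  by (simp add: L2_inner_def)

lemma L2_inner_sum_left:
  "(\<And>i. i \<in> I \<Longrightarrow> f i \<in> L2) \<Longrightarrow> h \<in> L2 \<Longrightarrow>
    L2_inner (\<lambda>x. \<Sum>i\<in>I. f i x) h = (\<Sum>i\<in>I. L2_inner (f i) h)"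
  by (simp add: L2_inner_def inner_sum_left L2_inner_integrable)

lemma L2_inner_sum_right:
  "(\<And>i. i \<in> I \<Longrightarrow> f i \<in> L2) \<Longrightarrow> h \<in> L2 \<Longrightarrow>
    L2_inner h (\<lambda>x. \<Sum>i\<in>I. f i x) = (\<Sum>i\<in>I. L2_inner h (f i))"
  by (simp add: L2_inner_def inner_sum_right L2_inner_integrable)

lemma L2_inner_diff_self:
  assumes "f \<in> L2" "g \<in> L2"
  shows "L2_inner (\<lambda>x. f x - g x) (\<lambda>x. f x - g x) = L2_inner f f - 2 * L2_inner f g + L2_inner g g"
  using assms by (simp add: L2_inner_diff_left L2_inner_diff_right L2_diff L2_inner_commute[of g f])

lemma L2_Cauchy_Schwarz:
  assumes "f \<in> L2" "g \<in> L2"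
  shows "\<bar>L2_inner f g\<bar> \<le> sqrt (L2_inner f f) * sqrt (L2_inner g g)"
proof -
  define A B D where "A = L2_inner f f" and "B = L2_inner f g" and "D = L2_inner g g"
  have q: "0 \<le> A - 2 * (t * B) + t\<^sup>2 * D" for t
    using L2_inner_diff_self[OF assms(1) L2_scaleR[OF assms(2), of t]]
      L2_inner_ge_zero[of "\<lambda>x. f x - t *\<^sub>R g x"]
    by (simp add: A_def B_def D_def L2_inner_scaleR_left L2_inner_scaleR_right power2_eq_square mult.assoc)
  have D: "D \<ge> 0" by (simp add: D_def L2_inner_ge_zero)
  have "B\<^sup>2 \<le> A * D"
  proof (cases "D = 0")
    case True
    have "B = 0"
    proof (rule ccontr)
      assume "B \<noteq> 0"
      \<comment> \<open>With \<open>D = 0\<close> the quadratic is affine in \<open>t\<close>, and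
        at this value of \<open>t\<close> it equals -1.\<close>
      then show False using q[of "(A + 1) / (2 * B)"] True by (simp add: field_simps)
    qed
    then show ?thesis using True by simp
  next
    case False
    then have "D > 0" using D by simp
    then have "B\<^sup>2 / D \<le> A" using q[of "B / D"] by (simp add: field_simps power2_eq_square)
    then show ?thesis using \<open>D > 0\<close> by (simp add: field_simps)
  qed
  then have "sqrt (B\<^sup>2) \<le> sqrt (A * D)" by (rule real_sqrt_le_mono)
  then show ?thesis by (simp add: A_def B_def D_def real_sqrt_mult)
qed

text \<open>Riesz-Fischer: a rapidly Cauchy subsequence converges almost everywhere, and Fatou's
  lemma shows that its pointwise limit is also the limit of the whole sequence in
  \<open>L2\<close>.\<close>

lemma L2_complete:
  fixes f :: "nat \<Rightarrow> real \<Rightarrow> 'a::euclidean_space"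
  assumes f: "\<And>n. f n \<in> L2"
    and cauchy: "\<And>e. e > 0 \<Longrightarrow> \<exists>N. \<forall>m\<ge>N. \<forall>n\<ge>N. L2_inner (\<lambda>x. f m x - f n x) (\<lambda>x. f m x - f n x) < e"
  obtains g where "g \<in> L2" "(\<lambda>n. L2_inner (\<lambda>x. f n x - g x) (\<lambda>x. f n x - g x)) \<longlonglongrightarrow> 0"
proof -
  note fm[measurable] = f[THEN L2_measurable]
  define nn where "nn = (\<lambda>h :: real \<Rightarrow> 'a. \<integral>\<^sup>+x. ennreal ((norm (h x))\<^sup>2) \<partial>lebesgue)"
  have nn: "nn h = ennreal (L2_inner h h)" if "h \<in> L2" for h
    unfolding nn_def L2_inner_self using that by (intro nn_integral_eq_integral) (auto simp: L2_def)
  \<comment> \<open>The rate \<open>(1/16) ^ k\<close> leaves room for the weight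
    \<open>4 ^ k\<close>: the weighted squares still have the summable integrals
    \<open>(1/4) ^ k\<close>, and their finiteness at a point bounds the increments there by a
    multiple of \<open>(1/2) ^ k\<close>.\<close>
  have "\<forall>k. \<exists>N. \<forall>m\<ge>N. \<forall>n\<ge>N. L2_inner (\<lambda>x. f m x - f n x) (\<lambda>x. f m x - f n x) < (1/16) ^ k"
    using cauchy by simp
  then obtain N where N: "\<And>k m n. m \<ge> N k \<Longrightarrow> n \<ge> N k \<Longrightarrow>
      L2_inner (\<lambda>x. f m x - f n x) (\<lambda>x. f m x - f n x) < (1/16) ^ k" by metis
  \<comment> \<open>The summand \<open>k\<close> gives \<open>s k \<ge> k\<close>, needed when
    Fatou's lemma is applied; the sum of the \<open>N i\<close> puts \<open>s k\<close> above every
    earlier threshold.\<close>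
  define s where "s = (\<lambda>k. k + (\<Sum>i\<le>k. N i))"
  have sN: "s k \<ge> N j" if "j \<le> k" for j k
    unfolding s_def using that by (intro trans_le_add2 member_le_sum) auto
  define d where "d = (\<lambda>k x. f (s (Suc k)) x - f (s k) x)"
  have d: "d k \<in> L2" for k using f by (simp add: d_def L2_diff)
  note [measurable] = d[THEN L2_measurable]
  have dk: "L2_inner (d k) (d k) \<le> (1/16) ^ k" for k
    unfolding d_def using N[of k "s (Suc k)" "s k"] sN by (simp add: less_imp_le)
  have "(\<integral>\<^sup>+x. (\<Sum>k. ennreal (4 ^ k * (norm (d k x))\<^sup>2)) \<partial>lebesgue) =
      (\<Sum>k. \<integral>\<^sup>+x. ennreal (4 ^ k * (norm (d k x))\<^sup>2) \<partial>lebesgue)"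
    by (intro nn_integral_suminf) auto
  also have "\<dots> \<le> (\<Sum>k. ennreal ((1/4) ^ k))"
  proof (rule suminf_le)
    fix k
    have "(\<integral>\<^sup>+x. ennreal (4 ^ k * (norm (d k x))\<^sup>2) \<partial>lebesgue) = ennreal (4 ^ k) * nn (d k)"
      unfolding nn_def by (simp add: ennreal_mult nn_integral_cmult)
    also have "\<dots> = ennreal (4 ^ k * L2_inner (d k) (d k))"
      by (simp add: nn[OF d] ennreal_mult L2_inner_ge_zero)
    also have "\<dots> \<le> ennreal (4 ^ k * (1/16) ^ k)"
      using dk by (intro ennreal_leI mult_left_mono) auto
    also have "4 ^ k * (1/16) ^ k = ((1/4) ^ k :: real)" by (simp add: power_mult_distrib[symmetric])
    finally show "(\<integral>\<^sup>+x. ennreal (4 ^ k * (norm (d k x))\<^sup>2) \<partial>lebesgue) \<le> ennreal ((1/4) ^ k)" .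
  qed auto
  also have "\<dots> < \<infinity>"
    using summable_geometric[of "1/4::real"] by (subst suminf_ennreal2) auto
  finally have "AE x in lebesgue. (\<Sum>k. ennreal (4 ^ k * (norm (d k x))\<^sup>2)) \<noteq> \<infinity>"
    by (intro nn_integral_PInf_AE) auto
  then have conv: "AE x in lebesgue. convergent (\<lambda>k. f (s k) x)"
  proof eventually_elim
    case (elim x)
    define c where "c = enn2real (\<Sum>k. ennreal (4 ^ k * (norm (d k x))\<^sup>2))"
    have ec: "ennreal c = (\<Sum>k. ennreal (4 ^ k * (norm (d k x))\<^sup>2))"
      using elim by (metis c_def ennreal_enn2real infinity_ennreal_def top.not_eq_extremum)
    have le: "F k \<le> (\<Sum>k. F k)" for F :: "nat \<Rightarrow> ennreal" and k
      using sum_le_suminf[OF summableI, of "{k}" F] by simp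
    have "ennreal (4 ^ k * (norm (d k x))\<^sup>2) \<le> ennreal c" for k
      unfolding ec by (rule le)
    moreover have "c \<ge> 0" by (simp add: c_def)
    ultimately have c: "4 ^ k * (norm (d k x))\<^sup>2 \<le> c" for k by simp
    have "norm (d k x) \<le> sqrt c * (1/2) ^ k" for k
    proof -
      have "(2 ^ k)\<^sup>2 = (4 ^ k :: real)" by (simp add: power2_eq_square power_mult_distrib[symmetric])
      then have "(2 ^ k * norm (d k x))\<^sup>2 \<le> c" using c[of k] by (simp add: power_mult_distrib)
      then have "2 ^ k * norm (d k x) \<le> sqrt c" by (rule real_le_rsqrt)
      then show ?thesis by (simp add: power_one_over field_simps)
    qed
    moreover have "summable (\<lambda>k. sqrt c * (1/2) ^ k)" by (simp add: summable_mult summable_geometric)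
    ultimately have "summable (\<lambda>k. d k x)"
      by (rule summable_comparison_test'[where N = 0, rotated])
    then have "convergent (\<lambda>n. \<Sum>k<n. d k x)" by (simp add: summable_iff_convergent)
    moreover have "(\<Sum>k<n. d k x) = f (s n) x - f (s 0) x" for n
      unfolding d_def by (rule sum_lessThan_telescope)
    ultimately have "convergent (\<lambda>n. (f (s n) x - f (s 0) x) + f (s 0) x)"
      by (intro convergent_add convergent_const) simp
    then show ?case by simp
  qed
  define g where "g = (\<lambda>x. lim (\<lambda>k. f (s k) x))"
  have [measurable]: "g \<in> borel_measurable lebesgue" unfolding g_def by measurable
  have lim: "AE x in lebesgue. (\<lambda>k. f (s k) x) \<longlonglongrightarrow> g x"
    using conv by eventually_elim (simp add: g_def convergent_LIMSEQ_iff)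
  \<comment> \<open>Stated with the nonnegative integral because membership of \<open>g\<close> in
    \<open>L2\<close> is not known yet; it is deduced from one instance of this estimate.\<close>
  have close: "nn (\<lambda>x. f n x - g x) \<le> ennreal e" if e: "\<forall>m\<ge>M. \<forall>n\<ge>M. L2_inner (\<lambda>x. f m x - f n x) (\<lambda>x. f m x - f n x) < e"
    "n \<ge> M" "e > 0" for n M e
  proof -
    have "nn (\<lambda>x. f n x - g x) = (\<integral>\<^sup>+x. liminf (\<lambda>k. ennreal ((norm (f n x - f (s (k + M)) x))\<^sup>2)) \<partial>lebesgue)"
      unfolding nn_def
    proof (rule nn_integral_cong_AE)
      show "AE x in lebesgue. ennreal ((norm (f n x - g x))\<^sup>2) =
        liminf (\<lambda>k. ennreal ((norm (f n x - f (s (k + M)) x))\<^sup>2))"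
        using lim
      proof eventually_elim
        case (elim x)
        then have "(\<lambda>k. f (s (k + M)) x) \<longlonglongrightarrow> g x" by (rule LIMSEQ_ignore_initial_segment)
        then have "(\<lambda>k. ennreal ((norm (f n x - f (s (k + M)) x))\<^sup>2)) \<longlonglongrightarrow> ennreal ((norm (f n x - g x))\<^sup>2)"
          by (intro tendsto_intros)
        then show ?case by (rule lim_imp_Liminf[OF trivial_limit_sequentially, symmetric])
      qed
    qed
    also have "\<dots> \<le> liminf (\<lambda>k. nn (\<lambda>x. f n x - f (s (k + M)) x))"
      unfolding nn_def by (intro nn_integral_liminf) auto
    also have "\<dots> \<le> ennreal e"
    proof -
      have "nn (\<lambda>x. f n x - f (s (k + M)) x) \<le> ennreal e" for k
      proof -
        have "s (k + M) \<ge> M" by (simp add: s_def)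
        then have "L2_inner (\<lambda>x. f n x - f (s (k + M)) x) (\<lambda>x. f n x - f (s (k + M)) x) < e"
          using e by blast
        then show ?thesis using nn[OF L2_diff[OF f f]] by (simp add: ennreal_leI less_imp_le)
      qed
      then show ?thesis by (intro Liminf_le) auto
    qed
    finally show ?thesis .
  qed
  obtain M where M: "\<forall>m\<ge>M. \<forall>n\<ge>M. L2_inner (\<lambda>x. f m x - f n x) (\<lambda>x. f m x - f n x) < 1"
    using cauchy[of 1] by auto
  have "nn (\<lambda>x. f M x - g x) \<le> ennreal 1" using close[OF M order_refl] by simp
  also have "\<dots> < \<infinity>" by simp
  finally have "nn (\<lambda>x. f M x - g x) < \<infinity>" .
  then have "(\<lambda>x. f M x - g x) \<in> L2"
    by (simp add: L2_def integrable_iff_bounded nn_def)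
  from L2_diff[OF f[of M] this] have g: "g \<in> L2" by simp
  have "(\<lambda>n. L2_inner (\<lambda>x. f n x - g x) (\<lambda>x. f n x - g x)) \<longlonglongrightarrow> 0"
  proof (rule LIMSEQ_I)
    fix r :: real assume r: "r > 0"
    then obtain M where M: "\<forall>m\<ge>M. \<forall>n\<ge>M. L2_inner (\<lambda>x. f m x - f n x) (\<lambda>x. f m x - f n x) < r / 2"
      using cauchy[of "r / 2"] by auto
    have "norm (L2_inner (\<lambda>x. f n x - g x) (\<lambda>x. f n x - g x) - 0) < r" if "n \<ge> M" for n
    proof -
      have "ennreal (L2_inner (\<lambda>x. f n x - g x) (\<lambda>x. f n x - g x)) \<le> ennreal (r / 2)"
        using close[OF M that] r by (simp add: nn[OF L2_diff[OF f g]])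
      then have "L2_inner (\<lambda>x. f n x - g x) (\<lambda>x. f n x - g x) \<le> r / 2"
        using r by simp
      then show ?thesis using r L2_inner_ge_zero[of "\<lambda>x. f n x - g x"] by simp
    qed
    then show "\<exists>no. \<forall>n\<ge>no. norm (L2_inner (\<lambda>x. f n x - g x) (\<lambda>x. f n x - g x) - 0) < r" by blast
  qed
  with g show ?thesis by (rule that)
qed

subsection \<open>Weak compactness in \<open>L2\<close>\<close>


lemma cesaro_mean_tendsto:
  fixes c :: "nat \<Rightarrow> real"
  assumes "c \<longlonglongrightarrow> l"
  shows "(\<lambda>N. (\<Sum>i<N. c i) / real N) \<longlonglongrightarrow> l"
proof (rule LIMSEQ_I)
  fix e :: real assume e: "e > 0"
  obtain n0 where n0: "\<And>i. i \<ge> n0 \<Longrightarrow> \<bar>c i - l\<bar> < e / 2"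
    using LIMSEQ_D[OF assms, of "e / 2"] e by auto
  define S where "S = (\<Sum>i<n0. \<bar>c i - l\<bar>)"
  have S: "S \<ge> 0" by (simp add: S_def sum_nonneg)
  obtain n1 where n1: "real n1 > 2 * S / e" using reals_Archimedean2 by blast
  have "norm ((\<Sum>i<N. c i) / real N - l) < e" if N: "N \<ge> max 1 (max n0 n1)" for N
  proof -
    have Np: "real N > 0" and "2 * S / e < real N" using N n1 by linarith+
    then have SN: "S < real N * (e / 2)" using e by (simp add: field_simps)
    have "(\<Sum>i<N. c i) / real N - l = (\<Sum>i<N. c i - l) / real N"
      using Np by (simp add: sum_subtractf field_simps)
    also have "\<bar>\<dots>\<bar> \<le> (\<Sum>i<N. \<bar>c i - l\<bar>) / real N"
      using Np by (simp add: abs_divide divide_right_mono)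
    also have "(\<Sum>i<N. \<bar>c i - l\<bar>) \<le> S + (\<Sum>i\<in>{n0..<N}. e / 2)"
    proof -
      have "{..<N} = {..<n0} \<union> {n0..<N}" using N by auto
      then have "(\<Sum>i<N. \<bar>c i - l\<bar>) = S + (\<Sum>i\<in>{n0..<N}. \<bar>c i - l\<bar>)"
        unfolding S_def by (simp add: sum.union_disjoint ivl_disj_int)
      also have "(\<Sum>i\<in>{n0..<N}. \<bar>c i - l\<bar>) \<le> (\<Sum>i\<in>{n0..<N}. e / 2)"
        using n0 by (intro sum_mono) (auto simp: less_imp_le)
      finally show ?thesis by simp
    qed
    also have "(\<Sum>i\<in>{n0..<N}. e / 2) \<le> real N * (e / 2)" using e by (simp add: mult_right_mono)
    finally have "\<bar>(\<Sum>i<N. c i) / real N - l\<bar> \<le> (S + real N * (e / 2)) / real N"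
      using Np by (simp add: divide_right_mono)
    also have "\<dots> < e" using SN Np by (simp add: field_simps)
    finally show ?thesis by simp
  qed
  then show "\<exists>no. \<forall>N\<ge>no. norm ((\<Sum>i<N. c i) / real N - l) < e" by blast
qed

text \<open>\<open>G\<close> stands for a matrix of inner products, \<open>b m\<close> for the
  limiting product with the vector of index \<open>m\<close>, and \<open>a\<close> for the limit of
  the \<open>b m\<close>. Choosing each index after its predecessor's products have settled makes
  every off-diagonal entry nearly \<open>a\<close>; the diagonal stays merely bounded. The sum of
  two powers replaces the power at the smaller index because it is symmetric and easily
  summed.\<close>

lemma gram_subseq:
  fixes G :: "nat \<Rightarrow> nat \<Rightarrow> real"
  assumes sym: "\<And>i j. G i j = G j i" and bd: "\<And>i. \<bar>G i i\<bar> \<le> B"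
    and lim: "\<And>m. (\<lambda>n. G n m) \<longlonglongrightarrow> b m" and b: "b \<longlonglongrightarrow> a"
  obtains s where "strict_mono s"
    "\<And>i j. \<bar>G (s i) (s j) - a\<bar> \<le> (1/2)^i + (1/2)^j + (if i = j then B + \<bar>a\<bar> else 0)"
proof -
  \<comment> \<open>The property of a single index controls \<open>b\<close> from there on; the
    relation between consecutive indices controls the products with the earlier vector.\<close>
  have "\<exists>s. \<forall>k. (\<forall>n\<ge>s k. \<bar>b n - a\<bar> \<le> (1/2)^Suc k) \<and>
    (s k < s (Suc k) \<and> (\<forall>n\<ge>s (Suc k). \<bar>G n (s k) - b (s k)\<bar> \<le> (1/2)^Suc k))"
  proof (rule dependent_nat_choice)
    have ev_b: "\<forall>\<^sub>F x in sequentially. \<forall>n\<ge>x. \<bar>b n - a\<bar> \<le> (1/2)^Suc k" for k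
    proof -
      have "\<forall>\<^sub>F n in sequentially. dist (b n) a < (1/2)^Suc k" using b by (rule tendstoD) simp
      then have "\<forall>\<^sub>F n in sequentially. \<bar>b n - a\<bar> \<le> (1/2)^Suc k"
        by eventually_elim (simp add: dist_real_def)
      then show ?thesis unfolding eventually_sequentially by (meson order_trans)
    qed
    show "\<exists>x. \<forall>n\<ge>x. \<bar>b n - a\<bar> \<le> (1/2)^Suc 0"
      using ev_b[of 0] unfolding eventually_sequentially by blast
    fix x k
    have "\<forall>\<^sub>F n in sequentially. dist (G n x) (b x) < (1/2)^Suc k"
      using lim by (rule tendstoD) simp
    then have "\<forall>\<^sub>F n in sequentially. \<bar>G n x - b x\<bar> \<le> (1/2)^Suc k"
      by eventually_elim (simp add: dist_real_def)
    then have "\<forall>\<^sub>F y in sequentially. \<forall>n\<ge>y. \<bar>G n x - b x\<bar> \<le> (1/2)^Suc k"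
      unfolding eventually_sequentially by (meson order_trans)
    then have "\<forall>\<^sub>F y in sequentially. (\<forall>n\<ge>y. \<bar>b n - a\<bar> \<le> (1/2)^Suc (Suc k)) \<and>
        x < y \<and> (\<forall>n\<ge>y. \<bar>G n x - b x\<bar> \<le> (1/2)^Suc k)"
      using ev_b[of "Suc k"] eventually_gt_at_top[of x] by eventually_elim auto
    then show "\<exists>y. (\<forall>n\<ge>y. \<bar>b n - a\<bar> \<le> (1/2)^Suc (Suc k)) \<and>
        x < y \<and> (\<forall>n\<ge>y. \<bar>G n x - b x\<bar> \<le> (1/2)^Suc k)"
      unfolding eventually_sequentially by blast
  qed
  then obtain s where s: "\<And>k n. n \<ge> s k \<Longrightarrow> \<bar>b n - a\<bar> \<le> (1/2)^Suc k" "\<And>k. s k < s (Suc k)"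
    "\<And>k n. n \<ge> s (Suc k) \<Longrightarrow> \<bar>G n (s k) - b (s k)\<bar> \<le> (1/2)^Suc k" by blast
  have mono: "strict_mono s" using s(2) by (simp add: strict_mono_Suc_iff)
  have off: "\<bar>G (s j) (s i) - a\<bar> \<le> (1/2)^i" if "i < j" for i j
  proof -
    have "s j \<ge> s (Suc i)" using mono that by (simp add: strict_mono_less_eq)
    then have "\<bar>G (s j) (s i) - b (s i)\<bar> \<le> (1/2)^Suc i" by (rule s(3))
    moreover have "\<bar>b (s i) - a\<bar> \<le> (1/2)^Suc i" by (rule s(1)) simp
    ultimately show ?thesis by (simp only: power_Suc)
  qed
  have "\<bar>G (s i) (s j) - a\<bar> \<le> (1/2)^i + (1/2)^j + (if i = j then B + \<bar>a\<bar> else 0)" for i j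
  proof (cases rule: linorder_cases[of i j])
    case less
    have "\<bar>G (s i) (s j) - a\<bar> \<le> (1/2)^i" using off[OF less] sym[of "s i" "s j"] by simp
    also have "\<dots> \<le> (1/2)^i + (1/2)^j" by simp
    finally show ?thesis using less by simp
  next
    case equal
    have "\<bar>G (s i) (s i) - a\<bar> \<le> B + \<bar>a\<bar>" using bd[of "s i"] by linarith
    also have "\<dots> \<le> (1/2)^i + (1/2)^i + (B + \<bar>a\<bar>)" by simp
    finally show ?thesis using equal by simp
  next
    case greater
    have "\<bar>G (s i) (s j) - a\<bar> \<le> (1/2)^j" by (rule off[OF greater])
    also have "\<dots> \<le> (1/2)^i + (1/2)^j" by simp
    finally show ?thesis using greater by simp
  qed
  with mono show ?thesis by (rule that)
qed

text \<open>The geometric errors sum to at most \<open>2 * P + 2 * N\<close>, and at most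
  \<open>N\<close> diagonal entries occur, so division by \<open>N * P\<close> makes everything
  small. Rectangular sums are allowed because averages of different lengths have to be
  compared.\<close>

lemma double_cesaro_bound:
  fixes H :: "nat \<Rightarrow> nat \<Rightarrow> real"
  assumes H: "\<And>i j. \<bar>H i j - a\<bar> \<le> (1/2)^i + (1/2)^j + (if i = j then E else 0)" and "E \<ge> 0"
    and N: "N > 0" and P: "P > 0"
  shows "\<bar>(\<Sum>i<N. \<Sum>j<P. H i j) / (real N * real P) - a\<bar> \<le> (2 + E) * (1 / real N + 1 / real P)"
proof -
  have geo: "(\<Sum>i<n. (1/2)^i) \<le> (2::real)" for n
  proof -
    have "(\<Sum>i<n. (1/2)^i) = 2 - 2 * (1/2::real)^n"
      by (induction n) auto
    then show ?thesis by simp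
  qed
  have "(\<Sum>i<N. \<Sum>j<P. H i j) / (real N * real P) - a = (\<Sum>i<N. \<Sum>j<P. H i j - a) / (real N * real P)"
    using N P by (simp add: sum_subtractf field_simps)
  also have "\<bar>\<dots>\<bar> \<le> (\<Sum>i<N. \<Sum>j<P. (1/2)^i + (1/2)^j + (if i = j then E else 0)) / (real N * real P)"
  proof -
    have "\<bar>\<Sum>i<N. \<Sum>j<P. H i j - a\<bar> \<le> (\<Sum>i<N. \<bar>\<Sum>j<P. H i j - a\<bar>)" by (rule sum_abs)
    also have "\<dots> \<le> (\<Sum>i<N. \<Sum>j<P. \<bar>H i j - a\<bar>)" by (intro sum_mono sum_abs)
    also have "\<dots> \<le> (\<Sum>i<N. \<Sum>j<P. (1/2)^i + (1/2)^j + (if i = j then E else 0))"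
      by (intro sum_mono H)
    finally show ?thesis by (simp add: abs_divide divide_right_mono)
  qed
  also have "(\<Sum>i<N. \<Sum>j<P. (1/2)^i + (1/2)^j + (if i = j then E else 0))
      \<le> 2 * real P + 2 * real N + E * real N"
  proof -
    have "(\<Sum>i<N. \<Sum>j<P. (1/2)^i + (1/2)^j + (if i = j then E else 0)) =
      real P * (\<Sum>i<N. (1/2)^i) + real N * (\<Sum>j<P. (1/2)^j) + (\<Sum>i<N. \<Sum>j<P. if i = j then E else 0)"
      by (simp add: sum.distrib sum_distrib_left)
    moreover have "(\<Sum>i<N. \<Sum>j<P. if i = j then E else 0) \<le> (\<Sum>i<N. E)"
      using \<open>E \<ge> 0\<close> by (intro sum_mono) simp
    moreover have "real P * (\<Sum>i<N. (1/2)^i) \<le> real P * 2" "real N * (\<Sum>j<P. (1/2)^j) \<le> real N * 2"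
      by (intro mult_left_mono geo; simp)+
    ultimately show ?thesis by (simp add: mult.commute)
  qed
  also have "(2 * real P + 2 * real N + E * real N) / (real N * real P) \<le> (2 + E) * (1 / real N + 1 / real P)"
    using N P \<open>E \<ge> 0\<close> by (simp add: field_simps)
  finally show ?thesis by (simp add: divide_right_mono)
qed

text \<open>
  Banach--Saks: if \<open>lam\<close> did not vanish in the limit, averaging a sparse subsequence with the
  signs of \<open>lam\<close> would give vectors of arbitrarily small norm on which the functional stays large.
\<close>

lemma gram_null_imp_functional_null:
  fixes G :: "nat \<Rightarrow> nat \<Rightarrow> real" and lam :: "nat \<Rightarrow> real"
  assumes sym: "\<And>i j. G i j = G j i" and bd: "\<And>i. \<bar>G i i\<bar> \<le> B"
    and lim: "\<And>m. (\<lambda>n. G n m) \<longlonglongrightarrow> 0"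
    and dom: "\<And>(N::nat) (k::nat \<Rightarrow> nat) c. (\<Sum>i<N. c i * lam (k i))\<^sup>2 \<le> C * (\<Sum>i<N. \<Sum>j<N. c i * c j * G (k i) (k j))"
  shows "lam \<longlonglongrightarrow> 0"
proof (rule ccontr)
  assume "\<not> lam \<longlonglongrightarrow> 0"
  then obtain \<delta> where \<delta>: "\<delta> > 0" "\<And>n0. \<exists>n\<ge>n0. \<bar>lam n\<bar> \<ge> \<delta>"
    unfolding LIMSEQ_iff by (auto simp: not_less)
  then have inf: "infinite {n. \<bar>lam n\<bar> \<ge> \<delta>}"
    by (simp add: infinite_nat_iff_unbounded_le)
  define q where "q = enumerate {n. \<bar>lam n\<bar> \<ge> \<delta>}"
  have q: "strict_mono q" "\<And>n. \<bar>lam (q n)\<bar> \<ge> \<delta>"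
    using enumerate_in_set[OF inf] strict_mono_enumerate[OF inf] by (auto simp: q_def)
  \<comment> \<open>The Gram matrix of the sign-flipped vectors: flipping makes all values of the
    functional at least \<open>\<delta>\<close>, so they cannot cancel in an average, and leaves the
    absolute values of the entries unchanged.\<close>
  define G' where "G' = (\<lambda>n m. sgn (lam (q n)) * sgn (lam (q m)) * G (q n) (q m))"
  have sgn1: "\<bar>sgn (lam (q n))\<bar> = 1" for n using q(2)[of n] \<delta> by (auto simp: abs_sgn_eq)
  have lim': "(\<lambda>n. G' n m) \<longlonglongrightarrow> 0" for m
  proof (rule Lim_null_comparison)
    show "(\<lambda>n. \<bar>G (q n) (q m)\<bar>) \<longlonglongrightarrow> 0"
      using LIMSEQ_subseq_LIMSEQ[OF lim[of "q m"] q(1)] by (simp add: o_def tendsto_rabs_zero)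
    show "\<forall>\<^sub>F n in sequentially. norm (G' n m) \<le> \<bar>G (q n) (q m)\<bar>"
      by (simp add: G'_def abs_mult sgn1)
  qed
  have B0: "B \<ge> 0" using bd[of 0] by linarith
  obtain s where s: "strict_mono s"
    "\<And>i j. \<bar>G' (s i) (s j) - 0\<bar> \<le> (1/2)^i + (1/2)^j + (if i = j then B + \<bar>0\<bar> else 0)"
  proof (rule gram_subseq[of G' B "\<lambda>_. 0" 0])
    show "G' i j = G' j i" for i j using sym by (simp add: G'_def)
    show "\<bar>G' i i\<bar> \<le> B" for i unfolding G'_def abs_mult sgn1 using bd by simp
  qed (use lim' that in auto)
  \<comment> \<open>Evaluated on the signed average of \<open>Suc N\<close> sparse vectors: the
    functional is at least \<open>\<delta>\<close>, while the quadratic form is of order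
    \<open>1 / Suc N\<close>.\<close>
  have "\<delta>\<^sup>2 \<le> \<bar>C\<bar> * ((2 + B) * (2 / real (Suc N)))" for N
  proof -
    define M where "M = Suc N"
    define c where "c = (\<lambda>i. sgn (lam (q (s i))) / real M)"
    define k where "k = (\<lambda>i. q (s i))"
    have M: "M > 0" by (simp add: M_def)
    have "\<delta> = (\<Sum>i<M. \<delta> / real M)" using M by simp
    also have "\<dots> \<le> (\<Sum>i<M. c i * lam (k i))"
    proof (rule sum_mono)
      fix i
      have "c i * lam (k i) = \<bar>lam (q (s i))\<bar> / real M"
        by (simp add: c_def k_def abs_sgn mult.commute)
      then show "\<delta> / real M \<le> c i * lam (k i)" using q(2) M by (simp add: divide_right_mono)
    qed
    finally have "\<delta>\<^sup>2 \<le> (\<Sum>i<M. c i * lam (k i))\<^sup>2" using \<delta>(1) by (intro power_mono) auto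
    also have "\<dots> \<le> C * (\<Sum>i<M. \<Sum>j<M. c i * c j * G (k i) (k j))" by (rule dom[where c = c and k = k and N = M])
    also have "(\<Sum>i<M. \<Sum>j<M. c i * c j * G (k i) (k j)) = (\<Sum>i<M. \<Sum>j<M. G' (s i) (s j)) / (real M * real M)"
      by (simp add: G'_def c_def k_def sum_divide_distrib)
    also have "C * \<dots> \<le> \<bar>C\<bar> * \<bar>\<dots>\<bar>" by (metis abs_ge_self abs_mult)
    also have "\<dots> \<le> \<bar>C\<bar> * ((2 + B) * (1 / real M + 1 / real M))"
    proof (rule mult_left_mono)
      have "\<bar>G' (s i) (s j) - 0\<bar> \<le> (1/2)^i + (1/2)^j + (if i = j then B else 0)" for i j
        using s(2)[of i j] by (simp split: if_splits)
      from double_cesaro_bound[OF this B0 M M]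
      show "\<bar>(\<Sum>i<M. \<Sum>j<M. G' (s i) (s j)) / (real M * real M)\<bar> \<le> (2 + B) * (1 / real M + 1 / real M)"
        by simp
    qed simp
    finally show ?thesis by (simp add: M_def)
  qed
  moreover have "(\<lambda>N. \<bar>C\<bar> * ((2 + B) * (2 / real (Suc N)))) \<longlonglongrightarrow> \<bar>C\<bar> * ((2 + B) * 0)"
    by (intro tendsto_intros LIMSEQ_Suc[OF lim_const_over_n])
  ultimately have "\<delta>\<^sup>2 \<le> \<bar>C\<bar> * ((2 + B) * 0)" by (intro LIMSEQ_le_const) auto
  then show False using \<delta>(1) by simp
qed

section \<open>Weak sequential compactness of bounded sequences\<close>

lemma L2_inner_lincomb:
  assumes "\<And>i. i \<in> I \<Longrightarrow> f i \<in> L2"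
  shows "L2_inner (\<lambda>x. \<Sum>i\<in>I. c i *\<^sub>R f i x) (\<lambda>x. \<Sum>i\<in>I. c i *\<^sub>R f i x)
    = (\<Sum>i\<in>I. \<Sum>j\<in>I. c i * c j * L2_inner (f i) (f j))"
proof -
  have "L2_inner (f i) (\<lambda>x. \<Sum>j\<in>I. c j *\<^sub>R f j x) = (\<Sum>j\<in>I. c j * L2_inner (f i) (f j))" if "i \<in> I" for i
    using assms that by (simp add: L2_inner_sum_right L2_scaleR L2_inner_scaleR_right)
  then show ?thesis using assms
    by (simp add: L2_inner_sum_left L2_scaleR L2_sum L2_inner_scaleR_left sum_distrib_left mult.assoc)
qed

text \<open>The candidate limit \<open>y\<close> is the strong limit of the averages of a sparse
  subsequence. It has the right product with every \<open>X m\<close>, so the deviations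
  \<open>X n - y\<close> become orthogonal to each \<open>X m\<close>, then to \<open>y\<close>, and
  hence to each other. Their Gram matrix is thus asymptotically null, and pairing with an arbitrary
  \<open>w\<close> is a dominated functional.\<close>

lemma L2_weak_compactness:
  fixes x :: "nat \<Rightarrow> real \<Rightarrow> 'a::euclidean_space"
  assumes x: "\<And>n. x n \<in> L2" and C: "\<And>n. L2_inner (x n) (x n) \<le> C"
  obtains r y where "strict_mono r" "y \<in> L2"
    "\<And>w. w \<in> L2 \<Longrightarrow> (\<lambda>n. L2_inner (x (r n)) w) \<longlonglongrightarrow> L2_inner y w"
proof -
  have C0: "C \<ge> 0" using C[of 0] L2_inner_ge_zero[of "x 0"] by linarith
  have GC: "\<bar>L2_inner (x n) (x m)\<bar> \<le> C" for n m
  proof -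
    have "\<bar>L2_inner (x n) (x m)\<bar> \<le> sqrt (L2_inner (x n) (x n)) * sqrt (L2_inner (x m) (x m))"
      by (rule L2_Cauchy_Schwarz[OF x x])
    also have "\<dots> \<le> sqrt C * sqrt C" using C C0 by (intro mult_mono) (auto simp: L2_inner_ge_zero)
    finally show ?thesis using C0 by simp
  qed
  \<comment> \<open>Cantor's diagonal argument over the countably many vectors
    \<open>x m\<close>.\<close>
  obtain r1 where r1: "strict_mono r1"
    "\<And>m. \<exists>l. (\<lambda>n. L2_inner (x (r1 n)) (x m)) \<longlonglongrightarrow> l"
    by (rule function_convergent_subsequence[of UNIV "\<lambda>n m. L2_inner (x n) (x m)" C]) (use GC in auto)
  then obtain b where b: "\<And>m. (\<lambda>n. L2_inner (x (r1 n)) (x m)) \<longlonglongrightarrow> b m" by metis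
  have bC: "\<bar>b m\<bar> \<le> C" for m
    using tendsto_rabs[OF b[of m]] by (rule LIMSEQ_le_const2) (use GC in auto)
  have "bounded (range b)" using bC by (auto simp: bounded_iff)
  then have "bounded (range (b \<circ> r1))" by (rule bounded_subset) auto
  \<comment> \<open>A second extraction makes the limits themselves converge, the remaining
    requirement of \<open>gram_subseq\<close>.\<close>
  then obtain a r2 where r2: "strict_mono r2" "((b \<circ> r1) \<circ> r2) \<longlonglongrightarrow> a"
    using bounded_imp_convergent_subsequence by blast
  define r where "r = r1 \<circ> r2"
  have r: "strict_mono r" unfolding r_def using r1(1) r2(1) by (rule strict_mono_o)
  define X where "X = (\<lambda>n. x (r n))"
  define c where "c = (\<lambda>n. b (r n))"
  have X: "X n \<in> L2" for n by (simp add: X_def x)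
  have XX: "\<bar>L2_inner (X n) (X m)\<bar> \<le> C" for n m by (simp add: X_def GC)
  have limX: "(\<lambda>n. L2_inner (X n) (X m)) \<longlonglongrightarrow> c m" for m
    using LIMSEQ_subseq_LIMSEQ[OF b[of "r m"] r2(1)] by (simp add: X_def c_def r_def o_def)
  have limc: "c \<longlonglongrightarrow> a" using r2(2) by (simp add: c_def r_def o_def)
  obtain s where s: "strict_mono s"
    "\<And>i j. \<bar>L2_inner (X (s i)) (X (s j)) - a\<bar> \<le> (1/2)^i + (1/2)^j + (if i = j then C + \<bar>a\<bar> else 0)"
    by (rule gram_subseq[of "\<lambda>n m. L2_inner (X n) (X m)" C c a])
      (use XX limX limc L2_inner_commute in auto)
  define M where "M = (\<lambda>N x. (1 / real N) *\<^sub>R (\<Sum>i<N. X (s i) x))"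
  have M: "M N \<in> L2" for N unfolding M_def by (intro L2_scaleR L2_sum X)
  have MX: "L2_inner (M N) w = (\<Sum>i<N. L2_inner (X (s i)) w) / real N" if "w \<in> L2" for N w
    unfolding M_def L2_inner_scaleR_left using that X by (simp add: L2_inner_sum_left)
  have MM: "L2_inner (M N) (M P) = (\<Sum>i<N. \<Sum>j<P. L2_inner (X (s i)) (X (s j))) / (real N * real P)" for N P
  proof -
    have "L2_inner (X (s i)) (M P) = (\<Sum>j<P. L2_inner (X (s i)) (X (s j))) / real P" for i
      unfolding M_def L2_inner_scaleR_right using X by (simp add: L2_inner_sum_right)
    then show ?thesis by (simp add: MX M sum_divide_distrib[symmetric] mult.commute)
  qed
  define E where "E = 2 + (C + \<bar>a\<bar>)"
  have MMa: "\<bar>L2_inner (M N) (M P) - a\<bar> \<le> E * (1 / real N + 1 / real P)" if "N > 0" "P > 0" for N P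
    unfolding MM E_def using that C0 by (intro double_cesaro_bound s(2)) auto
  have Mdiff: "L2_inner (\<lambda>x. M N x - M P x) (\<lambda>x. M N x - M P x) \<le> 4 * E * (1 / real N + 1 / real P)"
    if "N > 0" "P > 0" for N P
  proof -
    have "L2_inner (\<lambda>x. M N x - M P x) (\<lambda>x. M N x - M P x)
        = L2_inner (M N) (M N) - 2 * L2_inner (M N) (M P) + L2_inner (M P) (M P)"
      by (rule L2_inner_diff_self[OF M M])
    also have "\<dots> \<le> E * (1 / real N + 1 / real N) + 2 * (E * (1 / real N + 1 / real P)) + E * (1 / real P + 1 / real P)"
      using MMa[of N N] MMa[of N P] MMa[of P P] that by (simp add: abs_le_iff)
    also have "\<dots> = 4 * E * (1 / real N + 1 / real P)" by (simp add: algebra_simps)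
    finally show ?thesis .
  qed
  have E: "E > 0" using C0 by (simp add: E_def)
  \<comment> \<open>The shift by \<open>Suc\<close> skips the empty average, for which the estimate
    \<open>Mdiff\<close> says nothing.\<close>
  obtain y where y: "y \<in> L2" "(\<lambda>n. L2_inner (\<lambda>x. M (Suc n) x - y x) (\<lambda>x. M (Suc n) x - y x)) \<longlonglongrightarrow> 0"
  proof (rule L2_complete[of "\<lambda>n. M (Suc n)"])
    fix e :: real assume e: "e > 0"
    \<comment> \<open>Beyond \<open>K\<close> each reciprocal is below \<open>e / (8 * E)\<close>,
      so \<open>4 * E\<close> times the sum of two of them stays below \<open>e\<close>.\<close>
    obtain K where K: "real K > 8 * E / e" using reals_Archimedean2 by blast
    have "L2_inner (\<lambda>x. M (Suc m) x - M (Suc n) x) (\<lambda>x. M (Suc m) x - M (Suc n) x) < e"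
      if "m \<ge> K" "n \<ge> K" for m n
    proof -
      have *: "8 * E / real (Suc i) < e" if "i \<ge> K" for i
      proof -
        have "8 * E / e < real (Suc i)" using that K by simp
        then show ?thesis using e by (simp add: field_simps)
      qed
      have "4 * E * (1 / real (Suc m) + 1 / real (Suc n)) = (8 * E / real (Suc m) + 8 * E / real (Suc n)) / 2"
        by (simp only: distrib_left add_divide_distrib) (simp del: of_nat_Suc)
      also have "\<dots> < e" using *[OF that(1)] *[OF that(2)] by simp
      finally show ?thesis using Mdiff[of "Suc m" "Suc n"] by simp
    qed
    then show "\<exists>N. \<forall>m\<ge>N. \<forall>n\<ge>N. L2_inner (\<lambda>x. M (Suc m) x - M (Suc n) x) (\<lambda>x. M (Suc m) x - M (Suc n) x) < e"
      by blast
  qed (use M that in auto)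
  have My: "(\<lambda>n. L2_inner (M (Suc n)) w) \<longlonglongrightarrow> L2_inner y w" if w: "w \<in> L2" for w
  proof -
    have "(\<lambda>n. L2_inner (\<lambda>x. M (Suc n) x - y x) w) \<longlonglongrightarrow> 0"
    proof (rule Lim_null_comparison)
      have "(\<lambda>n. sqrt (L2_inner (\<lambda>x. M (Suc n) x - y x) (\<lambda>x. M (Suc n) x - y x)) * sqrt (L2_inner w w))
          \<longlonglongrightarrow> sqrt 0 * sqrt (L2_inner w w)" by (intro tendsto_intros y)
      then show "(\<lambda>n. sqrt (L2_inner (\<lambda>x. M (Suc n) x - y x) (\<lambda>x. M (Suc n) x - y x)) * sqrt (L2_inner w w))
          \<longlonglongrightarrow> 0" by simp
      show "\<forall>\<^sub>F n in sequentially. norm (L2_inner (\<lambda>x. M (Suc n) x - y x) w) \<le>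
          sqrt (L2_inner (\<lambda>x. M (Suc n) x - y x) (\<lambda>x. M (Suc n) x - y x)) * sqrt (L2_inner w w)"
        using L2_Cauchy_Schwarz[OF L2_diff[OF M y(1)] w] by simp
    qed
    then have "(\<lambda>n. L2_inner (M (Suc n)) w - L2_inner y w) \<longlonglongrightarrow> 0"
      by (simp add: L2_inner_diff_left M y(1) w)
    then show ?thesis by (simp add: LIM_zero_iff)
  qed
  \<comment> \<open>The products of \<open>X m\<close> with the averages are Cesaro means of a
    sequence tending to \<open>c m\<close>; they also tend to the product with
    \<open>y\<close>.\<close>
  have yX: "L2_inner y (X m) = c m" for m
  proof -
    have "(\<lambda>i. L2_inner (X (s i)) (X m)) \<longlonglongrightarrow> c m"
      using LIMSEQ_subseq_LIMSEQ[OF limX s(1)] by (simp add: o_def)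
    from LIMSEQ_Suc[OF cesaro_mean_tendsto[OF this]]
    have "(\<lambda>n. L2_inner (M (Suc n)) (X m)) \<longlonglongrightarrow> c m" by (simp add: MX X del: of_nat_Suc)
    then show ?thesis using My[OF X] LIMSEQ_unique by blast
  qed
  define d where "d = (\<lambda>n x. X n x - y x)"
  have d: "d n \<in> L2" for n by (simp add: d_def L2_diff X y(1))
  have dw: "L2_inner (d n) w = L2_inner (X n) w - L2_inner y w" if "w \<in> L2" for n w
    by (simp add: d_def L2_inner_diff_left X y(1) that)
  have dX: "(\<lambda>n. L2_inner (d n) (X m)) \<longlonglongrightarrow> 0" for m
    using tendsto_diff[OF limX[of m] tendsto_const[of "c m"]] by (simp add: dw X yX)
  define D where "D = C + 2 * (sqrt C * sqrt (L2_inner y y)) + L2_inner y y"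
  have dd: "\<bar>L2_inner (d n) (d n)\<bar> \<le> D" for n
  proof -
    have "\<bar>L2_inner (X n) y\<bar> \<le> sqrt C * sqrt (L2_inner y y)"
    proof -
      have "\<bar>L2_inner (X n) y\<bar> \<le> sqrt (L2_inner (X n) (X n)) * sqrt (L2_inner y y)"
        by (rule L2_Cauchy_Schwarz[OF X y(1)])
      also have "\<dots> \<le> sqrt C * sqrt (L2_inner y y)"
        using XX[of n n] by (intro mult_right_mono real_sqrt_le_mono) (auto simp: L2_inner_ge_zero)
      finally show ?thesis .
    qed
    then show ?thesis
      using L2_inner_diff_self[OF X y(1), of n] XX[of n n] L2_inner_ge_zero[of "d n"]
      unfolding D_def d_def by linarith
  qed
  have D0: "D \<ge> 0" using dd[of 0] by linarith
  \<comment> \<open>Replaces \<open>y\<close> by one fixed average close to it: a finite combination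
    of the \<open>X (s i)\<close>, to which the \<open>d n\<close> become orthogonal, while the
    error is uniform in \<open>n\<close> by the bound \<open>D\<close>.\<close>
  have dy: "(\<lambda>n. L2_inner (d n) y) \<longlonglongrightarrow> 0"
  proof (rule LIMSEQ_I)
    fix e :: real assume e: "e > 0"
    have "(\<lambda>n. sqrt D * sqrt (L2_inner (\<lambda>x. M (Suc n) x - y x) (\<lambda>x. M (Suc n) x - y x))) \<longlonglongrightarrow> sqrt D * sqrt 0"
      by (intro tendsto_intros y)
    then have "\<forall>\<^sub>F n in sequentially. sqrt D * sqrt (L2_inner (\<lambda>x. M (Suc n) x - y x) (\<lambda>x. M (Suc n) x - y x)) < e / 2"
      by (rule order_tendstoD) (use e in simp)
    then obtain N where N: "sqrt D * sqrt (L2_inner (\<lambda>x. M (Suc N) x - y x) (\<lambda>x. M (Suc N) x - y x)) < e / 2"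
      unfolding eventually_sequentially by blast
    have "(\<lambda>n. (\<Sum>i<Suc N. L2_inner (d n) (X (s i))) / real (Suc N)) \<longlonglongrightarrow> (\<Sum>i<Suc N. 0) / real (Suc N)"
      by (intro tendsto_intros dX) simp
    moreover have "L2_inner (d n) (M (Suc N)) = (\<Sum>i<Suc N. L2_inner (d n) (X (s i))) / real (Suc N)" for n
      using MX[OF d, of "Suc N" n] by (simp only: L2_inner_commute[of "d n"])
    ultimately have "(\<lambda>n. L2_inner (d n) (M (Suc N))) \<longlonglongrightarrow> 0" by simp
    then obtain n0 where n0: "\<And>n. n \<ge> n0 \<Longrightarrow> \<bar>L2_inner (d n) (M (Suc N))\<bar> < e / 2"
      using LIMSEQ_D[of _ 0 "e / 2"] e by fastforce
    have "norm (L2_inner (d n) y - 0) < e" if "n \<ge> n0" for n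
    proof -
      have "\<bar>L2_inner (d n) (\<lambda>x. M (Suc N) x - y x)\<bar>
          \<le> sqrt (L2_inner (d n) (d n)) * sqrt (L2_inner (\<lambda>x. M (Suc N) x - y x) (\<lambda>x. M (Suc N) x - y x))"
        by (rule L2_Cauchy_Schwarz[OF d L2_diff[OF M y(1)]])
      also have "\<dots> \<le> sqrt D * sqrt (L2_inner (\<lambda>x. M (Suc N) x - y x) (\<lambda>x. M (Suc N) x - y x))"
        using dd[of n] by (intro mult_right_mono real_sqrt_le_mono) (auto simp: L2_inner_ge_zero)
      finally have "\<bar>L2_inner (d n) (\<lambda>x. M (Suc N) x - y x)\<bar> < e / 2" using N by linarith
      moreover have "L2_inner (d n) (\<lambda>x. M (Suc N) x - y x) = L2_inner (d n) (M (Suc N)) - L2_inner (d n) y"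
        by (rule L2_inner_diff_right[OF M y(1) d])
      ultimately show ?thesis using n0[OF that] unfolding real_norm_def diff_0_right by linarith
    qed
    then show "\<exists>no. \<forall>n\<ge>no. norm (L2_inner (d n) y - 0) < e" by blast
  qed
  have "(\<lambda>n. L2_inner (x (r n)) w) \<longlonglongrightarrow> L2_inner y w" if w: "w \<in> L2" for w
  proof -
    have "(\<lambda>n. L2_inner (d n) w) \<longlonglongrightarrow> 0"
    proof (rule gram_null_imp_functional_null[of "\<lambda>n m. L2_inner (d n) (d m)" D _ "L2_inner w w"])
      show "(\<lambda>n. L2_inner (d n) (d m)) \<longlonglongrightarrow> 0" for m
        using tendsto_diff[OF dX[of m] dy] by (simp add: d_def L2_inner_diff_right X y(1) d[unfolded d_def])
      fix N :: nat and k :: "nat \<Rightarrow> nat" and c :: "nat \<Rightarrow> real"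
      define z where "z = (\<lambda>x. \<Sum>i<N. c i *\<^sub>R d (k i) x)"
      have z: "z \<in> L2" unfolding z_def by (intro L2_sum L2_scaleR d)
      have 1: "L2_inner z v = (\<Sum>i<N. c i * L2_inner (d (k i)) v)" if "v \<in> L2" for v
        unfolding z_def using that by (simp add: L2_inner_sum_left L2_scaleR d L2_inner_scaleR_left)
      have 2: "L2_inner z z = (\<Sum>i<N. \<Sum>j<N. c i * c j * L2_inner (d (k i)) (d (k j)))"
        unfolding z_def by (rule L2_inner_lincomb) (rule d)
      have "(L2_inner z w)\<^sup>2 \<le> (sqrt (L2_inner z z) * sqrt (L2_inner w w))\<^sup>2"
        using L2_Cauchy_Schwarz[OF z w] by (metis abs_ge_zero power2_abs power_mono)
      also have "\<dots> = L2_inner w w * L2_inner z z"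
        by (simp add: power_mult_distrib L2_inner_ge_zero mult.commute)
      finally show "(\<Sum>i<N. c i * L2_inner (d (k i)) w)\<^sup>2
          \<le> L2_inner w w * (\<Sum>i<N. \<Sum>j<N. c i * c j * L2_inner (d (k i)) (d (k j)))"
        by (simp add: 1[OF w] 2)
    qed (use dd L2_inner_commute in auto)
    then have "(\<lambda>n. L2_inner (X n) w - L2_inner y w) \<longlonglongrightarrow> 0" by (simp add: dw w)
    then show ?thesis by (simp add: LIM_zero_iff X_def)
  qed
  with r y(1) show ?thesis by (rule that)
qed

subsection \<open>Weighted weak compactness\<close>


lemma integrable_inverse_1_plus_square: "integrable lebesgue (\<lambda>x::real. inverse (1 + x\<^sup>2))"
proof -
  have "set_integrable lborel (einterval (-\<infinity>) \<infinity>) (\<lambda>x. inverse (1 + x\<^sup>2))"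
  proof (rule interval_integral_FTC_nonneg(1)[where F = arctan])
    show "((arctan \<circ> real_of_ereal) \<longlongrightarrow> - (pi / 2)) (at_right (-\<infinity>))"
      by (simp add: ereal_tendsto_simps tendsto_arctan_at_bot)
    show "((arctan \<circ> real_of_ereal) \<longlongrightarrow> pi / 2) (at_left \<infinity>)"
      by (simp add: ereal_tendsto_simps tendsto_arctan_at_top)
  qed (auto intro!: DERIV_arctan continuous_intros simp: add_nonneg_eq_0_iff)
  then show ?thesis by (simp add: set_integrable_def integrable_completion)
qed

lemma L2_bound:
  assumes w: "w \<in> L2" and v: "v \<in> borel_measurable lebesgue"
    and k: "\<And>x. norm (v x) \<le> k * norm (w x)" and "k \<ge> 0"
  shows "v \<in> L2" "sqrt (L2_inner v v) \<le> k * sqrt (L2_inner w w)"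
proof -
  note [measurable] = v
  have sq: "(norm (v x))\<^sup>2 \<le> k\<^sup>2 * (norm (w x))\<^sup>2" for x
    using power_mono[OF k[of x] norm_ge_zero, of 2] by (simp add: power_mult_distrib)
  have int: "integrable lebesgue (\<lambda>x. k\<^sup>2 * (norm (w x))\<^sup>2)" using w by (simp add: L2_def)
  have "integrable lebesgue (\<lambda>x. (norm (v x))\<^sup>2)"
    by (rule Bochner_Integration.integrable_bound[OF int]) (use sq in auto)
  then show "v \<in> L2" using v by (simp add: L2_def)
  have "L2_inner v v \<le> k\<^sup>2 * L2_inner w w" unfolding L2_inner_self integral_mult_right_zero[symmetric]
    by (rule integral_mono) (use sq int \<open>integrable lebesgue (\<lambda>x. (norm (v x))\<^sup>2)\<close> in auto)
  then have "sqrt (L2_inner v v) \<le> sqrt (k\<^sup>2 * L2_inner w w)" by (rule real_sqrt_le_mono)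
  then show "sqrt (L2_inner v v) \<le> k * sqrt (L2_inner w w)" using \<open>k \<ge> 0\<close> by (simp add: real_sqrt_mult)
qed

lemma nn_integral_eq_L2_inner:
  "f \<in> L2 \<Longrightarrow> (\<integral>\<^sup>+x. ennreal ((norm (f x))\<^sup>2) \<partial>lebesgue) = ennreal (L2_inner f f)"
  unfolding L2_inner_self by (intro nn_integral_eq_integral) (auto simp: L2_def)

text \<open>Expanding the nonnegative square of \<open>X n - y\<close> gives an estimate linear in
  \<open>X n\<close>, so convergence of the pairing with \<open>y\<close> itself is enough.\<close>

lemma L2_weak_lower_semicontinuous:
  assumes X: "\<And>n. X n \<in> L2" and y: "y \<in> L2" and lim: "(\<lambda>n. L2_inner (X n) y) \<longlonglongrightarrow> L2_inner y y"
  shows "ennreal (L2_inner y y) \<le> liminf (\<lambda>n. ennreal (L2_inner (X n) (X n)))"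
proof -
  have "(\<lambda>n. ennreal (2 * L2_inner (X n) y - L2_inner y y)) \<longlonglongrightarrow> ennreal (2 * L2_inner y y - L2_inner y y)"
    by (intro tendsto_ennrealI tendsto_intros lim)
  then have "ennreal (L2_inner y y) = liminf (\<lambda>n. ennreal (2 * L2_inner (X n) y - L2_inner y y))"
    by (simp add: lim_imp_Liminf)
  also have "\<dots> \<le> liminf (\<lambda>n. ennreal (L2_inner (X n) (X n)))"
  proof (intro Liminf_mono always_eventually allI ennreal_leI)
    fix n
    show "2 * L2_inner (X n) y - L2_inner y y \<le> L2_inner (X n) (X n)"
      using L2_inner_diff_self[OF X y, of n] L2_inner_ge_zero[of "\<lambda>x. X n x - y x"] by simp
  qed
  finally show ?thesis .
qed

text \<open>The weighted functions have a weak limit in \<open>L2\<close>. For \<open>w\<close> of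
  bounded support the weight is moved onto \<open>w\<close> as \<open>1 / a n\<close>, which is
  uniformly close to 1 where \<open>w\<close> lives, so the unweighted functions have the same local
  limit. The local bound holds for the original sequence and so survives any later
  extraction.\<close>

lemma weighted_weak_compactness:
  fixes f :: "nat \<Rightarrow> real \<Rightarrow> 'a::euclidean_space" and a :: "nat \<Rightarrow> real \<Rightarrow> real"
  assumes f: "\<And>n. f n \<in> borel_measurable lebesgue" and am: "\<And>n. a n \<in> borel_measurable lebesgue"
    and a: "\<And>n x. 0 < a n x" "\<And>n x. a n x \<le> 1"
    and a_lim: "\<forall>R. \<forall>\<theta><1. \<forall>\<^sub>F n in sequentially. \<forall>x. \<bar>x\<bar> \<le> R \<longrightarrow> \<theta> \<le> a n x"
    and bd: "\<And>n. (\<integral>\<^sup>+x. ennreal ((a n x)\<^sup>2 * (norm (f n x))\<^sup>2) \<partial>lebesgue) \<le> ennreal C" and "C \<ge> 0"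
  obtains r y where "strict_mono r" "y \<in> L2" "\<And>n. (\<lambda>x. a n x *\<^sub>R f n x) \<in> L2"
    "\<And>w. w \<in> L2 \<Longrightarrow> (\<lambda>n. L2_inner (\<lambda>x. a (r n) x *\<^sub>R f (r n) x) w) \<longlonglongrightarrow> L2_inner y w"
    "\<And>w R. w \<in> L2 \<Longrightarrow> \<forall>x. \<bar>x\<bar> > R \<longrightarrow> w x = 0 \<Longrightarrow>
      (\<lambda>n. L2_inner (f (r n)) w) \<longlonglongrightarrow> L2_inner y w"
    "\<And>R. \<forall>\<^sub>F n in sequentially. L2_inner (\<lambda>x. indicator {-R..R} x *\<^sub>R f n x) (\<lambda>x. indicator {-R..R} x *\<^sub>R f n x) \<le> 4 * C"
proof -
  note [measurable] = f am
  define X where "X = (\<lambda>n x. a n x *\<^sub>R f n x)"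
  have nnX: "(\<integral>\<^sup>+x. ennreal ((norm (X n x))\<^sup>2) \<partial>lebesgue) \<le> ennreal C" for n
    using bd[of n] by (simp add: X_def power_mult_distrib)
  have X: "X n \<in> L2" for n
  proof -
    have "(\<integral>\<^sup>+x. ennreal ((norm (X n x))\<^sup>2) \<partial>lebesgue) < \<infinity>"
      using nnX[of n] by (rule order_le_less_trans) simp
    then show ?thesis by (simp add: L2_def integrable_iff_bounded X_def power_mult_distrib)
  qed
  have XC: "L2_inner (X n) (X n) \<le> C" for n
    using nnX[of n] \<open>C \<ge> 0\<close> by (simp add: nn_integral_eq_L2_inner[OF X])
  obtain r y where r: "strict_mono r" and y: "y \<in> L2"
    and w: "\<And>w. w \<in> L2 \<Longrightarrow> (\<lambda>n. L2_inner (X (r n)) w) \<longlonglongrightarrow> L2_inner y w"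
    by (rule L2_weak_compactness[OF X XC]) (rule that)
  have div: "\<bar>1 / a n x\<bar> \<le> 1 / \<theta>" "\<bar>1 / a n x - 1\<bar> \<le> 1 / \<theta> - 1" if "\<theta> > 0" "\<theta> \<le> a n x" for n x \<theta>
  proof -
    have "1 / a n x \<le> 1 / \<theta>" "1 \<le> 1 / a n x" using that a[of n x] by (auto simp: field_simps)
    then show "\<bar>1 / a n x\<bar> \<le> 1 / \<theta>" "\<bar>1 / a n x - 1\<bar> \<le> 1 / \<theta> - 1" by auto
  qed
  have loc: "(\<lambda>n. L2_inner (f (r n)) w) \<longlonglongrightarrow> L2_inner y w"
    if wL: "w \<in> L2" and w0: "\<forall>x. \<bar>x\<bar> > R \<longrightarrow> w x = 0" for w R
  proof -
    note [measurable] = L2_measurable[OF wL]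
    have close: "\<forall>\<^sub>F n in sequentially. \<bar>L2_inner (f n) w - L2_inner (X n) w\<bar>
        \<le> sqrt C * ((1 / \<theta> - 1) * sqrt (L2_inner w w))" if "\<theta> > 0" "\<theta> < 1" for \<theta>
      using a_lim[rule_format, OF that(2), of R]
    proof eventually_elim
      case (elim n)
      have b1: "norm ((1 / a n x) *\<^sub>R w x) \<le> 1 / \<theta> * norm (w x)" for x
      proof (cases "\<bar>x\<bar> \<le> R")
        case True
        then show ?thesis using div(1)[OF that(1), of n x] elim
          by (simp only: norm_scaleR) (intro mult_right_mono; simp)
      qed (simp add: w0)
      have b2: "norm ((1 / a n x - 1) *\<^sub>R w x) \<le> (1 / \<theta> - 1) * norm (w x)" for x
      proof (cases "\<bar>x\<bar> \<le> R")
        case True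
        then show ?thesis using div(2)[OF that(1), of n x] elim
          by (simp only: norm_scaleR) (intro mult_right_mono; simp)
      qed (simp add: w0)
      have w1: "(\<lambda>x. (1 / a n x) *\<^sub>R w x) \<in> L2"
        by (rule L2_bound(1)[OF wL _ b1]) (use that in auto)
      have w2: "(\<lambda>x. (1 / a n x - 1) *\<^sub>R w x) \<in> L2"
          "sqrt (L2_inner (\<lambda>x. (1 / a n x - 1) *\<^sub>R w x) (\<lambda>x. (1 / a n x - 1) *\<^sub>R w x)) \<le> (1 / \<theta> - 1) * sqrt (L2_inner w w)"
        by (rule L2_bound[OF wL _ b2]; use that in \<open>auto simp: field_simps\<close>)+
      \<comment> \<open>The weight is transferred from one factor of the inner product to the
        other.\<close>
      have "f n x \<bullet> w x = X n x \<bullet> ((1 / a n x) *\<^sub>R w x)" for x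
        using a(1)[of n x] by (simp add: X_def)
      then have "L2_inner (f n) w = L2_inner (X n) (\<lambda>x. (1 / a n x) *\<^sub>R w x)"
        by (simp add: L2_inner_def)
      then have "L2_inner (f n) w - L2_inner (X n) w = L2_inner (X n) (\<lambda>x. (1 / a n x) *\<^sub>R w x - w x)"
        by (simp add: L2_inner_diff_right[OF w1 wL X])
      also have "(\<lambda>x. (1 / a n x) *\<^sub>R w x - w x) = (\<lambda>x. (1 / a n x - 1) *\<^sub>R w x)"
        by (simp add: scaleR_diff_left)
      finally have "\<bar>L2_inner (f n) w - L2_inner (X n) w\<bar> \<le> sqrt (L2_inner (X n) (X n)) *
          sqrt (L2_inner (\<lambda>x. (1 / a n x - 1) *\<^sub>R w x) (\<lambda>x. (1 / a n x - 1) *\<^sub>R w x))"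
        using L2_Cauchy_Schwarz[OF X w2(1)] by simp
      also have "\<dots> \<le> sqrt C * ((1 / \<theta> - 1) * sqrt (L2_inner w w))"
        using w2(2) XC \<open>C \<ge> 0\<close> by (intro mult_mono) (auto simp: L2_inner_ge_zero)
      finally show ?case .
    qed
    have "(\<lambda>n. L2_inner (f n) w - L2_inner (X n) w) \<longlonglongrightarrow> 0"
    proof (rule tendstoI)
      fix e :: real assume e: "e > 0"
      \<comment> \<open>The error in \<open>close\<close> is fixed once \<open>\<theta>\<close> is;
        letting \<open>\<theta>\<close> tend to 1 from the left yields one value with error below
        \<open>e\<close>.\<close>
      have "((\<lambda>\<theta>. sqrt C * ((1 / \<theta> - 1) * sqrt (L2_inner w w))) \<longlongrightarrow> sqrt C * ((1 / 1 - 1) * sqrt (L2_inner w w))) (at_left 1)"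
        by (intro tendsto_intros) auto
      then have "\<forall>\<^sub>F \<theta> in at_left 1. sqrt C * ((1 / \<theta> - 1) * sqrt (L2_inner w w)) < e"
        using e by (simp add: order_tendstoD)
      moreover have "\<forall>\<^sub>F \<theta> in at_left 1. \<theta> \<in> {0<..<1::real}"
        by (rule eventually_at_leftI[of 0]) auto
      ultimately have "\<forall>\<^sub>F \<theta> in at_left 1. 0 < \<theta> \<and> \<theta> < 1 \<and> sqrt C * ((1 / \<theta> - 1) * sqrt (L2_inner w w)) < e"
        by eventually_elim auto
      then obtain \<theta> where \<theta>: "0 < \<theta>" "\<theta> < 1" "sqrt C * ((1 / \<theta> - 1) * sqrt (L2_inner w w)) < e"
        using eventually_happens' trivial_limit_at_left_real by blast
      show "\<forall>\<^sub>F n in sequentially. dist (L2_inner (f n) w - L2_inner (X n) w) 0 < e"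
        using close[OF \<theta>(1,2)] by eventually_elim (use \<theta>(3) in \<open>simp add: dist_real_def\<close>)
    qed
    from tendsto_add[OF LIMSEQ_subseq_LIMSEQ[OF this r] w[OF wL]]
    show ?thesis by (simp add: o_def)
  qed
  \<comment> \<open>Once the weight is at least 1/2 on the interval, removing it costs a factor 2 in
    norm, hence 4 in the square.\<close>
  have bnd: "\<forall>\<^sub>F n in sequentially. L2_inner (\<lambda>x. indicator {-R..R} x *\<^sub>R f n x) (\<lambda>x. indicator {-R..R} x *\<^sub>R f n x) \<le> 4 * C" for R
  proof -
    have "\<forall>\<^sub>F n in sequentially. \<forall>x. \<bar>x\<bar> \<le> R \<longrightarrow> 1/2 \<le> a n x" by (rule a_lim[rule_format]) simp
    then show ?thesis
    proof eventually_elim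
      case (elim n)
      have "norm (indicator {-R..R} x *\<^sub>R f n x) \<le> 2 * norm (X n x)" for x
      proof (cases "x \<in> {-R..R}")
        case True
        then have "1 \<le> 2 * a n x" using elim[rule_format, of x] by (auto simp: abs_le_iff)
        then have "1 * norm (f n x) \<le> (2 * a n x) * norm (f n x)" by (intro mult_right_mono) auto
        then show ?thesis using True a(1)[of n x] by (simp add: X_def)
      qed simp
      then have "sqrt (L2_inner (\<lambda>x. indicator {-R..R} x *\<^sub>R f n x) (\<lambda>x. indicator {-R..R} x *\<^sub>R f n x))
          \<le> 2 * sqrt (L2_inner (X n) (X n))"
        by (intro L2_bound(2)[OF X]) (auto intro!: borel_measurable_scaleR borel_measurable_indicator)
      also have "\<dots> \<le> 2 * sqrt C" using XC by simp
      finally have "sqrt (L2_inner (\<lambda>x. indicator {-R..R} x *\<^sub>R f n x) (\<lambda>x. indicator {-R..R} x *\<^sub>R f n x)) \<le> sqrt (4 * C)"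
        by (simp add: real_sqrt_mult)
      then show ?case by simp
    qed
  qed
  show ?thesis using that[OF r y X[unfolded X_def] w[unfolded X_def] loc bnd] .
qed

section \<open>Local function spaces and closedness of the weak derivative\<close>

lemma L2_imp_L2loc: "f \<in> L2 \<Longrightarrow> f \<in> L2loc"
  unfolding L2_def L2loc_def set_integrable_def
  by (auto intro!: integrable_mult_indicator simp: borel_compact simp del: real_scaleR_def)

lemma L2loc_imp_L1loc:
  assumes "f \<in> L2loc" shows "f \<in> L1loc"
proof -
  note [measurable] = L2loc_measurable[OF assms]
  have "set_integrable lebesgue K f" if K: "compact K" for K
  proof -
    have [measurable]: "K \<in> sets lebesgue" using K by (simp add: borel_compact)
    have "emeasure lebesgue K < \<infinity>" using K emeasure_bounded_finite[OF compact_imp_bounded[OF K]] by (simp add: borel_compact)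
    then have "integrable lebesgue (\<lambda>x. indicator K x * (1::real))"
      by (simp add: integrable_indicator_iff)
    moreover have "integrable lebesgue (\<lambda>x. indicator K x *\<^sub>R (norm (f x))\<^sup>2)"
      using assms K by (simp add: L2loc_def set_integrable_def)
    ultimately have "integrable lebesgue (\<lambda>x. indicator K x * 1 + indicator K x *\<^sub>R (norm (f x))\<^sup>2)"
      by (rule Bochner_Integration.integrable_add)
    then show ?thesis unfolding set_integrable_def
    proof (rule Bochner_Integration.integrable_bound)
      have "t \<le> 1 + t\<^sup>2" for t :: real
        using zero_le_power2[of "t - 1/2"] by (simp add: power2_eq_square algebra_simps)
      then show "AE x in lebesgue. norm (indicator K x *\<^sub>R f x)
          \<le> norm (indicator K x * 1 + indicator K x *\<^sub>R (norm (f x))\<^sup>2)"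
        by (auto simp: indicator_def)
    qed measurable
  qed
  then show ?thesis using assms by (simp add: L1loc_def L2loc_def)
qed

lemma L2loc_indicator_L2:
  assumes "f \<in> L2loc" "compact K" shows "(\<lambda>x. indicator K x *\<^sub>R f x) \<in> L2"
proof -
  note [measurable] = L2loc_measurable[OF assms(1)]
  have [measurable]: "K \<in> sets lebesgue" using assms(2) by (simp add: borel_compact)
  have "(\<lambda>x. (norm (indicator K x *\<^sub>R f x))\<^sup>2) = (\<lambda>x. indicator K x *\<^sub>R (norm (f x))\<^sup>2)"
    by (auto simp: indicator_def)
  then show ?thesis using assms by (auto simp: L2_def L2loc_def set_integrable_def)
qed

text \<open>The factor may grow with \<open>R\<close>; this is the situation after dividing an
  \<open>L2\<close> limit by a decaying weight.\<close>

lemma L2_local_bound_imp_L2loc: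
  assumes y: "y \<in> L2" and v: "v \<in> borel_measurable lebesgue"
    and k: "\<And>R. \<exists>k\<ge>0. \<forall>x. \<bar>x\<bar> \<le> R \<longrightarrow> norm (v x) \<le> k * norm (y x)"
  shows "v \<in> L2loc"
proof -
  have "set_integrable lebesgue K (\<lambda>x. (norm (v x))\<^sup>2)" if K: "compact K" for K
  proof -
    have [measurable]: "K \<in> sets lebesgue" using K by (simp add: borel_compact)
    note v[measurable]
    obtain R where R: "\<And>x. x \<in> K \<Longrightarrow> \<bar>x\<bar> \<le> R"
      using compact_imp_bounded[OF K] by (auto simp: bounded_iff)
    from k[of R] obtain k where k: "k \<ge> 0" "\<And>x. \<bar>x\<bar> \<le> R \<Longrightarrow> norm (v x) \<le> k * norm (y x)" by blast
    have "(\<lambda>x. indicator K x *\<^sub>R v x) \<in> L2"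
    proof (rule L2_bound(1)[OF y _ _ k(1)])
      show "norm (indicator K x *\<^sub>R v x) \<le> k * norm (y x)" for x
        using R[of x] k by (cases "x \<in> K") auto
    qed measurable
    moreover have "(\<lambda>x. (norm (indicator K x *\<^sub>R v x))\<^sup>2) = (\<lambda>x. indicator K x *\<^sub>R (norm (v x))\<^sup>2)"
      by (auto simp: indicator_def)
    ultimately show ?thesis by (simp add: L2_def set_integrable_def)
  qed
  then show ?thesis using v by (simp add: L2loc_def)
qed

lemma test_function_scaleR_L2:
  assumes "test_function \<phi>"
  shows "(\<lambda>x. \<phi> x *\<^sub>R (b::'a::euclidean_space)) \<in> L2" "\<exists>R. \<forall>x. \<bar>x\<bar> > R \<longrightarrow> \<phi> x *\<^sub>R b = 0"
proof -
  obtain K M where KM: "compact K" "\<And>x. \<bar>\<phi> x\<bar> \<le> M * indicator K x"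
    using test_function_bounded[OF assms] by blast
  have [measurable]: "\<phi> \<in> borel_measurable lebesgue" by (rule test_function_measurable[OF assms])
  have [measurable]: "K \<in> sets lebesgue" using KM by (simp add: borel_compact)
  have fin: "emeasure lebesgue K < \<infinity>" using KM(1) emeasure_bounded_finite[OF compact_imp_bounded[OF KM(1)]] by (simp add: borel_compact)
  have "(\<lambda>x. indicator K x *\<^sub>R b) \<in> L2"
  proof -
    have "(\<lambda>x. (norm (indicator K x *\<^sub>R b))\<^sup>2) = (\<lambda>x. (norm b)\<^sup>2 * indicator K x)"
      by (auto simp: indicator_def)
    then show ?thesis using fin by (simp add: L2_def integrable_indicator_iff)
  qed
  then show "(\<lambda>x. \<phi> x *\<^sub>R b) \<in> L2"
  proof (rule L2_bound(1))
    show "norm (\<phi> x *\<^sub>R b) \<le> \<bar>M\<bar> * norm (indicator K x *\<^sub>R b)" for x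
    proof -
      have "\<bar>\<phi> x\<bar> \<le> \<bar>M\<bar> * indicator K x" using KM(2)[of x] by (auto simp: indicator_def)
      then have "\<bar>\<phi> x\<bar> * norm b \<le> (\<bar>M\<bar> * indicator K x) * norm b" by (intro mult_right_mono) auto
      then show ?thesis by (simp add: mult.assoc)
    qed
  qed auto
  obtain R where R: "\<And>x. x \<in> K \<Longrightarrow> \<bar>x\<bar> \<le> R"
    using compact_imp_bounded[OF KM(1)] by (auto simp: bounded_iff)
  have "\<phi> x *\<^sub>R b = 0" if "\<bar>x\<bar> > R" for x
  proof -
    have "x \<notin> K" using R that by force
    then show ?thesis using KM(2)[of x] by simp
  qed
  then show "\<exists>R. \<forall>x. \<bar>x\<bar> > R \<longrightarrow> \<phi> x *\<^sub>R b = 0" by blast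
qed

text \<open>Tested against a vector \<open>b\<close>, both integrals in the definition become
  pairings with square integrable functions of bounded support, so the identity passes to the
  limit.\<close>

lemma has_weak_deriv_closed:
  fixes u :: "nat \<Rightarrow> real \<Rightarrow> 'a::euclidean_space"
  assumes u: "\<And>n. has_weak_deriv (u n) (u' n)" and v: "v \<in> L1loc" "v' \<in> L1loc"
    and lim: "\<And>w R. w \<in> L2 \<Longrightarrow> \<forall>x. \<bar>x\<bar> > R \<longrightarrow> w x = 0 \<Longrightarrow> (\<lambda>n. L2_inner (u n) w) \<longlonglongrightarrow> L2_inner v w"
    and lim': "\<And>w R. w \<in> L2 \<Longrightarrow> \<forall>x. \<bar>x\<bar> > R \<longrightarrow> w x = 0 \<Longrightarrow> (\<lambda>n. L2_inner (u' n) w) \<longlonglongrightarrow> L2_inner v' w"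
  shows "has_weak_deriv v v'"
  unfolding has_weak_deriv_def
proof (intro conjI v allI impI)
  fix \<phi> assume \<phi>: "test_function \<phi>"
  have pair: "(\<integral>x. \<psi> x *\<^sub>R h x \<partial>lebesgue) \<bullet> b = L2_inner h (\<lambda>x. \<psi> x *\<^sub>R b)"
    if "test_function \<psi>" "h \<in> L1loc" for \<psi> b and h :: "real \<Rightarrow> 'a"
    using test_function_integrable[OF that] by (simp add: L2_inner_def integral_inner_left[symmetric])
  show "(\<integral>x. deriv \<phi> x *\<^sub>R v x \<partial>lebesgue) = - (\<integral>x. \<phi> x *\<^sub>R v' x \<partial>lebesgue)"
  proof (rule euclidean_eqI)
    fix b :: 'a
    have d\<phi>: "test_function (deriv \<phi>)" by (rule test_function_deriv[OF \<phi>])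
    obtain R R' where "\<forall>x. \<bar>x\<bar> > R \<longrightarrow> deriv \<phi> x *\<^sub>R b = 0" "\<forall>x. \<bar>x\<bar> > R' \<longrightarrow> \<phi> x *\<^sub>R b = 0"
      using test_function_scaleR_L2(2)[OF d\<phi>, of b] test_function_scaleR_L2(2)[OF \<phi>, of b] by blast
    then have "(\<lambda>n. L2_inner (u n) (\<lambda>x. deriv \<phi> x *\<^sub>R b)) \<longlonglongrightarrow> L2_inner v (\<lambda>x. deriv \<phi> x *\<^sub>R b)"
      "(\<lambda>n. L2_inner (u' n) (\<lambda>x. \<phi> x *\<^sub>R b)) \<longlonglongrightarrow> L2_inner v' (\<lambda>x. \<phi> x *\<^sub>R b)"
      by (blast intro: lim lim' test_function_scaleR_L2(1)[OF d\<phi>] test_function_scaleR_L2(1)[OF \<phi>])+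
    moreover have "L2_inner (u n) (\<lambda>x. deriv \<phi> x *\<^sub>R b) = - L2_inner (u' n) (\<lambda>x. \<phi> x *\<^sub>R b)" for n
      using u[of n] \<phi> d\<phi> pair[of "deriv \<phi>" "u n" b] pair[of \<phi> "u' n" b] by (simp add: has_weak_deriv_def)
    ultimately have "L2_inner v (\<lambda>x. deriv \<phi> x *\<^sub>R b) = - L2_inner v' (\<lambda>x. \<phi> x *\<^sub>R b)"
      using LIMSEQ_unique[OF _ tendsto_minus] by fastforce
    then show "(\<integral>x. deriv \<phi> x *\<^sub>R v x \<partial>lebesgue) \<bullet> b = - (\<integral>x. \<phi> x *\<^sub>R v' x \<partial>lebesgue) \<bullet> b"
      using pair[OF d\<phi> v(1)] pair[OF \<phi> v(2)] by simp
  qed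
qed


text \<open>Weighted compactness is applied twice: to the derivatives with weight \<open>a\<close>,
  and along that subsequence to \<open>\<rho>\<close> times the functions with weight
  \<open>a\<^sup>2\<close>. Closedness of the weak derivative then links the two limits.\<close>

lemma H1loc_compactness:
  fixes u :: "nat \<Rightarrow> real \<Rightarrow> 'a::euclidean_space" and a :: "nat \<Rightarrow> real \<Rightarrow> real"
  assumes u: "\<And>n. u n \<in> H1loc" and am: "\<And>n. a n \<in> borel_measurable lebesgue"
    and a: "\<And>n x. 0 < a n x" "\<And>n x. a n x \<le> 1"
    and a_lim: "\<forall>R. \<forall>\<theta><1. \<forall>\<^sub>F n in sequentially. \<forall>x. \<bar>x\<bar> \<le> R \<longrightarrow> \<theta> \<le> a n x"
    and bd: "\<And>n. (\<integral>\<^sup>+x. ennreal ((a n x)\<^sup>2 * (norm (weak_deriv (u n) x))\<^sup>2) \<partial>lebesgue) \<le> ennreal C"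
    and bd4: "\<And>n. (\<integral>\<^sup>+x. ennreal ((a n x)^4 * ((norm (u n x))\<^sup>2 - 1)\<^sup>2) \<partial>lebesgue) \<le> ennreal C"
    and "C \<ge> 0"
  obtains r v where "strict_mono r" "v \<in> H1loc" "weak_deriv v \<in> L2"
    "\<And>n. (\<lambda>x. a n x *\<^sub>R weak_deriv (u n) x) \<in> L2"
    "\<And>w. w \<in> L2 \<Longrightarrow> (\<lambda>n. L2_inner (\<lambda>x. a (r n) x *\<^sub>R weak_deriv (u (r n)) x) w) \<longlonglongrightarrow> L2_inner (weak_deriv v) w"
    "\<And>w R. w \<in> L2 \<Longrightarrow> \<forall>x. \<bar>x\<bar> > R \<longrightarrow> w x = 0 \<Longrightarrow> (\<lambda>n. L2_inner (u (r n)) w) \<longlonglongrightarrow> L2_inner v w"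
    "\<And>w R. w \<in> L2 \<Longrightarrow> \<forall>x. \<bar>x\<bar> > R \<longrightarrow> w x = 0 \<Longrightarrow>
      (\<lambda>n. L2_inner (weak_deriv (u (r n))) w) \<longlonglongrightarrow> L2_inner (weak_deriv v) w"
    "\<And>R. \<exists>B. \<forall>\<^sub>F n in sequentially.
      L2_inner (\<lambda>x. indicator {-R..R} x *\<^sub>R u (r n) x) (\<lambda>x. indicator {-R..R} x *\<^sub>R u (r n) x) \<le> B \<and>
      L2_inner (\<lambda>x. indicator {-R..R} x *\<^sub>R weak_deriv (u (r n)) x) (\<lambda>x. indicator {-R..R} x *\<^sub>R weak_deriv (u (r n)) x) \<le> B"
proof -
  note um [measurable] = H1locD(1)[OF u, THEN L2loc_measurable]
  note wdm [measurable] = H1locD(3)[OF u, THEN L2loc_measurable]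
  note am [measurable]
  obtain r1 g where r1: "strict_mono r1" and g: "g \<in> L2" and aL2: "\<And>n. (\<lambda>x. a n x *\<^sub>R weak_deriv (u n) x) \<in> L2"
    and gw: "\<And>w. w \<in> L2 \<Longrightarrow> (\<lambda>n. L2_inner (\<lambda>x. a (r1 n) x *\<^sub>R weak_deriv (u (r1 n)) x) w) \<longlonglongrightarrow> L2_inner g w"
    and gl: "\<And>w R. w \<in> L2 \<Longrightarrow> \<forall>x. \<bar>x\<bar> > R \<longrightarrow> w x = 0 \<Longrightarrow>
      (\<lambda>n. L2_inner (weak_deriv (u (r1 n))) w) \<longlonglongrightarrow> L2_inner g w"
    and gb: "\<And>R. \<forall>\<^sub>F n in sequentially. L2_inner (\<lambda>x. indicator {-R..R} x *\<^sub>R weak_deriv (u n) x)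
        (\<lambda>x. indicator {-R..R} x *\<^sub>R weak_deriv (u n) x) \<le> 4 * C"
    by (rule weighted_weak_compactness[OF wdm am a a_lim bd \<open>C \<ge> 0\<close>]) (rule that)
  \<comment> \<open>The potential controls \<open>u n\<close> only locally in \<open>L2\<close>; the weight \<open>\<rho>\<close> makes the bound global.\<close>
  define \<rho> where "\<rho> = (\<lambda>x::real. inverse (1 + x\<^sup>2))"
  have \<rho>: "0 < \<rho> x" "\<rho> x \<le> 1" for x
    by (auto simp: \<rho>_def add_pos_nonneg inverse_le_1_iff)
  have [measurable]: "\<rho> \<in> borel_measurable lebesgue"
    using integrable_inverse_1_plus_square by (auto simp: \<rho>_def)
  define I where "I = (\<integral>x. \<rho> x \<partial>lebesgue)"
  have I: "(\<integral>\<^sup>+x. ennreal (\<rho> x) \<partial>lebesgue) = ennreal I" "I \<ge> 0"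
    unfolding I_def using integrable_inverse_1_plus_square \<rho>(1)
    by (auto intro!: nn_integral_eq_integral integral_nonneg_AE simp: \<rho>_def[symmetric] less_imp_le)
  define f where "f = (\<lambda>n x. \<rho> x *\<^sub>R u (r1 n) x)"
  \<comment> \<open>The potential carries the fourth power of \<open>a\<close>, which is the square
    of this weight.\<close>
  define b where "b = (\<lambda>n x. (a (r1 n) x)\<^sup>2)"
  have fm [measurable]: "f n \<in> borel_measurable lebesgue"
    and bm [measurable]: "b n \<in> borel_measurable lebesgue" for n
    by (simp_all add: f_def b_def)
  have b: "0 < b n x" "b n x \<le> 1" for n x using a[of "r1 n" x] by (auto simp: b_def power_le_one)
  have b_lim: "\<forall>R. \<forall>\<theta><1. \<forall>\<^sub>F n in sequentially. \<forall>x. \<bar>x\<bar> \<le> R \<longrightarrow> \<theta> \<le> b n x"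
  proof (intro allI impI)
    fix R \<theta> :: real assume "\<theta> < 1"
    define \<theta>' where "\<theta>' = max \<theta> 0"
    have "sqrt \<theta>' < 1" using \<open>\<theta> < 1\<close> by (simp add: \<theta>'_def)
    from a_lim[rule_format, OF this, of R] have "\<forall>\<^sub>F n in sequentially. \<forall>x. \<bar>x\<bar> \<le> R \<longrightarrow> sqrt \<theta>' \<le> a (r1 n) x"
      by (rule eventually_subseq[OF r1])
    then show "\<forall>\<^sub>F n in sequentially. \<forall>x. \<bar>x\<bar> \<le> R \<longrightarrow> \<theta> \<le> b n x"
    proof eventually_elim
      case (elim n)
      have "\<theta> \<le> b n x" if "\<bar>x\<bar> \<le> R" for x
      proof -
        have "(sqrt \<theta>')\<^sup>2 \<le> b n x" unfolding b_def using elim that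
          by (intro power_mono) (auto simp: \<theta>'_def)
        then show ?thesis by (simp add: \<theta>'_def)
      qed
      then show ?case by blast
    qed
  qed
  have bdf: "(\<integral>\<^sup>+x. ennreal ((b n x)\<^sup>2 * (norm (f n x))\<^sup>2) \<partial>lebesgue) \<le> ennreal (2 * I + C)" for n
  proof -
    have "(b n x)\<^sup>2 * (norm (f n x))\<^sup>2 \<le> 2 * \<rho> x + (a (r1 n) x)^4 * ((norm (u (r1 n) x))\<^sup>2 - 1)\<^sup>2" for x
    proof -
      define t where "t = (norm (u (r1 n) x))\<^sup>2"
      define A where "A = (a (r1 n) x)^4"
      have A: "0 \<le> A" "A \<le> 1" using a[of "r1 n" x] by (auto simp: A_def power_le_one)
      \<comment> \<open>Converts control of the potential into control of the squared norm
        \<open>t\<close>: the difference of the two sides is \<open>(t - 3/2)\<^sup>2 + 3/4\<close>.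
        The constant 2 becomes integrable after multiplication by \<open>\<rho>\<close>.\<close>
      have t: "0 \<le> t" "t \<le> 2 + (t - 1)\<^sup>2"
        using zero_le_power2[of "t - 3/2"] by (auto simp: t_def power2_eq_square algebra_simps)
      have r2: "(\<rho> x)\<^sup>2 \<le> \<rho> x" "(\<rho> x)\<^sup>2 \<le> 1" using \<rho>[of x] by (auto simp: power2_eq_square mult_le_one mult_left_le)
      have "(b n x)\<^sup>2 * (norm (f n x))\<^sup>2 = (\<rho> x)\<^sup>2 * (A * t)"
        by (simp add: b_def f_def A_def t_def power_mult_distrib)
      also have "\<dots> \<le> (\<rho> x)\<^sup>2 * (A * (2 + (t - 1)\<^sup>2))"
        using A t by (intro mult_left_mono) auto
      also have "\<dots> = 2 * ((\<rho> x)\<^sup>2 * A) + (\<rho> x)\<^sup>2 * (A * (t - 1)\<^sup>2)" by (simp add: algebra_simps)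
      also have "\<dots> \<le> 2 * (\<rho> x * 1) + 1 * (A * (t - 1)\<^sup>2)"
        using A r2 \<rho>(1)[of x] by (intro add_mono mult_left_mono mult_mono mult_right_mono) auto
      finally show ?thesis by (simp add: A_def t_def)
    qed
    note pw = this
    have "(\<integral>\<^sup>+x. ennreal ((b n x)\<^sup>2 * (norm (f n x))\<^sup>2) \<partial>lebesgue)
        \<le> (\<integral>\<^sup>+x. ennreal 2 * ennreal (\<rho> x) + ennreal ((a (r1 n) x)^4 * ((norm (u (r1 n) x))\<^sup>2 - 1)\<^sup>2) \<partial>lebesgue)"
    proof (rule nn_integral_mono)
      fix x
      have "ennreal (2 * \<rho> x + (a (r1 n) x)^4 * ((norm (u (r1 n) x))\<^sup>2 - 1)\<^sup>2)
        = ennreal 2 * ennreal (\<rho> x) + ennreal ((a (r1 n) x)^4 * ((norm (u (r1 n) x))\<^sup>2 - 1)\<^sup>2)"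
        using \<rho>(1)[of x] by (simp add: ennreal_plus ennreal_mult less_imp_le)
      then show "ennreal ((b n x)\<^sup>2 * (norm (f n x))\<^sup>2)
        \<le> ennreal 2 * ennreal (\<rho> x) + ennreal ((a (r1 n) x)^4 * ((norm (u (r1 n) x))\<^sup>2 - 1)\<^sup>2)"
        using ennreal_leI[OF pw[of x]] by simp
    qed
    also have "\<dots> = ennreal 2 * ennreal I + (\<integral>\<^sup>+x. ennreal ((a (r1 n) x)^4 * ((norm (u (r1 n) x))\<^sup>2 - 1)\<^sup>2) \<partial>lebesgue)"
      by (simp add: nn_integral_add nn_integral_cmult I)
    also have "\<dots> \<le> ennreal 2 * ennreal I + ennreal C" by (intro add_mono bd4 order_refl)
    also have "\<dots> = ennreal (2 * I + C)"
      using I(2) \<open>C \<ge> 0\<close> by (simp add: ennreal_mult ennreal_plus)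
    finally show ?thesis .
  qed
  have IC: "2 * I + C \<ge> 0" using I \<open>C \<ge> 0\<close> by simp
  obtain r2 y where r2: "strict_mono r2" and y: "y \<in> L2"
    and yl: "\<And>w R. w \<in> L2 \<Longrightarrow> \<forall>x. \<bar>x\<bar> > R \<longrightarrow> w x = 0 \<Longrightarrow>
      (\<lambda>n. L2_inner (f (r2 n)) w) \<longlonglongrightarrow> L2_inner y w"
    and yb: "\<And>R. \<forall>\<^sub>F n in sequentially. L2_inner (\<lambda>x. indicator {-R..R} x *\<^sub>R f n x)
        (\<lambda>x. indicator {-R..R} x *\<^sub>R f n x) \<le> 4 * (2 * I + C)"
    by (rule weighted_weak_compactness[OF fm bm b b_lim bdf IC]) (rule that)
  define r where "r = r1 \<circ> r2"
  have r: "strict_mono r" unfolding r_def using r1 r2 by (rule strict_mono_o)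
  \<comment> \<open>Divides out the weight \<open>\<rho>\<close> again; \<open>v\<close> is only
    locally square integrable.\<close>
  define v where "v = (\<lambda>x. (1 + x\<^sup>2) *\<^sub>R y x)"
  have \<rho>_inv: "\<rho> x * (1 + x\<^sup>2) = 1" for x
    using add_pos_nonneg[of 1 "x\<^sup>2"] by (simp add: \<rho>_def)
  have sq_le: "\<bar>1 + x\<^sup>2\<bar> \<le> 1 + R\<^sup>2" if "\<bar>x\<bar> \<le> R" for x R :: real
    using power_mono[OF that abs_ge_zero, of 2] by simp
  have poly_meas [measurable]: "(\<lambda>x::real. 1 + x\<^sup>2) \<in> borel_measurable lebesgue"
    by (intro measurable_completion) simp
  have [measurable]: "y \<in> borel_measurable lebesgue" by (rule L2_measurable[OF y])
  have vL2: "v \<in> L2loc"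
  proof (rule L2_local_bound_imp_L2loc[OF y])
    show "\<exists>k\<ge>0. \<forall>x. \<bar>x\<bar> \<le> R \<longrightarrow> norm (v x) \<le> k * norm (y x)" for R
      using sq_le[of _ R] by (intro exI[of _ "1 + R\<^sup>2"]) (auto simp: v_def intro!: mult_right_mono)
  qed (simp add: v_def)
  have ul: "(\<lambda>n. L2_inner (u (r n)) w) \<longlonglongrightarrow> L2_inner v w"
    if w: "w \<in> L2" and w0: "\<forall>x. \<bar>x\<bar> > R \<longrightarrow> w x = 0" for w R
  proof -
    have [measurable]: "w \<in> borel_measurable lebesgue" by (rule L2_measurable[OF w])
    have "norm ((1 + x\<^sup>2) *\<^sub>R w x) \<le> (1 + R\<^sup>2) * norm (w x)" for x
      using sq_le[of x R] w0 by (cases "\<bar>x\<bar> \<le> R") (auto intro!: mult_right_mono)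
    then have "(\<lambda>x. (1 + x\<^sup>2) *\<^sub>R w x) \<in> L2"
      by (intro L2_bound(1)[OF w]) (auto intro!: borel_measurable_scaleR)
    from yl[OF this, of R] w0
    have "(\<lambda>n. L2_inner (f (r2 n)) (\<lambda>x. (1 + x\<^sup>2) *\<^sub>R w x)) \<longlonglongrightarrow> L2_inner y (\<lambda>x. (1 + x\<^sup>2) *\<^sub>R w x)" by simp
    moreover have "L2_inner (f (r2 n)) (\<lambda>x. (1 + x\<^sup>2) *\<^sub>R w x) = L2_inner (u (r n)) w" for n
      unfolding L2_inner_def f_def r_def using \<rho>_inv by (simp add: mult.assoc[symmetric] mult.commute)
    ultimately show ?thesis by (simp add: L2_inner_def v_def)
  qed
  have ul': "(\<lambda>n. L2_inner (weak_deriv (u (r n))) w) \<longlonglongrightarrow> L2_inner g w"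
    if "w \<in> L2" "\<forall>x. \<bar>x\<bar> > R \<longrightarrow> w x = 0" for w R
    using LIMSEQ_subseq_LIMSEQ[OF gl[OF that] r2] by (simp add: r_def o_def)
  have wd: "has_weak_deriv v g"
  proof (rule has_weak_deriv_closed[of "\<lambda>n. u (r n)" "\<lambda>n. weak_deriv (u (r n))", OF H1locD(2)[OF u] _ _ ul ul'])
    show "v \<in> L1loc" "g \<in> L1loc" using vL2 g by (auto intro: L2loc_imp_L1loc L2_imp_L2loc)
  qed
  have vH: "v \<in> H1loc" using vL2 wd g by (auto simp: H1loc_def intro: L2_imp_L2loc)
  have wdvm [measurable]: "weak_deriv v \<in> borel_measurable lebesgue"
    by (rule L2loc_measurable[OF H1locD(3)[OF vH]])
  have [measurable]: "g \<in> borel_measurable lebesgue" by (rule L2_measurable[OF g])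
  have AE: "AE x in lebesgue. weak_deriv v x = g x" by (rule weak_deriv_AE_eq[OF wd])
  \<comment> \<open>The chosen \<open>weak_deriv v\<close> agrees with \<open>g\<close> only almost
    everywhere, so pairings and membership in \<open>L2\<close> are transferred from
    \<open>g\<close>.\<close>
  have inner_g: "L2_inner g w = L2_inner (weak_deriv v) w" if "w \<in> L2" for w
  proof -
    have [measurable]: "w \<in> borel_measurable lebesgue" by (rule L2_measurable[OF that])
    show ?thesis unfolding L2_inner_def by (intro integral_cong_AE) (use AE in auto)
  qed
  have wdL2: "weak_deriv v \<in> L2"
  proof -
    have "integrable lebesgue (\<lambda>x. (norm (g x))\<^sup>2)" using g by (simp add: L2_def)
    then have "integrable lebesgue (\<lambda>x. (norm (weak_deriv v x))\<^sup>2)"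
      by (rule integrable_cong_AE_imp) (use AE in auto)
    then show ?thesis using wdvm by (simp add: L2_def)
  qed
  have bnd: "\<exists>B. \<forall>\<^sub>F n in sequentially.
      L2_inner (\<lambda>x. indicator {-R..R} x *\<^sub>R u (r n) x) (\<lambda>x. indicator {-R..R} x *\<^sub>R u (r n) x) \<le> B \<and>
      L2_inner (\<lambda>x. indicator {-R..R} x *\<^sub>R weak_deriv (u (r n)) x) (\<lambda>x. indicator {-R..R} x *\<^sub>R weak_deriv (u (r n)) x) \<le> B" for R
  proof -
    \<comment> \<open>On \<open>{-R..R}\<close> the reciprocal of \<open>\<rho>\<close> is at most
      \<open>1 + R\<^sup>2\<close>.\<close>
    have "sqrt (L2_inner (\<lambda>x. indicator {-R..R} x *\<^sub>R u (r n) x) (\<lambda>x. indicator {-R..R} x *\<^sub>R u (r n) x))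
      \<le> (1 + R\<^sup>2) * sqrt (L2_inner (\<lambda>x. indicator {-R..R} x *\<^sub>R f (r2 n) x) (\<lambda>x. indicator {-R..R} x *\<^sub>R f (r2 n) x))" for n
    proof (rule L2_bound(2))
      have "f (r2 n) = (\<lambda>x. \<rho> x *\<^sub>R u (r n) x)" by (simp add: f_def r_def)
      moreover have "(\<lambda>x. \<rho> x *\<^sub>R u (r n) x) \<in> L2loc"
      proof -
        have "norm (\<rho> x *\<^sub>R u (r n) x) \<le> norm (u (r n) x)" for x
          using \<rho>[of x] by (simp add: mult_left_le_one_le)
        then have sq: "(norm (\<rho> x *\<^sub>R u (r n) x))\<^sup>2 \<le> (norm (u (r n) x))\<^sup>2" for x
          by (intro power_mono) auto
        show ?thesis unfolding L2loc_def mem_Collect_eq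
        proof (intro conjI allI impI)
          fix K :: "real set" assume K: "compact K"
          have [measurable]: "K \<in> sets lebesgue" using K by (simp add: borel_compact)
          have "set_integrable lebesgue K (\<lambda>x. (norm (u (r n) x))\<^sup>2)"
            using H1locD(1)[OF u] K by (simp add: L2loc_def)
          then show "set_integrable lebesgue K (\<lambda>x. (norm (\<rho> x *\<^sub>R u (r n) x))\<^sup>2)"
            unfolding set_integrable_def
            by (rule Bochner_Integration.integrable_bound) (use sq in \<open>auto simp: indicator_def\<close>)
        qed simp
      qed
      ultimately show "(\<lambda>x. indicator {-R..R} x *\<^sub>R f (r2 n) x) \<in> L2"
        by (simp only: L2loc_indicator_L2 compact_Icc)
      show "norm (indicator {-R..R} x *\<^sub>R u (r n) x) \<le> (1 + R\<^sup>2) * norm (indicator {-R..R} x *\<^sub>R f (r2 n) x)" for x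
      proof (cases "x \<in> {-R..R}")
        case True
        then have "\<bar>x\<bar> \<le> R" by auto
        have "norm (u (r n) x) = (\<rho> x * (1 + x\<^sup>2)) * norm (u (r n) x)" by (simp add: \<rho>_inv)
        also have "\<dots> \<le> (\<rho> x * (1 + R\<^sup>2)) * norm (u (r n) x)"
          using sq_le[OF \<open>\<bar>x\<bar> \<le> R\<close>] \<rho>(1)[of x] by (intro mult_right_mono mult_left_mono) auto
        finally show ?thesis using True \<rho>(1)[of x] by (simp add: f_def r_def mult.commute mult.left_commute)
      qed simp
    qed (auto intro!: borel_measurable_scaleR borel_measurable_indicator)
    then have *: "L2_inner (\<lambda>x. indicator {-R..R} x *\<^sub>R u (r n) x) (\<lambda>x. indicator {-R..R} x *\<^sub>R u (r n) x)
      \<le> (1 + R\<^sup>2)\<^sup>2 * L2_inner (\<lambda>x. indicator {-R..R} x *\<^sub>R f (r2 n) x) (\<lambda>x. indicator {-R..R} x *\<^sub>R f (r2 n) x)" for n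
      using sqrt_le_D[of _ "(1 + R\<^sup>2) * sqrt (L2_inner (\<lambda>x. indicator {-R..R} x *\<^sub>R f (r2 n) x) (\<lambda>x. indicator {-R..R} x *\<^sub>R f (r2 n) x))"]
      by (simp add: power_mult_distrib L2_inner_ge_zero)
    define B where "B = max ((1 + R\<^sup>2)\<^sup>2 * (4 * (2 * I + C))) (4 * C)"
    have "\<forall>\<^sub>F n in sequentially.
      L2_inner (\<lambda>x. indicator {-R..R} x *\<^sub>R u (r n) x) (\<lambda>x. indicator {-R..R} x *\<^sub>R u (r n) x) \<le> B \<and>
      L2_inner (\<lambda>x. indicator {-R..R} x *\<^sub>R weak_deriv (u (r n)) x) (\<lambda>x. indicator {-R..R} x *\<^sub>R weak_deriv (u (r n)) x) \<le> B"
      using eventually_subseq[OF r2 yb[of R]] eventually_subseq[OF r gb[of R]]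
    proof eventually_elim
      case (elim n)
      have "(1 + R\<^sup>2)\<^sup>2 * L2_inner (\<lambda>x. indicator {-R..R} x *\<^sub>R f (r2 n) x) (\<lambda>x. indicator {-R..R} x *\<^sub>R f (r2 n) x)
        \<le> (1 + R\<^sup>2)\<^sup>2 * (4 * (2 * I + C))" by (rule mult_left_mono[OF elim(1)]) simp
      then show ?case using *[of n] elim(2) unfolding B_def by linarith
    qed
    then show ?thesis by blast
  qed
  have gw': "(\<lambda>n. L2_inner (\<lambda>x. a (r n) x *\<^sub>R weak_deriv (u (r n)) x) w) \<longlonglongrightarrow> L2_inner (weak_deriv v) w" if "w \<in> L2" for w
    using LIMSEQ_subseq_LIMSEQ[OF gw[OF that] r2] inner_g[OF that] by (simp add: r_def o_def)
  show ?thesis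
    by (rule that[OF r vH wdL2 aL2 gw' ul]) (use ul' inner_g bnd in auto)
qed

subsection \<open>Weak convergence in \<open>H1loc\<close>\<close>


lemma H1locI:
  assumes "f \<in> L2loc" "g \<in> L2loc" "has_weak_deriv f g" shows "f \<in> H1loc"
  using assms by (auto simp: H1loc_def)

lemma H1loc_add: "f \<in> H1loc \<Longrightarrow> g \<in> H1loc \<Longrightarrow> (\<lambda>x. f x + g x) \<in> H1loc"
  by (rule H1locI[where g = "\<lambda>x. weak_deriv f x + weak_deriv g x"])
    (auto intro: L2loc_add has_weak_deriv_add H1locD)

lemma H1loc_scaleR: "f \<in> H1loc \<Longrightarrow> (\<lambda>x. c *\<^sub>R f x) \<in> H1loc"
  by (rule H1locI[where g = "\<lambda>x. c *\<^sub>R weak_deriv f x"])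
    (auto intro: L2loc_scaleR has_weak_deriv_scaleR H1locD)

lemma H1loc_zero: "(\<lambda>x. 0) \<in> H1loc"
proof (rule H1locI)
  show "has_weak_deriv (\<lambda>x. 0) (\<lambda>x. 0::'a)"
    using has_weak_deriv_sum[of "{}" "\<lambda>_ _. 0::'a" "\<lambda>_ _. 0"] by simp
qed (use L2loc_sum[of "{}" "\<lambda>_ _. 0::'a"] in simp_all)

lemma H1loc_sum: "(\<And>i. i \<in> I \<Longrightarrow> f i \<in> H1loc) \<Longrightarrow> (\<lambda>x. \<Sum>i\<in>I. f i x) \<in> H1loc"
  by (induction I rule: infinite_finite_induct) (auto intro: H1loc_add H1loc_zero)

lemma H1loc_dual_add:
  "l \<in> H1loc_dual \<Longrightarrow> u \<in> H1loc \<Longrightarrow> v \<in> H1loc \<Longrightarrow> l (\<lambda>x. u x + v x) = l u + l v"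
  unfolding H1loc_dual_def by blast

lemma H1loc_dual_scaleR:
  "l \<in> H1loc_dual \<Longrightarrow> u \<in> H1loc \<Longrightarrow> l (\<lambda>x. c *\<^sub>R u x) = c * l u"
  unfolding H1loc_dual_def by blast

lemma H1loc_dual_lincomb:
  assumes l: "l \<in> H1loc_dual" and f: "\<And>i. f i \<in> H1loc"
  shows "l (\<lambda>x. \<Sum>i<(N::nat). c i *\<^sub>R f i x) = (\<Sum>i<N. c i * l (f i))"
proof (induction N)
  case 0
  show ?case using H1loc_dual_scaleR[OF l f, of 0 0] by simp
next
  case (Suc N)
  have "(\<lambda>x. \<Sum>i<N. c i *\<^sub>R f i x) \<in> H1loc" by (intro H1loc_sum H1loc_scaleR f)
  from H1loc_dual_add[OF l this H1loc_scaleR[OF f]]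
  show ?case using Suc H1loc_dual_scaleR[OF l f] by simp
qed

lemma L2_inner_indicator_mono:
  assumes "f \<in> L2loc" "compact I" "K \<subseteq> I" "compact K"
  shows "L2_inner (\<lambda>x. indicator K x *\<^sub>R f x) (\<lambda>x. indicator K x *\<^sub>R f x)
    \<le> L2_inner (\<lambda>x. indicator I x *\<^sub>R f x) (\<lambda>x. indicator I x *\<^sub>R f x)"
  unfolding L2_inner_def
proof (rule integral_mono)
  show "integrable lebesgue (\<lambda>x. (indicat_real K x *\<^sub>R f x) \<bullet> (indicat_real K x *\<^sub>R f x))"
    "integrable lebesgue (\<lambda>x. (indicat_real I x *\<^sub>R f x) \<bullet> (indicat_real I x *\<^sub>R f x))"
    using assms by (auto intro!: L2_inner_integrable L2loc_indicator_L2 simp del: inner_scaleR_left inner_scaleR_right)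
  show "(indicat_real K x *\<^sub>R f x) \<bullet> (indicat_real K x *\<^sub>R f x)
      \<le> (indicat_real I x *\<^sub>R f x) \<bullet> (indicat_real I x *\<^sub>R f x)" for x
    using assms(3) by (auto simp: indicator_def)
qed

text \<open>Frees the seminorm from the choice of representative: for a linear combination, the
  combination of the derivatives may be used although \<open>weak_deriv\<close> selects some other
  representative.\<close>

lemma H1_seminorm_square:
  assumes u: "has_weak_deriv u u'" "u \<in> L2loc" "u' \<in> L2loc" and K: "compact K"
  shows "(H1_seminorm K u)\<^sup>2 = L2_inner (\<lambda>x. indicator K x *\<^sub>R u x) (\<lambda>x. indicator K x *\<^sub>R u x)
    + L2_inner (\<lambda>x. indicator K x *\<^sub>R u' x) (\<lambda>x. indicator K x *\<^sub>R u' x)"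
proof -
  have uH: "u \<in> H1loc" using u by (auto intro: H1locI)
  note [measurable] = L2loc_measurable[OF u(2)] L2loc_measurable[OF u(3)] L2loc_measurable[OF H1locD(3)[OF uH]]
  have [measurable]: "K \<in> sets lebesgue" using K by (simp add: borel_compact)
  have "(LINT x:K|lebesgue. (norm (u x))\<^sup>2 + (norm (weak_deriv u x))\<^sup>2)
      = (\<integral>x. (indicator K x *\<^sub>R u x) \<bullet> (indicator K x *\<^sub>R u x) + (indicator K x *\<^sub>R u' x) \<bullet> (indicator K x *\<^sub>R u' x) \<partial>lebesgue)"
    unfolding set_lebesgue_integral_def
  proof (rule integral_cong_AE)
    show "AE x in lebesgue. indicator K x *\<^sub>R ((norm (u x))\<^sup>2 + (norm (weak_deriv u x))\<^sup>2)
      = (indicator K x *\<^sub>R u x) \<bullet> (indicator K x *\<^sub>R u x) + (indicator K x *\<^sub>R u' x) \<bullet> (indicator K x *\<^sub>R u' x)"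
      using weak_deriv_AE_eq[OF u(1)]
      by eventually_elim (auto simp: indicator_def power2_norm_eq_inner)
  qed simp_all
  also have "\<dots> = L2_inner (\<lambda>x. indicator K x *\<^sub>R u x) (\<lambda>x. indicator K x *\<^sub>R u x)
    + L2_inner (\<lambda>x. indicator K x *\<^sub>R u' x) (\<lambda>x. indicator K x *\<^sub>R u' x)"
    unfolding L2_inner_def
    by (intro Bochner_Integration.integral_add L2_inner_integrable L2loc_indicator_L2 u K)
  finally have eq: "(LINT x:K|lebesgue. (norm (u x))\<^sup>2 + (norm (weak_deriv u x))\<^sup>2) = \<dots>" .
  show ?thesis unfolding H1_seminorm_def eq by (simp add: L2_inner_ge_zero)
qed

lemma L2_inner_indicator_left:
  assumes "\<And>x. x \<notin> I \<Longrightarrow> w x = 0"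
  shows "L2_inner (\<lambda>x. indicator I x *\<^sub>R f x) w = L2_inner f w"
  unfolding L2_inner_def using assms by (intro Bochner_Integration.integral_cong) (auto simp: indicator_def)

lemma L2_inner_diff_le:
  assumes "f \<in> L2" "g \<in> L2"
  shows "L2_inner (\<lambda>x. f x - g x) (\<lambda>x. f x - g x) \<le> 2 * L2_inner f f + 2 * L2_inner g g"
proof -
  have "0 \<le> L2_inner f f + 2 * L2_inner f g + L2_inner g g"
    using L2_inner_diff_self[OF assms(1) L2_scaleR[OF assms(2), of "-1"]]
      L2_inner_ge_zero[of "\<lambda>x. f x - (-1) *\<^sub>R g x"]
    by (simp add: L2_inner_scaleR_left L2_inner_scaleR_right del: scaleR_minus_left scaleR_minus1_left)
  then show ?thesis using L2_inner_diff_self[OF assms] by simp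
qed

text \<open>A functional in the dual is dominated by the seminorm over some compact set, hence by
  the \<open>H1\<close> norm over an interval \<open>I\<close>. The matrix of \<open>H1\<close>
  inner products over \<open>I\<close> of the differences \<open>u n - v\<close> is asymptotically
  null, and its diagonal is bounded by \<open>bd\<close>, so
  \<open>gram_null_imp_functional_null\<close> applies without representing the functional.\<close>

lemma weakly_tendsto_H1locI:
  fixes u :: "nat \<Rightarrow> real \<Rightarrow> 'a::euclidean_space"
  assumes u: "\<And>n. u n \<in> H1loc" and v: "v \<in> H1loc"
    and lim: "\<And>w R. w \<in> L2 \<Longrightarrow> \<forall>x. \<bar>x\<bar> > R \<longrightarrow> w x = 0 \<Longrightarrow> (\<lambda>n. L2_inner (u n) w) \<longlonglongrightarrow> L2_inner v w"
    and lim': "\<And>w R. w \<in> L2 \<Longrightarrow> \<forall>x. \<bar>x\<bar> > R \<longrightarrow> w x = 0 \<Longrightarrow>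
      (\<lambda>n. L2_inner (weak_deriv (u n)) w) \<longlonglongrightarrow> L2_inner (weak_deriv v) w"
    and bd: "\<And>R. \<exists>B. \<forall>\<^sub>F n in sequentially.
      L2_inner (\<lambda>x. indicator {-R..R} x *\<^sub>R u n x) (\<lambda>x. indicator {-R..R} x *\<^sub>R u n x) \<le> B \<and>
      L2_inner (\<lambda>x. indicator {-R..R} x *\<^sub>R weak_deriv (u n) x) (\<lambda>x. indicator {-R..R} x *\<^sub>R weak_deriv (u n) x) \<le> B"
  shows "weakly_tendsto_H1loc u v"
  unfolding weakly_tendsto_H1loc_def
proof (intro conjI allI ballI u v)
  fix l :: "(real \<Rightarrow> 'a) \<Rightarrow> real" assume l: "l \<in> H1loc_dual"
  then obtain K C where K: "compact K" and C: "\<And>f. f \<in> H1loc \<Longrightarrow> \<bar>l f\<bar> \<le> C * H1_seminorm K f"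
    unfolding H1loc_dual_def by blast
  obtain R where R: "\<And>x. x \<in> K \<Longrightarrow> \<bar>x\<bar> \<le> R"
    using compact_imp_bounded[OF K] by (auto simp: bounded_iff)
  define I where "I = {-R..R}"
  have I: "compact I" "K \<subseteq> I" using R by (auto simp: I_def abs_le_iff minus_le_iff)
  have Iout: "\<bar>x\<bar> > R" if "x \<notin> I" for x using that by (auto simp: I_def)
  have Iout': "x \<notin> I" if "\<bar>x\<bar> > R" for x using that by (auto simp: I_def)
  note uL = H1locD(1)[OF u] and uL' = H1locD(3)[OF u] and vL = H1locD(1)[OF v] and vL' = H1locD(3)[OF v]
  define p p' where "p = (\<lambda>n x. indicator I x *\<^sub>R u n x)" and "p' = (\<lambda>n x. indicator I x *\<^sub>R weak_deriv (u n) x)"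
  define q q' where "q = (\<lambda>x. indicator I x *\<^sub>R v x)" and "q' = (\<lambda>x. indicator I x *\<^sub>R weak_deriv v x)"
  have pq: "p n \<in> L2" "p' n \<in> L2" "q \<in> L2" "q' \<in> L2" for n
    unfolding p_def p'_def q_def q'_def using uL uL' vL vL' I by (auto intro: L2loc_indicator_L2)
  define e e' where "e = (\<lambda>n x. p n x - q x)" and "e' = (\<lambda>n x. p' n x - q' x)"
  have e: "e n \<in> L2" "e' n \<in> L2" for n unfolding e_def e'_def by (intro L2_diff pq)+
  have esupp: "e n x = 0" "e' n x = 0" if "x \<notin> I" for n x
    using that by (simp_all add: e_def e'_def p_def p'_def q_def q'_def)
  \<comment> \<open>The inner product of \<open>H1\<close> over \<open>I\<close> for the
    differences. Being cut off to \<open>I\<close>, \<open>e m\<close> and \<open>e' m\<close> are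
    admissible as test vectors in \<open>lim\<close> and \<open>lim'\<close>.\<close>
  define G where "G = (\<lambda>n m. L2_inner (e n) (e m) + L2_inner (e' n) (e' m))"
  have limG: "(\<lambda>n. G n m) \<longlonglongrightarrow> 0" for m
  proof -
    have "L2_inner (e n) (e m) = L2_inner (u n) (e m) - L2_inner v (e m)" for n
    proof -
      have "L2_inner (e n) (e m) = L2_inner (p n) (e m) - L2_inner q (e m)"
        using L2_inner_diff_left[OF pq(1,3) e(1)] by (simp add: e_def)
      then show ?thesis unfolding p_def q_def by (simp add: L2_inner_indicator_left esupp)
    qed
    moreover have "L2_inner (e' n) (e' m) = L2_inner (weak_deriv (u n)) (e' m) - L2_inner (weak_deriv v) (e' m)" for n
    proof -
      have "L2_inner (e' n) (e' m) = L2_inner (p' n) (e' m) - L2_inner q' (e' m)"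
        using L2_inner_diff_left[OF pq(2,4) e(2)] by (simp add: e'_def)
      then show ?thesis unfolding p'_def q'_def by (simp add: L2_inner_indicator_left esupp)
    qed
    ultimately have "G n m = (L2_inner (u n) (e m) - L2_inner v (e m)) +
        (L2_inner (weak_deriv (u n)) (e' m) - L2_inner (weak_deriv v) (e' m))" for n
      by (simp add: G_def)
    moreover have "(\<lambda>n. (L2_inner (u n) (e m) - L2_inner v (e m)) +
        (L2_inner (weak_deriv (u n)) (e' m) - L2_inner (weak_deriv v) (e' m))) \<longlonglongrightarrow>
        (L2_inner v (e m) - L2_inner v (e m)) + (L2_inner (weak_deriv v) (e' m) - L2_inner (weak_deriv v) (e' m))"
      by (intro tendsto_intros lim[where R = R] lim'[where R = R] e) (auto simp: esupp Iout')
    ultimately show ?thesis by simp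
  qed
  obtain B0 where "\<forall>\<^sub>F n in sequentially. L2_inner (p n) (p n) \<le> B0 \<and> L2_inner (p' n) (p' n) \<le> B0"
    using bd[of R] unfolding p_def p'_def I_def by blast
  then have "\<forall>\<^sub>F n in sequentially. norm (G n n) \<le> 4 * B0 + 2 * L2_inner q q + 2 * L2_inner q' q'"
  proof eventually_elim
    case (elim n)
    have "L2_inner (e n) (e n) \<le> 2 * L2_inner (p n) (p n) + 2 * L2_inner q q"
      "L2_inner (e' n) (e' n) \<le> 2 * L2_inner (p' n) (p' n) + 2 * L2_inner q' q'"
      unfolding e_def e'_def by (intro L2_inner_diff_le pq)+
    moreover have "L2_inner (e n) (e n) \<ge> 0" "L2_inner (e' n) (e' n) \<ge> 0" by (rule L2_inner_ge_zero)+
    ultimately show ?case using elim unfolding G_def real_norm_def by linarith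
  qed
  \<comment> \<open>Turns the eventual bound on the diagonal into one for all indices.\<close>
  then have "Bseq (\<lambda>n. G n n)" by (rule BfunI)
  then obtain B where B: "\<And>n. \<bar>G n n\<bar> \<le> B" unfolding Bseq_def by auto
  \<comment> \<open>The functional is applied to the differences without cut-off: cutting may create
    jumps at the ends of \<open>I\<close> and lead out of \<open>H1loc\<close>. The cut-off versions
    enter only through the seminorm.\<close>
  define d where "d = (\<lambda>n x. u n x + (-1) *\<^sub>R v x)"
  have d: "d n \<in> H1loc" for n unfolding d_def by (intro H1loc_add H1loc_scaleR u v)
  define d' where "d' = (\<lambda>n x. weak_deriv (u n) x + (-1) *\<^sub>R weak_deriv v x)"
  have dd': "has_weak_deriv (d n) (d' n)" for n
    unfolding d_def d'_def by (intro has_weak_deriv_add has_weak_deriv_scaleR H1locD u v)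
  have d'L: "d' n \<in> L2loc" for n unfolding d'_def by (intro L2loc_add L2loc_scaleR uL' vL')
  have ed: "e n = (\<lambda>x. indicator I x *\<^sub>R d n x)" "e' n = (\<lambda>x. indicator I x *\<^sub>R d' n x)" for n
    by (auto simp: e_def e'_def p_def p'_def q_def q'_def d_def d'_def scaleR_diff_right)
  have "(\<lambda>n. l (d n)) \<longlonglongrightarrow> 0"
  proof (rule gram_null_imp_functional_null[of G B _ "C\<^sup>2"])
    show "G i j = G j i" for i j by (simp add: G_def L2_inner_commute[of "e i"] L2_inner_commute[of "e' i"])
    fix N :: nat and k :: "nat \<Rightarrow> nat" and c :: "nat \<Rightarrow> real"
    define z z' where "z = (\<lambda>x. \<Sum>i<N. c i *\<^sub>R d (k i) x)" and "z' = (\<lambda>x. \<Sum>i<N. c i *\<^sub>R d' (k i) x)"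
    have zz': "has_weak_deriv z z'" unfolding z_def z'_def by (intro has_weak_deriv_sum has_weak_deriv_scaleR dd')
    have zL: "z \<in> L2loc" "z' \<in> L2loc"
      unfolding z_def z'_def by (intro L2loc_sum L2loc_scaleR d'L H1locD(1)[OF d])+
    have zH: "z \<in> H1loc" using zL zz' by (auto intro: H1locI)
    have lz: "l z = (\<Sum>i<N. c i * l (d (k i)))" unfolding z_def by (rule H1loc_dual_lincomb[OF l d])
    have "\<bar>l z\<bar>\<^sup>2 \<le> (C * H1_seminorm K z)\<^sup>2" by (intro power_mono C zH) simp
    then have "(l z)\<^sup>2 \<le> C\<^sup>2 * (H1_seminorm K z)\<^sup>2" by (simp add: power_mult_distrib)
    also have "(H1_seminorm K z)\<^sup>2 \<le> L2_inner (\<lambda>x. indicator I x *\<^sub>R z x) (\<lambda>x. indicator I x *\<^sub>R z x)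
        + L2_inner (\<lambda>x. indicator I x *\<^sub>R z' x) (\<lambda>x. indicator I x *\<^sub>R z' x)"
      unfolding H1_seminorm_square[OF zz' zL K] by (intro add_mono L2_inner_indicator_mono zL I K)
    also have "(\<lambda>x. indicator I x *\<^sub>R z x) = (\<lambda>x. \<Sum>i<N. c i *\<^sub>R e (k i) x)"
      by (simp add: z_def ed scaleR_sum_right mult.commute)
    also have "(\<lambda>x. indicator I x *\<^sub>R z' x) = (\<lambda>x. \<Sum>i<N. c i *\<^sub>R e' (k i) x)"
      by (simp add: z'_def ed scaleR_sum_right mult.commute)
    also have "L2_inner (\<lambda>x. \<Sum>i<N. c i *\<^sub>R e (k i) x) (\<lambda>x. \<Sum>i<N. c i *\<^sub>R e (k i) x)
        + L2_inner (\<lambda>x. \<Sum>i<N. c i *\<^sub>R e' (k i) x) (\<lambda>x. \<Sum>i<N. c i *\<^sub>R e' (k i) x)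
        = (\<Sum>i<N. \<Sum>j<N. c i * c j * G (k i) (k j))"
      using L2_inner_lincomb[of "{..<N}" "\<lambda>i. e (k i)" c] L2_inner_lincomb[of "{..<N}" "\<lambda>i. e' (k i)" c] e
      by (simp add: G_def distrib_left sum.distrib)
    finally show "(\<Sum>i<N. c i * l (d (k i)))\<^sup>2 \<le> C\<^sup>2 * (\<Sum>i<N. \<Sum>j<N. c i * c j * G (k i) (k j))"
      unfolding lz by (simp add: mult_left_mono)
  qed (use B limG in auto)
  moreover have "l (d n) = l (u n) - l v" for n
  proof -
    show ?thesis unfolding d_def
      using H1loc_dual_add[OF l u H1loc_scaleR[OF v, of "-1"]] H1loc_dual_scaleR[OF l v, of "-1"] by simp
  qed
  ultimately have "(\<lambda>n. l (u n) - l v) \<longlonglongrightarrow> 0" by simp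
  then show "(\<lambda>n. l (u n)) \<longlonglongrightarrow> l v" by (simp add: LIM_zero_iff)
qed

subsection \<open>The energies\<close>


lemma norm_square_vec2: "(norm (v::real^2))\<^sup>2 = (v $ 1)\<^sup>2 + (v $ 2)\<^sup>2"
  unfolding power2_norm_eq_inner by (simp add: inner_vec_def sum_2 power2_eq_square)

text \<open>Both quartic terms of the energy carry the same weight, so they are handled as a single
  density.\<close>

definition potential :: "real \<Rightarrow> real^2 \<Rightarrow> real" where
  "potential \<gamma> v = 1/2 * ((norm v)\<^sup>2 - 1)\<^sup>2 + (\<gamma> - 1) * (v $ 1)\<^sup>2 * (v $ 2)\<^sup>2"

lemma potential_nonneg: "\<gamma> > 1 \<Longrightarrow> potential \<gamma> v \<ge> 0"
  by (simp add: potential_def)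

lemma continuous_on_potential: "continuous_on UNIV (potential \<gamma>)"
  unfolding potential_def by (intro continuous_intros)

lemma potential_measurable [measurable]:
  "f \<in> borel_measurable M \<Longrightarrow> (\<lambda>x. potential \<gamma> (f x)) \<in> borel_measurable M"
  by (rule borel_measurable_continuous_on[OF continuous_on_potential])

lemma half_mult_ennreal: "(1/2) * x = ennreal (1/2) * x" for x :: ennreal
  by (metis divide_ennreal ennreal_1 ennreal_numeral zero_le_numeral zero_le_one zero_less_numeral)

lemma half_mult_le_iff_ennreal:
  assumes "C \<ge> 0" shows "(1/2) * x \<le> ennreal C \<longleftrightarrow> x \<le> ennreal (2 * C)"
proof
  have "ennreal 2 * ennreal (1/2) = 1" "ennreal (1/2) * ennreal 2 = 1"
    by (simp_all only: ennreal_mult[symmetric]) simp_all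
  then have 1: "ennreal 2 * ((1/2) * y) = y" "(1/2) * (ennreal 2 * y) = y" for y :: ennreal
    unfolding half_mult_ennreal mult.assoc[of "ennreal _" "ennreal _", symmetric] by simp_all
  show "x \<le> ennreal (2 * C)" if "(1/2) * x \<le> ennreal C"
    using mult_left_mono[OF that zero_le, of "ennreal 2"] assms by (simp only: 1 ennreal_mult)
  show "(1/2) * x \<le> ennreal C" if "x \<le> ennreal (2 * C)"
    using mult_left_mono[OF that zero_le, of "1/2"] assms by (simp only: 1 ennreal_mult)
qed

lemma J_eps_eq:
  assumes \<Phi>: "\<Phi> \<in> H1loc" and a: "(\<lambda>z. \<eta> (\<epsilon> * z)) \<in> borel_measurable lebesgue" and "\<gamma> > 1"
  shows "J_eps \<gamma> \<eta> \<epsilon> \<Phi> = (1/2) * ((\<integral>\<^sup>+z. ennreal ((\<eta> (\<epsilon> * z))\<^sup>2 * (norm (weak_deriv \<Phi> z))\<^sup>2) \<partial>lebesgue)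
    + (\<integral>\<^sup>+z. ennreal ((\<eta> (\<epsilon> * z))^4 * potential \<gamma> (\<Phi> z)) \<partial>lebesgue))"
proof -
  note [measurable] = a L2loc_measurable[OF H1locD(1)[OF \<Phi>]] L2loc_measurable[OF H1locD(3)[OF \<Phi>]]
  have "(\<eta> (\<epsilon> * z))\<^sup>2 * ((weak_deriv \<Phi> z $ 1)\<^sup>2 + (weak_deriv \<Phi> z $ 2)\<^sup>2)
     + 1/2 * (\<eta> (\<epsilon> * z))^4 * ((\<Phi> z $ 1)\<^sup>2 + (\<Phi> z $ 2)\<^sup>2 - 1)\<^sup>2
     + (\<gamma> - 1) * (\<eta> (\<epsilon> * z))^4 * (\<Phi> z $ 1)\<^sup>2 * (\<Phi> z $ 2)\<^sup>2
    = (\<eta> (\<epsilon> * z))\<^sup>2 * (norm (weak_deriv \<Phi> z))\<^sup>2 + (\<eta> (\<epsilon> * z))^4 * potential \<gamma> (\<Phi> z)" for z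
    unfolding potential_def norm_square_vec2 by (simp add: algebra_simps)
  then have "J_eps \<gamma> \<eta> \<epsilon> \<Phi> = (1/2) * (\<integral>\<^sup>+z. ennreal ((\<eta> (\<epsilon> * z))\<^sup>2 * (norm (weak_deriv \<Phi> z))\<^sup>2)
      + ennreal ((\<eta> (\<epsilon> * z))^4 * potential \<gamma> (\<Phi> z)) \<partial>lebesgue)"
    unfolding J_eps_def using potential_nonneg[OF \<open>\<gamma> > 1\<close>] by (simp add: ennreal_plus)
  then show ?thesis by (simp add: nn_integral_add)
qed

lemma J_0_eq:
  assumes \<Phi>: "\<Phi> \<in> H1loc" and "\<gamma> > 1"
  shows "J_0 \<gamma> \<Phi> = (1/2) * ((\<integral>\<^sup>+z. ennreal ((norm (weak_deriv \<Phi> z))\<^sup>2) \<partial>lebesgue)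
    + (\<integral>\<^sup>+z. ennreal (potential \<gamma> (\<Phi> z)) \<partial>lebesgue))"
proof -
  \<comment> \<open>The limit energy is the energy of the constant profile 1, so the splitting is
    inherited.\<close>
  have "J_0 \<gamma> \<Phi> = J_eps \<gamma> (\<lambda>_. 1) 1 \<Phi>" using \<Phi> by (simp add: J_0_def J_eps_def)
  then show ?thesis using J_eps_eq[OF \<Phi> _ \<open>\<gamma> > 1\<close>, of "\<lambda>_. 1" 1] by simp
qed

lemma ground_state_measurable:
  assumes "positive_ground_state \<epsilon> \<eta>" shows "(\<lambda>z. \<eta> (c * z)) \<in> borel_measurable lebesgue"
proof -
  from assms obtain \<eta>' where "\<And>x. (\<eta> has_real_derivative \<eta>' x) (at x)"
    unfolding positive_ground_state_def by blast
  then have "continuous_on UNIV \<eta>"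
    by (auto intro!: DERIV_continuous_on simp: has_field_derivative_at_within)
  then have "continuous_on UNIV (\<lambda>z. \<eta> (c * z))"
    by (rule continuous_on_compose2) (auto intro: continuous_intros)
  then have "(\<lambda>z. \<eta> (c * z)) \<in> borel_measurable lborel"
    using borel_measurable_continuous_onI by simp
  then show ?thesis by (rule measurable_completion)
qed

lemma liminf_add_ennreal:
  fixes f g :: "nat \<Rightarrow> ennreal"
  shows "liminf f + liminf g \<le> liminf (\<lambda>n. f n + g n)"
proof -
  have inc: "incseq (\<lambda>n. INF m\<in>{n..}. f m)" "incseq (\<lambda>n. INF m\<in>{n..}. g m)"
    by (auto intro!: incseq_SucI INF_superset_mono)
  have "liminf f + liminf g = (SUP n. (INF m\<in>{n..}. f m) + (INF m\<in>{n..}. g m))"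
    unfolding liminf_SUP_INF by (rule ennreal_SUP_add[OF inc, symmetric])
  also have "\<dots> \<le> liminf (\<lambda>n. f n + g n)"
    unfolding liminf_SUP_INF
    by (intro SUP_mono' INF_greatest add_mono INF_lower) auto
  finally show ?thesis .
qed

section \<open>Compactness and lower bound for the energies\<close>

text \<open>As \<open>\<gamma> > 1\<close>, all terms are nonnegative: kinetic and potential
  integrals are each at most \<open>2 * C\<close>, and the squared deviation of the squared norm
  from 1 is at most twice the potential, whence the common constant \<open>4 * C\<close>. The
  weighted convergence is exported because the lower bound relies on it.\<close>

lemma J_eps_compactness:
  fixes u :: "nat \<Rightarrow> real \<Rightarrow> real^2"
  assumes "\<gamma> > 1" and e: "\<And>n. e n > 0" "e \<longlonglongrightarrow> 0"
    and gs: "\<And>n. positive_ground_state (e n) (\<eta> n)" and u: "\<And>n. u n \<in> H1loc"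
    and J: "\<And>n. J_eps \<gamma> (\<eta> n) (e n) (u n) \<le> ennreal C" and "C \<ge> 0"
  obtains r v where "strict_mono r" "v \<in> H1loc" "weak_deriv v \<in> L2"
    "\<And>n. (\<lambda>x. \<eta> n (e n * x) *\<^sub>R weak_deriv (u n) x) \<in> L2"
    "\<And>w. w \<in> L2 \<Longrightarrow> (\<lambda>n. L2_inner (\<lambda>x. \<eta> (r n) (e (r n) * x) *\<^sub>R weak_deriv (u (r n)) x) w) \<longlonglongrightarrow> L2_inner (weak_deriv v) w"
    "weakly_tendsto_H1loc (\<lambda>n. u (r n)) v"
    "\<And>w R. w \<in> L2 \<Longrightarrow> \<forall>x. \<bar>x\<bar> > R \<longrightarrow> w x = 0 \<Longrightarrow>
      (\<lambda>n. L2_inner (weak_deriv (u (r n))) w) \<longlonglongrightarrow> L2_inner (weak_deriv v) w"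
proof -
  define a where "a = (\<lambda>n z. \<eta> n (e n * z))"
  have am: "a n \<in> borel_measurable lebesgue" for n
    unfolding a_def by (rule ground_state_measurable[OF gs])
  have a: "0 < a n x" "a n x \<le> 1" for n x
    using gs[of n] ground_state_le_1[OF e(1) gs] by (auto simp: a_def positive_ground_state_def)
  have a_lim: "\<forall>R. \<forall>\<theta><1. \<forall>\<^sub>F n in sequentially. \<forall>x. \<bar>x\<bar> \<le> R \<longrightarrow> \<theta> \<le> a n x"
    unfolding a_def using ground_state_tendsto_1[OF e gs] by blast
  have sum: "(\<integral>\<^sup>+x. ennreal ((a n x)\<^sup>2 * (norm (weak_deriv (u n) x))\<^sup>2) \<partial>lebesgue)
      + (\<integral>\<^sup>+x. ennreal ((a n x)^4 * potential \<gamma> (u n x)) \<partial>lebesgue) \<le> ennreal (2 * C)" for n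
    using J[of n] J_eps_eq[OF u[of n] ground_state_measurable[OF gs[of n], of "e n"] \<open>\<gamma> > 1\<close>] \<open>C \<ge> 0\<close>
    by (simp only: half_mult_le_iff_ennreal a_def)
  have bd: "(\<integral>\<^sup>+x. ennreal ((a n x)\<^sup>2 * (norm (weak_deriv (u n) x))\<^sup>2) \<partial>lebesgue) \<le> ennreal (4 * C)" for n
  proof -
    have "(\<integral>\<^sup>+x. ennreal ((a n x)\<^sup>2 * (norm (weak_deriv (u n) x))\<^sup>2) \<partial>lebesgue) \<le> ennreal (2 * C)"
      using sum[of n] by (rule order_trans[rotated]) simp
    also have "\<dots> \<le> ennreal (4 * C)" using \<open>C \<ge> 0\<close> by (intro ennreal_leI) simp
    finally show ?thesis .
  qed
  have bd4: "(\<integral>\<^sup>+x. ennreal ((a n x)^4 * ((norm (u n x))\<^sup>2 - 1)\<^sup>2) \<partial>lebesgue) \<le> ennreal (4 * C)" for n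
  proof -
    note [measurable] = am L2loc_measurable[OF H1locD(1)[OF u]]
    have "(\<integral>\<^sup>+x. ennreal ((a n x)^4 * ((norm (u n x))\<^sup>2 - 1)\<^sup>2) \<partial>lebesgue)
        \<le> (\<integral>\<^sup>+x. ennreal 2 * ennreal ((a n x)^4 * potential \<gamma> (u n x)) \<partial>lebesgue)"
    proof (rule nn_integral_mono)
      fix x
      have "((norm (u n x))\<^sup>2 - 1)\<^sup>2 \<le> 2 * potential \<gamma> (u n x)"
        using \<open>\<gamma> > 1\<close> by (simp add: potential_def)
      then have "(a n x)^4 * ((norm (u n x))\<^sup>2 - 1)\<^sup>2 \<le> (a n x)^4 * (2 * potential \<gamma> (u n x))"
        by (rule mult_left_mono) simp
      then have "ennreal ((a n x)^4 * ((norm (u n x))\<^sup>2 - 1)\<^sup>2) \<le> ennreal (2 * ((a n x)^4 * potential \<gamma> (u n x)))"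
        by (intro ennreal_leI) (simp add: mult.left_commute)
      then show "ennreal ((a n x)^4 * ((norm (u n x))\<^sup>2 - 1)\<^sup>2) \<le> ennreal 2 * ennreal ((a n x)^4 * potential \<gamma> (u n x))"
        using potential_nonneg[OF \<open>\<gamma> > 1\<close>] by (simp add: ennreal_mult)
    qed
    also have "\<dots> = ennreal 2 * (\<integral>\<^sup>+x. ennreal ((a n x)^4 * potential \<gamma> (u n x)) \<partial>lebesgue)"
      by (rule nn_integral_cmult) simp
    also have "\<dots> \<le> ennreal 2 * ennreal (2 * C)"
      using sum[of n] by (intro mult_left_mono) (auto intro: order_trans[rotated])
    also have "\<dots> = ennreal (4 * C)" using \<open>C \<ge> 0\<close> by (subst ennreal_mult[symmetric]) simp_all
    finally show ?thesis .
  qed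
  have "4 * C \<ge> 0" using \<open>C \<ge> 0\<close> by simp
  obtain r v where r: "strict_mono r" and v: "v \<in> H1loc" "weak_deriv v \<in> L2"
      and aL2: "\<And>n. (\<lambda>x. a n x *\<^sub>R weak_deriv (u n) x) \<in> L2"
      and w: "\<And>w. w \<in> L2 \<Longrightarrow> (\<lambda>n. L2_inner (\<lambda>x. a (r n) x *\<^sub>R weak_deriv (u (r n)) x) w) \<longlonglongrightarrow> L2_inner (weak_deriv v) w"
      and l: "\<And>w R. w \<in> L2 \<Longrightarrow> \<forall>x. \<bar>x\<bar> > R \<longrightarrow> w x = 0 \<Longrightarrow> (\<lambda>n. L2_inner (u (r n)) w) \<longlonglongrightarrow> L2_inner v w"
      and l': "\<And>w R. w \<in> L2 \<Longrightarrow> \<forall>x. \<bar>x\<bar> > R \<longrightarrow> w x = 0 \<Longrightarrow>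
        (\<lambda>n. L2_inner (weak_deriv (u (r n))) w) \<longlonglongrightarrow> L2_inner (weak_deriv v) w"
      and B: "\<And>R. \<exists>B. \<forall>\<^sub>F n in sequentially.
        L2_inner (\<lambda>x. indicator {-R..R} x *\<^sub>R u (r n) x) (\<lambda>x. indicator {-R..R} x *\<^sub>R u (r n) x) \<le> B \<and>
        L2_inner (\<lambda>x. indicator {-R..R} x *\<^sub>R weak_deriv (u (r n)) x) (\<lambda>x. indicator {-R..R} x *\<^sub>R weak_deriv (u (r n)) x) \<le> B"
    by (rule H1loc_compactness[OF u am a a_lim bd bd4 \<open>4 * C \<ge> 0\<close>]) (rule that)
  have wk: "weakly_tendsto_H1loc (\<lambda>n. u (r n)) v"
    by (rule weakly_tendsto_H1locI[OF u v(1) l l' B])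
  show ?thesis
    by (rule that[OF r v aL2[unfolded a_def] w[unfolded a_def] wk l'])
qed

text \<open>The lower bound in sequential form: along a sequence with energies at most
  \<open>C\<close>, the kinetic part is lower semicontinuous under weak convergence and the
  potential part obeys Fatou's lemma. A fixed bound is assumed instead of a limit inferior because
  the final argument refutes exactly such a sequence.\<close>

lemma J_eps_liminf_bound:
  fixes u :: "nat \<Rightarrow> real \<Rightarrow> real^2"
  assumes "\<gamma> > 1" and e: "\<And>n. e n > 0" "e \<longlonglongrightarrow> 0"
    and gs: "\<And>n. positive_ground_state (e n) (\<eta> n)" and u: "\<And>n. u n \<in> H1loc"
    and J: "\<And>n. J_eps \<gamma> (\<eta> n) (e n) (u n) \<le> ennreal C" and "C \<ge> 0"
    and \<Phi>: "\<Phi> \<in> L2loc"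
    and conv: "\<And>K. compact K \<Longrightarrow> (\<lambda>n. LINT x:K|lebesgue. (norm (u n x - \<Phi> x))\<^sup>2) \<longlonglongrightarrow> 0"
  shows "J_0 \<gamma> \<Phi> \<le> ennreal C"
proof -
  obtain r v where r: "strict_mono r" and v: "v \<in> H1loc" "weak_deriv v \<in> L2"
    and aL2: "\<And>n. (\<lambda>x. \<eta> n (e n * x) *\<^sub>R weak_deriv (u n) x) \<in> L2"
    and w: "\<And>w. w \<in> L2 \<Longrightarrow> (\<lambda>n. L2_inner (\<lambda>x. \<eta> (r n) (e (r n) * x) *\<^sub>R weak_deriv (u (r n)) x) w) \<longlonglongrightarrow> L2_inner (weak_deriv v) w"
    and l': "\<And>w R. w \<in> L2 \<Longrightarrow> \<forall>x. \<bar>x\<bar> > R \<longrightarrow> w x = 0 \<Longrightarrow>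
      (\<lambda>n. L2_inner (weak_deriv (u (r n))) w) \<longlonglongrightarrow> L2_inner (weak_deriv v) w"
    by (rule J_eps_compactness[OF \<open>\<gamma> > 1\<close> e gs u J \<open>C \<ge> 0\<close>]) (rule that)
  define a where "a = (\<lambda>n z. \<eta> n (e n * z))"
  have am[measurable]: "a n \<in> borel_measurable lebesgue" for n
    unfolding a_def by (rule ground_state_measurable[OF gs])
  have a: "0 < a n x" "a n x \<le> 1" for n x
    using gs[of n] ground_state_le_1[OF e(1) gs] by (auto simp: a_def positive_ground_state_def)
  note um[measurable] = L2loc_measurable[OF H1locD(1)[OF u]] and \<Phi>m[measurable] = L2loc_measurable[OF \<Phi>]
  have diffL2: "(\<lambda>x. indicator K x *\<^sub>R (u n x - \<Phi> x)) \<in> L2" if "compact K" for K n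
    using L2loc_indicator_L2[OF L2loc_add[OF H1locD(1)[OF u] L2loc_scaleR[OF \<Phi>, of "-1"]] that] by simp
  have conv': "(\<lambda>n. L2_inner (\<lambda>x. indicator K x *\<^sub>R (u n x - \<Phi> x)) (\<lambda>x. indicator K x *\<^sub>R (u n x - \<Phi> x))) \<longlonglongrightarrow> 0"
    if "compact K" for K
  proof -
    have "(LINT x:K|lebesgue. (norm (u n x - \<Phi> x))\<^sup>2)
      = L2_inner (\<lambda>x. indicator K x *\<^sub>R (u n x - \<Phi> x)) (\<lambda>x. indicator K x *\<^sub>R (u n x - \<Phi> x))" for n
      unfolding set_lebesgue_integral_def L2_inner_def
      by (intro Bochner_Integration.integral_cong) (auto simp: indicator_def power2_norm_eq_inner)
    then show ?thesis using conv[OF that] by simp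
  qed
  have lim: "(\<lambda>n. L2_inner (u n) w) \<longlonglongrightarrow> L2_inner \<Phi> w"
    if wL: "w \<in> L2" and w0: "\<forall>x. \<bar>x\<bar> > R \<longrightarrow> w x = 0" for w R
  proof -
    define I where "I = {-R..R}"
    have I: "compact I" by (simp add: I_def)
    have w0': "w x = 0" if "x \<notin> I" for x using that w0 by (auto simp: I_def)
    have "L2_inner (\<lambda>x. indicator I x *\<^sub>R (u n x - \<Phi> x)) w = L2_inner (u n) w - L2_inner \<Phi> w" for n
    proof -
      have "(\<lambda>x. indicator I x *\<^sub>R (u n x - \<Phi> x)) = (\<lambda>x. indicator I x *\<^sub>R u n x - indicator I x *\<^sub>R \<Phi> x)"
        by (simp add: scaleR_diff_right)
      then show ?thesis
        using L2_inner_diff_left[OF L2loc_indicator_L2[OF H1locD(1)[OF u] I] L2loc_indicator_L2[OF \<Phi> I] wL]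
        by (simp add: L2_inner_indicator_left w0')
    qed
    moreover have "(\<lambda>n. L2_inner (\<lambda>x. indicator I x *\<^sub>R (u n x - \<Phi> x)) w) \<longlonglongrightarrow> 0"
    proof (rule Lim_null_comparison)
      have "(\<lambda>n. sqrt (L2_inner (\<lambda>x. indicator I x *\<^sub>R (u n x - \<Phi> x)) (\<lambda>x. indicator I x *\<^sub>R (u n x - \<Phi> x)))
          * sqrt (L2_inner w w)) \<longlonglongrightarrow> sqrt 0 * sqrt (L2_inner w w)"
        by (intro tendsto_intros conv' I)
      then show "(\<lambda>n. sqrt (L2_inner (\<lambda>x. indicator I x *\<^sub>R (u n x - \<Phi> x)) (\<lambda>x. indicator I x *\<^sub>R (u n x - \<Phi> x)))
          * sqrt (L2_inner w w)) \<longlonglongrightarrow> 0" by simp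
      show "\<forall>\<^sub>F n in sequentially. norm (L2_inner (\<lambda>x. indicator I x *\<^sub>R (u n x - \<Phi> x)) w)
          \<le> sqrt (L2_inner (\<lambda>x. indicator I x *\<^sub>R (u n x - \<Phi> x)) (\<lambda>x. indicator I x *\<^sub>R (u n x - \<Phi> x))) * sqrt (L2_inner w w)"
        using L2_Cauchy_Schwarz[OF diffL2[OF I] wL] by simp
    qed
    ultimately show ?thesis by (simp add: LIM_zero_iff)
  qed
  have lim_r: "(\<lambda>n. L2_inner (u (r n)) w) \<longlonglongrightarrow> L2_inner \<Phi> w"
    if "w \<in> L2" "\<forall>x. \<bar>x\<bar> > R \<longrightarrow> w x = 0" for w R
    using LIMSEQ_subseq_LIMSEQ[OF lim[OF that] r] by (simp add: o_def)
  \<comment> \<open>The functions converge to \<open>\<Phi>\<close> and the derivatives to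
    \<open>weak_deriv v\<close>, so closedness applies directly and \<open>v\<close> need not be
    compared with \<open>\<Phi>\<close>.\<close>
  have wd: "has_weak_deriv \<Phi> (weak_deriv v)"
    by (rule has_weak_deriv_closed[OF H1locD(2)[OF u] L2loc_imp_L1loc[OF \<Phi>] L2loc_imp_L1loc[OF H1locD(3)[OF v(1)]] lim_r l'])
  have \<Phi>H: "\<Phi> \<in> H1loc" using \<Phi> H1locD(3)[OF v(1)] wd by (rule H1locI)
  have "(\<integral>\<^sup>+x. ennreal ((norm (weak_deriv \<Phi> x))\<^sup>2) \<partial>lebesgue) = (\<integral>\<^sup>+x. ennreal ((norm (weak_deriv v x))\<^sup>2) \<partial>lebesgue)"
    by (intro nn_integral_cong_AE eventually_mono[OF weak_deriv_AE_eq[OF wd]]) simp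
  also have "\<dots> = ennreal (L2_inner (weak_deriv v) (weak_deriv v))" by (rule nn_integral_eq_L2_inner[OF v(2)])
  finally have kin: "(\<integral>\<^sup>+x. ennreal ((norm (weak_deriv \<Phi> x))\<^sup>2) \<partial>lebesgue) = ennreal (L2_inner (weak_deriv v) (weak_deriv v))" .
  define A B where "A = (\<lambda>n. \<integral>\<^sup>+x. ennreal ((a n x)\<^sup>2 * (norm (weak_deriv (u n) x))\<^sup>2) \<partial>lebesgue)"
    and "B = (\<lambda>n. \<integral>\<^sup>+x. ennreal ((a n x)^4 * potential \<gamma> (u n x)) \<partial>lebesgue)"
  have AB: "A n + B n \<le> ennreal (2 * C)" for n
    using J[of n] J_eps_eq[OF u[of n] ground_state_measurable[OF gs[of n], of "e n"] \<open>\<gamma> > 1\<close>] \<open>C \<ge> 0\<close>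
    by (simp only: half_mult_le_iff_ennreal a_def A_def B_def)
  have Aeq: "A n = ennreal (L2_inner (\<lambda>x. a n x *\<^sub>R weak_deriv (u n) x) (\<lambda>x. a n x *\<^sub>R weak_deriv (u n) x))" for n
    using nn_integral_eq_L2_inner[OF aL2[of n]] by (simp add: A_def a_def power_mult_distrib)
  \<comment> \<open>Convergence in \<open>L2loc\<close> gives an almost everywhere convergent
    subsequence on one interval at a time, so the potential is truncated while the kinetic term is
    kept whole. The subsequence depends on \<open>R\<close>, the resulting bound does not.\<close>
  define W where "W = (\<lambda>R. \<integral>\<^sup>+x. ennreal (indicator {-R..R} x * potential \<gamma> (\<Phi> x)) \<partial>lebesgue)"
  have energy_le: "ennreal (L2_inner (weak_deriv v) (weak_deriv v)) + W R \<le> ennreal (2 * C)" for R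
  proof -
    define I where "I = {-R..R}"
    have I: "compact I" "I \<in> sets lebesgue" by (simp_all add: I_def)
    define h where "h = (\<lambda>n x. (norm (indicator I x *\<^sub>R (u (r n) x - \<Phi> x)))\<^sup>2)"
    have "integrable lebesgue (h n)" for n using diffL2[OF I(1), of "r n"] by (simp add: h_def L2_def)
    moreover have "(\<lambda>n. \<integral>x. norm (h n x) \<partial>lebesgue) \<longlonglongrightarrow> 0"
      using LIMSEQ_subseq_LIMSEQ[OF conv'[OF I(1)] r] by (simp add: h_def L2_inner_self o_def)
    \<comment> \<open>The squared distances tend to 0 in \<open>L1\<close>, which yields pointwise
      convergence along a subsequence.\<close>
    ultimately obtain s where s: "strict_mono s" "AE x in lebesgue. (\<lambda>n. h (s n) x) \<longlonglongrightarrow> 0"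
      using tendsto_L1_AE_subseq[of lebesgue h] by blast
    define q where "q = r \<circ> s"
    have q: "strict_mono q" unfolding q_def using r s(1) by (rule strict_mono_o)
    have kin_le: "ennreal (L2_inner (weak_deriv v) (weak_deriv v)) \<le> liminf (\<lambda>n. A (q n))"
      unfolding Aeq
    proof (rule L2_weak_lower_semicontinuous[OF _ v(2)])
      show "(\<lambda>x. a (q n) x *\<^sub>R weak_deriv (u (q n)) x) \<in> L2" for n using aL2 by (simp add: a_def)
      show "(\<lambda>n. L2_inner (\<lambda>x. a (q n) x *\<^sub>R weak_deriv (u (q n)) x) (weak_deriv v))
          \<longlonglongrightarrow> L2_inner (weak_deriv v) (weak_deriv v)"
        using LIMSEQ_subseq_LIMSEQ[OF w[OF v(2)] s(1)] by (simp add: q_def a_def o_def)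
    qed
    have a_to_1: "(\<lambda>n. a (q n) x) \<longlonglongrightarrow> 1" for x
    proof (rule LIMSEQ_subseq_LIMSEQ[OF _ q, unfolded o_def])
      show "(\<lambda>n. a n x) \<longlonglongrightarrow> 1"
      proof (rule order_tendstoI)
        fix \<theta> :: real
        show "\<forall>\<^sub>F n in sequentially. \<theta> < a n x" if "\<theta> < 1"
        proof -
          have "(\<theta> + 1) / 2 < 1" using that by simp
          from ground_state_tendsto_1[OF e gs this, of "\<bar>x\<bar>"] show ?thesis
            by eventually_elim (use that in \<open>force simp: a_def\<close>)
        qed
        show "\<forall>\<^sub>F n in sequentially. a n x < \<theta>" if "1 < \<theta>"
          using a(2)[of _ x] that by (intro always_eventually allI) (rule le_less_trans)
      qed
    qed
    have "W R \<le> (\<integral>\<^sup>+x. liminf (\<lambda>n. ennreal ((a (q n) x)^4 * potential \<gamma> (u (q n) x))) \<partial>lebesgue)"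
      unfolding W_def
    proof (rule nn_integral_mono_AE)
      show "AE x in lebesgue. ennreal (indicator {-R..R} x * potential \<gamma> (\<Phi> x))
          \<le> liminf (\<lambda>n. ennreal ((a (q n) x)^4 * potential \<gamma> (u (q n) x)))"
        using s(2)
      proof eventually_elim
        case (elim x)
        show ?case
        proof (cases "x \<in> I")
          case True
          have "(\<lambda>n. (norm (u (q n) x - \<Phi> x))\<^sup>2) \<longlonglongrightarrow> 0"
            using elim True by (simp add: h_def q_def)
          from tendsto_real_sqrt[OF this] have "(\<lambda>n. u (q n) x - \<Phi> x) \<longlonglongrightarrow> 0"
            by (simp add: tendsto_norm_zero_iff)
          then have "(\<lambda>n. u (q n) x) \<longlonglongrightarrow> \<Phi> x" by (simp add: LIM_zero_iff)
          then have "(\<lambda>n. potential \<gamma> (u (q n) x)) \<longlonglongrightarrow> potential \<gamma> (\<Phi> x)"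
            by (intro continuous_on_tendsto_compose[OF continuous_on_potential]) auto
          then have "(\<lambda>n. ennreal ((a (q n) x)^4 * potential \<gamma> (u (q n) x))) \<longlonglongrightarrow> ennreal (1^4 * potential \<gamma> (\<Phi> x))"
            by (intro tendsto_ennrealI tendsto_intros a_to_1)
          then have "liminf (\<lambda>n. ennreal ((a (q n) x)^4 * potential \<gamma> (u (q n) x))) = ennreal (1^4 * potential \<gamma> (\<Phi> x))"
            by (rule lim_imp_Liminf[OF trivial_limit_sequentially])
          then show ?thesis using True by (simp add: I_def)
        qed (simp add: I_def)
      qed
    qed
    also have "\<dots> \<le> liminf (\<lambda>n. B (q n))"
      unfolding B_def by (intro nn_integral_liminf) simp
    finally have pot_le: "W R \<le> liminf (\<lambda>n. B (q n))" .
    have "ennreal (L2_inner (weak_deriv v) (weak_deriv v)) + W R \<le> liminf (\<lambda>n. A (q n)) + liminf (\<lambda>n. B (q n))"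
      by (intro add_mono kin_le pot_le)
    also have "\<dots> \<le> liminf (\<lambda>n. A (q n) + B (q n))" by (rule liminf_add_ennreal)
    also have "\<dots> \<le> ennreal (2 * C)" by (intro Liminf_le always_eventually allI AB) simp
    finally show ?thesis .
  qed
  \<comment> \<open>Removes the truncation: at each point the truncated densities are eventually
    constant in \<open>n\<close>, so Fatou's lemma over growing intervals recovers the full
    potential.\<close>
  have "(\<integral>\<^sup>+x. ennreal (potential \<gamma> (\<Phi> x)) \<partial>lebesgue)
      = (\<integral>\<^sup>+x. liminf (\<lambda>n. ennreal (indicator {- real n..real n} x * potential \<gamma> (\<Phi> x))) \<partial>lebesgue)"
  proof (rule nn_integral_cong)
    fix x
    have "\<forall>\<^sub>F n in sequentially. \<bar>x\<bar> \<le> real n"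
      using eventually_ge_at_top[of "nat \<lceil>\<bar>x\<bar>\<rceil>"] by eventually_elim linarith
    then have "\<forall>\<^sub>F n in sequentially. ennreal (potential \<gamma> (\<Phi> x)) = ennreal (indicator {- real n..real n} x * potential \<gamma> (\<Phi> x))"
      by eventually_elim (auto simp: abs_le_iff minus_le_iff)
    then have "(\<lambda>n. ennreal (indicator {- real n..real n} x * potential \<gamma> (\<Phi> x))) \<longlonglongrightarrow> ennreal (potential \<gamma> (\<Phi> x))"
      by (rule Lim_transform_eventually[OF tendsto_const])
    then show "ennreal (potential \<gamma> (\<Phi> x)) = liminf (\<lambda>n. ennreal (indicator {- real n..real n} x * potential \<gamma> (\<Phi> x)))"
      by (rule lim_imp_Liminf[OF trivial_limit_sequentially, symmetric])
  qed
  also have "\<dots> \<le> liminf (\<lambda>n. W (real n))"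
    unfolding W_def by (intro nn_integral_liminf) (auto intro!: measurable_compose[OF _ measurable_ennreal] borel_measurable_times borel_measurable_indicator)
  finally have pot: "(\<integral>\<^sup>+x. ennreal (potential \<gamma> (\<Phi> x)) \<partial>lebesgue) \<le> liminf (\<lambda>n. W (real n))" .
  have "(\<integral>\<^sup>+z. ennreal ((norm (weak_deriv \<Phi> z))\<^sup>2) \<partial>lebesgue) + (\<integral>\<^sup>+z. ennreal (potential \<gamma> (\<Phi> z)) \<partial>lebesgue)
      \<le> liminf (\<lambda>n::nat. ennreal (L2_inner (weak_deriv v) (weak_deriv v))) + liminf (\<lambda>n. W (real n))"
    unfolding kin using pot by (intro add_mono) (simp_all add: Liminf_const)
  also have "\<dots> \<le> liminf (\<lambda>n. ennreal (L2_inner (weak_deriv v) (weak_deriv v)) + W (real n))"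
    by (rule liminf_add_ennreal)
  also have "\<dots> \<le> ennreal (2 * C)" by (intro Liminf_le always_eventually allI energy_le) simp
  finally show ?thesis unfolding J_0_eq[OF \<Phi>H \<open>\<gamma> > 1\<close>] half_mult_le_iff_ennreal[OF \<open>C \<ge> 0\<close>] .
qed


text \<open>\<open>\<epsilon>\<^sub>0\<close> makes smallness precise. As the parameter is
  continuous, compactness is asserted along every sequence of parameters tending to 0, while both
  inequalities use the filter \<open>at_right 0\<close>; the lower one is reduced to sequences by
  contradiction.\<close>

theorem theorem1:
  fixes \<gamma> \<epsilon>\<^sub>0 :: real
    and \<eta> :: "real \<Rightarrow> real \<Rightarrow> real"
    and \<Phi>\<^sub>\<epsilon> :: "real \<Rightarrow> real \<Rightarrow> real^2"
  assumes "\<gamma> > 1"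
    and "\<epsilon>\<^sub>0 > 0"
    and "\<And>\<epsilon>. 0 < \<epsilon> \<Longrightarrow> \<epsilon> < \<epsilon>\<^sub>0 \<Longrightarrow> positive_ground_state \<epsilon> (\<eta> \<epsilon>)"
    and "\<And>\<epsilon>. 0 < \<epsilon> \<Longrightarrow> \<epsilon> < \<epsilon>\<^sub>0 \<Longrightarrow> \<Phi>\<^sub>\<epsilon> \<epsilon> \<in> H1loc"
  shows
    "((\<exists>C::real. \<forall>\<epsilon>. 0 < \<epsilon> \<and> \<epsilon> < \<epsilon>\<^sub>0 \<longrightarrow> J_eps \<gamma> (\<eta> \<epsilon>) \<epsilon> (\<Phi>\<^sub>\<epsilon> \<epsilon>) \<le> ennreal C) \<longrightarrow>
       (\<forall>e. (\<forall>n::nat. 0 < e n \<and> e n < \<epsilon>\<^sub>0) \<and> e \<longlonglongrightarrow> 0 \<longrightarrow>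
          (\<exists>r \<Phi>. strict_mono r \<and> \<Phi> \<in> H1loc \<and>
             weakly_tendsto_H1loc (\<lambda>n. \<Phi>\<^sub>\<epsilon> (e (r n))) \<Phi>)))
     \<and>
     (\<forall>\<Phi>. tendsto_L2loc \<Phi>\<^sub>\<epsilon> \<Phi> (at_right 0) \<longrightarrow>
        Liminf (at_right 0) (\<lambda>\<epsilon>. J_eps \<gamma> (\<eta> \<epsilon>) \<epsilon> (\<Phi>\<^sub>\<epsilon> \<epsilon>)) \<ge> J_0 \<gamma> \<Phi>)
     \<and>
     (\<forall>\<Phi>\<in>H1loc. \<exists>\<Psi>. (\<forall>\<epsilon>>0. \<Psi> \<epsilon> \<in> H1loc) \<and> tendsto_L2loc \<Psi> \<Phi> (at_right 0) \<and>
        Limsup (at_right 0) (\<lambda>\<epsilon>. J_eps \<gamma> (\<eta> \<epsilon>) \<epsilon> (\<Psi> \<epsilon>)) \<le> J_0 \<gamma> \<Phi>)"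
proof (intro conjI impI allI ballI)
  fix e :: "nat \<Rightarrow> real"
  assume "\<exists>C::real. \<forall>\<epsilon>. 0 < \<epsilon> \<and> \<epsilon> < \<epsilon>\<^sub>0 \<longrightarrow> J_eps \<gamma> (\<eta> \<epsilon>) \<epsilon> (\<Phi>\<^sub>\<epsilon> \<epsilon>) \<le> ennreal C"
  then obtain C :: real where C: "\<And>\<epsilon>. 0 < \<epsilon> \<Longrightarrow> \<epsilon> < \<epsilon>\<^sub>0 \<Longrightarrow> J_eps \<gamma> (\<eta> \<epsilon>) \<epsilon> (\<Phi>\<^sub>\<epsilon> \<epsilon>) \<le> ennreal C"
    by blast
  assume "(\<forall>n. 0 < e n \<and> e n < \<epsilon>\<^sub>0) \<and> e \<longlonglongrightarrow> 0"
  then have e: "\<And>n. 0 < e n" "\<And>n. e n < \<epsilon>\<^sub>0" "e \<longlonglongrightarrow> 0" by auto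
  \<comment> \<open>\<open>ennreal\<close> sends a negative \<open>C\<close> to 0, so the bound may
    be made nonnegative.\<close>
  have J: "J_eps \<gamma> (\<eta> (e n)) (e n) (\<Phi>\<^sub>\<epsilon> (e n)) \<le> ennreal (max C 0)" for n
    using C[OF e(1,2), of n] by (rule order_trans) (simp add: ennreal_leI)
  have "0 \<le> max C 0" by simp
  from J_eps_compactness[OF assms(1) e(1,3) assms(3)[OF e(1,2)] assms(4)[OF e(1,2)] J this]
  show "\<exists>r \<Phi>. strict_mono r \<and> \<Phi> \<in> H1loc \<and> weakly_tendsto_H1loc (\<lambda>n. \<Phi>\<^sub>\<epsilon> (e (r n))) \<Phi>"
    by metis
next
  fix \<Phi> assume lim: "tendsto_L2loc \<Phi>\<^sub>\<epsilon> \<Phi> (at_right 0)"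
  show "J_0 \<gamma> \<Phi> \<le> Liminf (at_right 0) (\<lambda>\<epsilon>. J_eps \<gamma> (\<eta> \<epsilon>) \<epsilon> (\<Phi>\<^sub>\<epsilon> \<epsilon>))"
    unfolding le_Liminf_iff
  proof (intro allI impI, rule ccontr)
    fix y assume y: "y < J_0 \<gamma> \<Phi>"
    assume "\<not> (\<forall>\<^sub>F \<epsilon> in at_right 0. y < J_eps \<gamma> (\<eta> \<epsilon>) \<epsilon> (\<Phi>\<^sub>\<epsilon> \<epsilon>))"
    \<comment> \<open>If the energy does not eventually exceed \<open>y\<close>, parameters
      arbitrarily close to 0 have energy at most \<open>y\<close>; they supply the sequence to which
      the sequential bound applies.\<close>
    then have ex: "\<exists>\<epsilon>. 0 < \<epsilon> \<and> \<epsilon> < b \<and> J_eps \<gamma> (\<eta> \<epsilon>) \<epsilon> (\<Phi>\<^sub>\<epsilon> \<epsilon>) \<le> y" if "b > 0" for b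
      using that unfolding eventually_at_right_field by (meson not_less)
    have "\<forall>n. \<exists>\<epsilon>. 0 < \<epsilon> \<and> \<epsilon> < min \<epsilon>\<^sub>0 (1 / real (Suc n)) \<and> J_eps \<gamma> (\<eta> \<epsilon>) \<epsilon> (\<Phi>\<^sub>\<epsilon> \<epsilon>) \<le> y"
      using \<open>\<epsilon>\<^sub>0 > 0\<close> by (intro allI ex) simp
    then obtain e where e: "\<And>n. 0 < e n" "\<And>n. e n < min \<epsilon>\<^sub>0 (1 / real (Suc n))"
      "\<And>n. J_eps \<gamma> (\<eta> (e n)) (e n) (\<Phi>\<^sub>\<epsilon> (e n)) \<le> y" by metis
    have e_less: "e n < \<epsilon>\<^sub>0" for n using e(2)[of n] by simp
    have e_lim: "e \<longlonglongrightarrow> 0"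
    proof (rule Lim_null_comparison)
      show "(\<lambda>n. 1 / real (Suc n)) \<longlonglongrightarrow> 0" by (rule LIMSEQ_Suc[OF lim_const_over_n])
      show "\<forall>\<^sub>F n in sequentially. norm (e n) \<le> 1 / real (Suc n)"
        using e(1,2) by (intro always_eventually allI) (simp add: less_imp_le)
    qed
    have e_right: "filterlim e (at_right 0) sequentially"
      using e(1) e_lim by (intro tendsto_imp_filterlim_at_right) auto
    \<comment> \<open>Strictly below some value, \<open>y\<close> is finite and can serve as the
      real energy bound.\<close>
    have "y < top" using y by (rule order_less_le_trans) simp
    then have yC: "y = ennreal (enn2real y)" by simp
    have "J_0 \<gamma> \<Phi> \<le> ennreal (enn2real y)"
    proof (rule J_eps_liminf_bound[OF assms(1) e(1) e_lim assms(3)[OF e(1) e_less] assms(4)[OF e(1) e_less]])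
      show "J_eps \<gamma> (\<eta> (e n)) (e n) (\<Phi>\<^sub>\<epsilon> (e n)) \<le> ennreal (enn2real y)" for n using e(3) yC by simp
      show "\<Phi> \<in> L2loc" using lim by (simp add: tendsto_L2loc_def)
      show "(\<lambda>n. LINT x:K|lebesgue. (norm (\<Phi>\<^sub>\<epsilon> (e n) x - \<Phi> x))\<^sup>2) \<longlonglongrightarrow> 0" if "compact K" for K
        using filterlim_compose[OF _ e_right] lim that unfolding tendsto_L2loc_def by blast
    qed simp
    then show False using y yC by simp
  qed
next
  fix \<Phi> :: "real \<Rightarrow> real^2" assume \<Phi>: "\<Phi> \<in> H1loc"
  have "tendsto_L2loc (\<lambda>_. \<Phi>) \<Phi> (at_right (0::real))"
    using H1locD(1)[OF \<Phi>] by (simp add: tendsto_L2loc_def set_lebesgue_integral_def)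
  moreover have "Limsup (at_right 0) (\<lambda>\<epsilon>. J_eps \<gamma> (\<eta> \<epsilon>) \<epsilon> \<Phi>) \<le> J_0 \<gamma> \<Phi>"
  proof (rule Limsup_bounded)
    have "\<forall>\<^sub>F \<epsilon> in at_right 0. \<epsilon> \<in> {0<..<\<epsilon>\<^sub>0}" using \<open>\<epsilon>\<^sub>0 > 0\<close> by (rule eventually_at_right_real)
    then show "\<forall>\<^sub>F \<epsilon> in at_right 0. J_eps \<gamma> (\<eta> \<epsilon>) \<epsilon> \<Phi> \<le> J_0 \<gamma> \<Phi>"
    proof eventually_elim
      case (elim \<epsilon>)
      then have \<epsilon>: "0 < \<epsilon>" and gs: "positive_ground_state \<epsilon> (\<eta> \<epsilon>)" using assms(3) by auto
      have \<eta>: "0 \<le> \<eta> \<epsilon> x" "\<eta> \<epsilon> x \<le> 1" for x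
        using gs ground_state_le_1[OF \<epsilon> gs] by (auto simp: positive_ground_state_def less_imp_le)
      \<comment> \<open>With a profile between 0 and 1 each weighted density lies below the
        unweighted one, so the constant family has energy at most \<open>J_0\<close> for every small
        parameter.\<close>
      show ?case
        unfolding J_eps_eq[OF \<Phi> ground_state_measurable[OF gs] assms(1)] J_0_eq[OF \<Phi> assms(1)]
        using \<eta> potential_nonneg[OF assms(1)]
        by (intro mult_left_mono add_mono nn_integral_mono ennreal_leI mult_left_le_one_le)
          (auto simp: power_le_one)
    qed
  qed
  ultimately show "\<exists>\<Psi>. (\<forall>\<epsilon>>0. \<Psi> \<epsilon> \<in> H1loc) \<and> tendsto_L2loc \<Psi> \<Phi> (at_right 0) \<and>
      Limsup (at_right 0) (\<lambda>\<epsilon>. J_eps \<gamma> (\<eta> \<epsilon>) \<epsilon> (\<Psi> \<epsilon>)) \<le> J_0 \<gamma> \<Phi>"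
    using \<Phi> by (intro exI[of _ "\<lambda>_. \<Phi>"]) simp
qed

end
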